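(* Let $d=1$. Suppose that $\mathbb P^{X} = \mathbb P^{g^{*}(Z)}$ for some $g^{*} \in \mathcal G(d_Z,d_g,\beta,K)$ and that $\mathbb P^{X}$ is continuous (its distribution function $F_X$ is continuous). Let $\mathcal E\in\mathbb N$, $\phi_n=(n\mathcal E)^{-\frac{2\beta}{2\beta+d_g}}$, and for some $\gamma\ge1$ let $a_n=n^{-\frac{2\gamma}{2\gamma+1}}$. Assume: (a) $L_f\ge\log_2(n)\log_2(4\vee4\gamma)$, $\min_{i=1,\dots,L_f}p_{f,i}\gtrsim na_n$, $s_f\gtrsim\log(n)\,na_n$ (constants depending on $\gamma$); (b) $F\ge K\vee1$; $\log_2(n\mathcal E)\log_2(4d_g\vee4\beta)\le L_g\lesssim\log(n\mathcal E)$; $\min_{i=1,\dots,L_g}p_{g,i}\gtrsim n\mathcal E\phi_n$; $s_g\asymp n\mathcal E\phi_n\log(n\mathcal E)$; $L_f\le L_g$, $s_f\le s_g$; (c) there exist constants $\kappa>1,\alpha>1$ with $\beta_X(k)\le\kappa k^{-\alpha}$ for all $k\in\mathbb N$. Let $\hat g_n$ be the unconditional WGAN estimator and $\hat F_{N,n}(x) = \frac{1}{N}\sum_{j=1}^{N}\mathbf 1_{\{\hat g_n(Z_j^{*}) \le x\}}$. Then for any $\rho > 0$, $$\limsup_{n\to\infty}\limsup_{N\to\infty}\mathbb P\big(|\hat F_{N,n}(X) - F_X(X)| \ge \rho\big) = 0.$$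
   Context: Notation: $a_n\lesssim b_n$ means $a_n\le Cb_n$ for a constant $C>0$ not depending on $n$; $\gtrsim$ is the reverse, and $\asymp$ means both. Data: $(X_i)_{i\in\mathbb Z}$ is a strictly stationary process with values in $[0,1]^d$ (here $d=1$), observed for $i=1,\dots,n$; $X$ denotes a random variable with the distribution of $X_1$. $\mathbb P^Z$ is a known distribution on $[0,1]^{d_Z}$, $Z\sim\mathbb P^Z$; $Z_{i,j}$, $i=1,\dots,n$, $j=1,\dots,\mathcal E$, are i.i.d. from $\mathbb P^Z$, independent of the $X_i$; $Z_1^*,\dots,Z_N^*$ are i.i.d. from $\mathbb P^Z$, independent of the $X_i$ and $Z_{i,j}$. Mixing: for $\sigma$-algebras $\mathcal U,\mathcal V$, $\beta(\mathcal U,\mathcal V)=\frac12\sup\sum_{i,j}|\mathbb P(U_i\cap V_j)-\mathbb P(U_i)\mathbb P(V_j)|$, the supremum over all finite $\mathcal U$-measurable partitions $(U_i)$ and $\mathcal V$-measurable partitions $(V_j)$. $\beta_X(0)=1$, $\beta_X(k)=\beta(\sigma(X_i;i\le0),\sigma(X_i;i\ge k))$, $k\in\mathbb N$. Hölder classes: for $T\subset\mathbb R^r$, $\beta\ge1$, $K>0$, $C^\beta(T,K)$ is the set of $f:T\to\mathbb R$ with $\sum_{0\le|\alpha|<\beta}\|\partial^\alpha f\|_\infty+\sum_{|\alpha|=\beta-1}\sup_{x\ne y}\frac{|\partial^\alpha f(x)-\partial^\alpha f(y)|}{|x-y|_\infty}\le K$. $\mathcal G(d_Z,d_g,\beta,K)$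 is the set of measurable $g:\mathbb R^{d_Z}\to\mathbb R^d$ such that each component depends only on $d_g$ of its arguments and lies in $C^\beta([0,1]^{d_Z},K)$. Networks: $\sigma(x)=\max\{x,0\}$, $\sigma_v(x)=\sigma(x-v)$ componentwise. For $L\in\mathbb N$, $\mathbf p=(p_0,\dots,p_{L+1})\in\mathbb N^{L+2}$, $s>0$, $F>0$, $\mathcal R(L,\mathbf p,s)=\mathcal R(L,\mathbf p,s,F)$ is the set of $h:\mathbb R^{p_0}\to\mathbb R^{p_{L+1}}$ of the form $h(x)=W^{(L)}\sigma_{v^{(L)}}W^{(L-1)}\cdots W^{(1)}\sigma_{v^{(1)}}W^{(0)}x$ with $W^{(l)}\in\mathbb R^{p_{l+1}\times p_l}$, $v^{(l)}\in\mathbb R^{p_l}$, all entries bounded by 1 in absolute value, at most $s$ nonzero entries in total, and $\sup_{x\in[0,1]^{p_0}}|h(x)|_\infty\le F$. Generators: $\mathcal R(L_g,\mathbf p_g,s_g)$ with $p_{g,0}=d_Z$, $p_{g,L_g+1}=d$. Critics: $\mathcal R(L_f,\mathbf p_f,s_f)$ with $p_{f,0}=d$, $p_{f,L_f+1}=1$. All parameters may depend on $n$. $\|f\|_L$ is the Lipschitz constant with respect to the Euclidean norm. The estimator $\hat g_n$ is a minimizer over $g\in\mathcal R(L_g,\mathbf p_g,s_g)$ of $\hat W_{1,n}(g)=\sup_{f\in\mathcal R(L_f,\mathbf p_f,s_f),\|f\|_L\le1}\frac1n\sum_{i=1}^n\{f(X_i)-\frac1{\mathcal E}\sum_{j=1}^{\mathcal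 E}f(g(Z_{i,j}))\}$. *)

theory Defs
  imports "HOL-Probability.Probability" "HOL-Library.Landau_Symbols" "HOL-Library.Disjoint_Sets"
begin

text \<open>
  A point of \<open>r\<close>-dimensional Euclidean space is a function \<open>nat \<Rightarrow> real\<close> whose coordinates are
  those with index below \<open>r\<close>. The dimensions are numbers rather than types because the layer
  widths of the networks vary with the sample size. As a set (and as a measurable space) the
  \<open>r\<close>-dimensional space is the extensional product over \<open>{..<r}\<close>.
\<close>

abbreviation Rvec :: "nat \<Rightarrow> (nat \<Rightarrow> real) measure" where
  "Rvec r \<equiv> PiM {..<r} (\<lambda>_. borel)"

definition cube :: "nat \<Rightarrow> (nat \<Rightarrow> real) set" where
  "cube r = PiE {..<r} (\<lambda>_. {0..1})"

definition linf_dist :: "nat \<Rightarrow> (nat \<Rightarrow> real) \<Rightarrow> (nat \<Rightarrow> real) \<Rightarrow> real" where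
  "linf_dist r x y = (MAX i\<in>{..<r}. \<bar>x i - y i\<bar>)"

definition vec1 :: "real \<Rightarrow> nat \<Rightarrow> real" where
  "vec1 x = (\<lambda>i\<in>{..<1}. x)"

definition multi_indices :: "nat \<Rightarrow> (nat \<Rightarrow> nat) set" where
  "multi_indices r = {\<alpha>. \<forall>i\<ge>r. \<alpha> i = 0}"

definition degree_of :: "nat \<Rightarrow> (nat \<Rightarrow> nat) \<Rightarrow> nat" where
  "degree_of r \<alpha> = (\<Sum>i<r. \<alpha> i)"

definition has_partial_on ::
  "(nat \<Rightarrow> real) set \<Rightarrow> nat \<Rightarrow> ((nat \<Rightarrow> real) \<Rightarrow> real) \<Rightarrow> ((nat \<Rightarrow> real) \<Rightarrow> real) \<Rightarrow> bool" where
  "has_partial_on T i f f' \<longleftrightarrow>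
     (\<forall>x\<in>T. ((\<lambda>t. f (x(i := t))) has_real_derivative f' x) (at (x i) within {t. x(i := t) \<in> T}))"

text \<open>
  \<open>D \<alpha>\<close> is the partial derivative of \<open>f\<close> on \<open>T\<close> for the multi-index \<open>\<alpha>\<close> (on a cube it is determined
  by \<open>f\<close>); all those of order less than \<open>\<beta>\<close> have to exist. The suprema are taken in
  \<open>ennreal\<close>, so that an unbounded derivative has norm infinity. Multi-indices with
  \<open>\<bar>\<alpha>\<bar> = \<beta> - 1\<close> exist only for integer \<open>\<beta>\<close>.
\<close>

definition holder_class ::
  "nat \<Rightarrow> (nat \<Rightarrow> real) set \<Rightarrow> real \<Rightarrow> real \<Rightarrow> ((nat \<Rightarrow> real) \<Rightarrow> real) set" where
  "holder_class r T \<beta> K = {f. \<exists>D :: (nat \<Rightarrow> nat) \<Rightarrow> (nat \<Rightarrow> real) \<Rightarrow> real.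
     (\<forall>x\<in>T. D (\<lambda>_. 0) x = f x) \<and>
     (\<forall>\<alpha>\<in>multi_indices r. \<forall>i<r. real (degree_of r \<alpha>) + 1 < \<beta> \<longrightarrow>
        has_partial_on T i (D \<alpha>) (D (\<alpha>(i := Suc (\<alpha> i))))) \<and>
     (\<Sum>\<alpha>\<in>{\<alpha>\<in>multi_indices r. real (degree_of r \<alpha>) < \<beta>}. SUP x\<in>T. ennreal \<bar>D \<alpha> x\<bar>)
     + (\<Sum>\<alpha>\<in>{\<alpha>\<in>multi_indices r. real (degree_of r \<alpha>) = \<beta> - 1}.
          SUP (x, y)\<in>{(x, y). x \<in> T \<and> y \<in> T \<and> x \<noteq> y}.
            ennreal (\<bar>D \<alpha> x - D \<alpha> y\<bar> / linf_dist r x y))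
     \<le> ennreal K}"

text \<open>For one-dimensional output (\<open>d = 1\<close>), hence real-valued.\<close>

definition generator_class ::
  "nat \<Rightarrow> nat \<Rightarrow> real \<Rightarrow> real \<Rightarrow> ((nat \<Rightarrow> real) \<Rightarrow> real) set" where
  "generator_class dZ dg \<beta> K = {g \<in> borel_measurable (Rvec dZ).
     (\<exists>I\<subseteq>{..<dZ}. card I = dg \<and>
        (\<forall>x\<in>space (Rvec dZ). \<forall>y\<in>space (Rvec dZ). (\<forall>i\<in>I. x i = y i) \<longrightarrow> g x = g y)) \<and>
     g \<in> holder_class dZ (cube dZ) \<beta> K}"

definition generators ::
  "'w measure \<Rightarrow> 'b measure \<Rightarrow> ('i \<Rightarrow> 'w \<Rightarrow> 'b) \<Rightarrow> 'i set \<Rightarrow> 'w set set" where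
  "generators M N X I = (\<Union>i\<in>I. {X i -` A \<inter> space M | A. A \<in> sets N})"

definition beta_coeff :: "'w measure \<Rightarrow> 'w set set \<Rightarrow> 'w set set \<Rightarrow> real" where
  "beta_coeff M \<U> \<V> = (1/2) * Sup {(\<Sum>U\<in>P. \<Sum>V\<in>Q. \<bar>measure M (U \<inter> V) - measure M U * measure M V\<bar>) | P Q.
     finite P \<and> P \<subseteq> \<U> \<and> partition_on (space M) P \<and>
     finite Q \<and> Q \<subseteq> \<V> \<and> partition_on (space M) Q}"

definition beta_mixing :: "'w measure \<Rightarrow> (int \<Rightarrow> 'w \<Rightarrow> real) \<Rightarrow> nat \<Rightarrow> real" where
  "beta_mixing M X k =
     (if k = 0 then 1
      else beta_coeff M (sigma_sets (space M) (generators M borel X {..0}))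
                        (sigma_sets (space M) (generators M borel X {int k..})))"

definition strictly_stationary :: "'w measure \<Rightarrow> (int \<Rightarrow> 'w \<Rightarrow> real) \<Rightarrow> bool" where
  "strictly_stationary M X \<longleftrightarrow>
     (\<forall>i. X i \<in> borel_measurable M) \<and>
     (\<forall>J h. finite J \<longrightarrow>
        distr M (PiM J (\<lambda>_. borel)) (\<lambda>\<omega>. \<lambda>i\<in>J. X (i + h) \<omega>) =
        distr M (PiM J (\<lambda>_. borel)) (\<lambda>\<omega>. \<lambda>i\<in>J. X i \<omega>))"

text \<open>
  \<open>net_eval p W v L\<close> is \<open>W\<^sup>L \<sigma>\<^bsub>v L\<^esub> W\<^sup>L\<^sup>-\<^sup>1 \<dots> W\<^sup>1 \<sigma>\<^bsub>v 1\<^esub> W\<^sup>0\<close>, where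
  \<open>W l i j\<close> is the entry in row \<open>i\<close> and column \<open>j\<close> of the \<open>p (l + 1) \<times> p l\<close> matrix of layer \<open>l\<close>.
\<close>

primrec net_eval ::
  "(nat \<Rightarrow> nat) \<Rightarrow> (nat \<Rightarrow> nat \<Rightarrow> nat \<Rightarrow> real) \<Rightarrow> (nat \<Rightarrow> nat \<Rightarrow> real) \<Rightarrow> nat
    \<Rightarrow> (nat \<Rightarrow> real) \<Rightarrow> nat \<Rightarrow> real" where
  "net_eval p W v 0 x = (\<lambda>i. \<Sum>j<p 0. W 0 i j * x j)"
| "net_eval p W v (Suc l) x =
     (\<lambda>i. \<Sum>j<p (Suc l). W (Suc l) i j * max (net_eval p W v l x j - v (Suc l) j) 0)"

definition networks ::
  "nat \<Rightarrow> (nat \<Rightarrow> nat) \<Rightarrow> real \<Rightarrow> real \<Rightarrow> ((nat \<Rightarrow> real) \<Rightarrow> nat \<Rightarrow> real) set" where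
  "networks L p s F = {h. \<exists>W v.
     h = (\<lambda>x. \<lambda>i\<in>{..<p (Suc L)}. net_eval p W v L x i) \<and>
     (\<forall>l\<le>L. \<forall>i<p (Suc l). \<forall>j<p l. \<bar>W l i j\<bar> \<le> 1) \<and>
     (\<forall>l\<in>{1..L}. \<forall>i<p l. \<bar>v l i\<bar> \<le> 1) \<and>
     real (card {(l, i, j). l \<le> L \<and> i < p (Suc l) \<and> j < p l \<and> W l i j \<noteq> 0}
           + card {(l, i). l \<in> {1..L} \<and> i < p l \<and> v l i \<noteq> 0}) \<le> s \<and>
     (\<forall>x\<in>cube (p 0). \<forall>i<p (Suc L). \<bar>h x i\<bar> \<le> F)}"

text \<open>
  For \<open>d = 1\<close>. The Lipschitz condition is on the whole real line, since generators may take values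
  outside the unit interval. The set over which the supremum is taken is then bounded above,
  and it is nonempty as the zero network is a critic.
\<close>

definition lip1_critics :: "((nat \<Rightarrow> real) \<Rightarrow> nat \<Rightarrow> real) set \<Rightarrow> ((nat \<Rightarrow> real) \<Rightarrow> nat \<Rightarrow> real) set" where
  "lip1_critics C = {f \<in> C. 1-lipschitz_on UNIV (\<lambda>x. f (vec1 x) 0)}"

definition empirical_W1 ::
  "((nat \<Rightarrow> real) \<Rightarrow> nat \<Rightarrow> real) set \<Rightarrow> nat \<Rightarrow> nat \<Rightarrow> (nat \<Rightarrow> real) \<Rightarrow> (nat \<Rightarrow> nat \<Rightarrow> nat \<Rightarrow> real)
    \<Rightarrow> ((nat \<Rightarrow> real) \<Rightarrow> nat \<Rightarrow> real) \<Rightarrow> real" where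
  "empirical_W1 C \<E> n x z g =
     (SUP f\<in>lip1_critics C.
        (1 / real n) * (\<Sum>i=1..n. f (vec1 (x i)) 0 - (1 / real \<E>) * (\<Sum>j=1..\<E>. f (g (z i j)) 0)))"

definition data_algebra ::
  "'w measure \<Rightarrow> nat \<Rightarrow> nat \<Rightarrow> (int \<Rightarrow> 'w \<Rightarrow> real) \<Rightarrow> (nat \<Rightarrow> nat \<Rightarrow> 'w \<Rightarrow> nat \<Rightarrow> real) \<Rightarrow> nat
    \<Rightarrow> 'w measure" where
  "data_algebra M dZ \<E> X Z n =
     sigma (space M) (generators M borel X {1..int n} \<union>
                      generators M (Rvec dZ) (\<lambda>(i, j). Z i j) ({1..n} \<times> {1..\<E>}))"

definition empirical_cdf ::
  "((nat \<Rightarrow> real) \<Rightarrow> nat \<Rightarrow> real) \<Rightarrow> (nat \<Rightarrow> nat \<Rightarrow> real) \<Rightarrow> nat \<Rightarrow> real \<Rightarrow> real" where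
  "empirical_cdf g zs N x = (1 / real N) * (\<Sum>j=1..N. indicator {..x} (g (zs j) 0))"

text \<open>
  \<open>rate \<beta> k m = m\<^sup>- \<^sup>2\<^sup>\<beta>\<^sup>/\<^sup>(\<^sup>2\<^sup>\<beta>\<^sup>+\<^sup>k\<^sup>)\<close>, so that \<open>\<phi>\<^sub>n = rate \<beta> d\<^sub>g (n \<E>)\<close> and \<open>a\<^sub>n = rate \<gamma> 1 n\<close>.
\<close>

definition rate :: "real \<Rightarrow> real \<Rightarrow> nat \<Rightarrow> real" where
  "rate \<beta> k m = real m powr (- (2 * \<beta> / (2 * \<beta> + k)))"

end

theory Submission
  imports Defs "HOL-Real_Asymp.Real_Asymp"
begin

text \<open>
  Only consistency is claimed, so no approximation rate is needed. The true generator is Lipschitz,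
  hence uniformly close to a fixed ReLU network (a McShane extension from a finite grid), which
  belongs to the generator class for all large \<open>n\<close>. There the objective is small, uniformly over
  1-Lipschitz critics, since the empirical distribution functions of the \<open>X\<^sub>i\<close> (by mixing) and of
  \<open>g\<^sup>*(Z\<^sub>i\<^sub>j)\<close> (by independence) are close to \<open>F\<^sub>X\<close>; hence it is small at the estimator. Differences of
  two shifted ReLUs are critics for large \<open>n\<close>; with the fluctuation over the generator class controlled
  by Hoeffding's inequality on a finite cover of cardinality \<open>exp (o(n))\<close>, they bound the distribution
  function of the estimator at grid points by \<open>F\<^sub>X\<close>, up to one grid step. As \<open>F\<^sub>X\<close> is continuous,
  closeness on the grid is uniform; so the evaluation point may even depend on the sample \<open>Z\<^sup>*\<close>.
\<close>

section \<open>Straight-line ReLU programs\<close>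

text \<open>The grid size \<open>m\<close> is chosen from \<open>\<rho>\<close> and the modulus of
  continuity of the distribution function before the sample size enters. The approximating program,
  the ramps and the tolerances are therefore constant in \<open>n\<close>, and the lower bounds on
  depth, width and sparsity serve to fit networks of constant size into architectures whose depth is
  prescribed: values have to be carried through all layers, at a cost linear in the depth, that is,
  logarithmic in the sample size.

  Two restrictions shape the constructions. Weights are bounded by 1, so large coefficients are
  obtained by repeating neurons. Critics are 1-Lipschitz, so a ramp over a cell of length
  \<open>1 / m\<close> has height only \<open>1 / m\<close>, and tolerances are of order
  \<open>\<rho> / m\<close>.

  The minimiser depends on the same \<open>Z i j\<close> over which it is averaged, hence the
  uniform bound over the generators. Widths are bounded only from below, so the cover counts nonzero
  parameters after dead neurons are removed; its logarithm is sublinear because the sparsity is, up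
  to a logarithm, \<open>n * \<E>\<close> to the power
  \<open>dg / (2 * \<beta> + dg) < 1\<close>.\<close>

definition slp :: "nat \<Rightarrow> ((nat \<Rightarrow> real) \<Rightarrow> real) list \<Rightarrow> bool" where
  "slp r fs \<longleftrightarrow> r \<le> length fs \<and> (\<forall>i<r. fs ! i = (\<lambda>x. x i)) \<and>
     (\<forall>i. r \<le> i \<longrightarrow> i < length fs \<longrightarrow> (\<exists>c b. (\<forall>j. \<bar>c j\<bar> \<le> 1) \<and> \<bar>b\<bar> \<le> 1 \<and>
        fs ! i = (\<lambda>x. max ((\<Sum>j<i. c j * (fs ! j) x) - b) 0)))"

lemma slp_start: "slp r (map (\<lambda>i x. x i) [0..<r])"
  by (auto simp: slp_def)

text \<open>Each neuron refers to smaller indices only, so appending disturbs no existing entry.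
  Programs grow at the end, and indices into them stay valid.\<close>

lemma slp_snoc:
  assumes "slp r fs" "\<And>j. \<bar>c j\<bar> \<le> 1" "\<bar>b\<bar> \<le> 1"
  shows "slp r (fs @ [\<lambda>x. max ((\<Sum>j<length fs. c j * (fs ! j) x) - b) 0])"
  unfolding slp_def
proof (intro conjI allI impI)
  show "r \<le> length (fs @ [\<lambda>x. max ((\<Sum>j<length fs. c j * (fs ! j) x) - b) 0])"
    using assms(1) by (simp add: slp_def)
  fix i
  let ?gs = "fs @ [\<lambda>x. max ((\<Sum>j<length fs. c j * (fs ! j) x) - b) 0]"
  show "?gs ! i = (\<lambda>x. x i)" if "i < r"
    using assms(1) that by (auto simp: slp_def nth_append)
  assume i: "r \<le> i" "i < length ?gs"
  show "\<exists>c b. (\<forall>j. \<bar>c j\<bar> \<le> 1) \<and> \<bar>b\<bar> \<le> 1 \<and>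
      ?gs ! i = (\<lambda>x. max ((\<Sum>j<i. c j * (?gs ! j) x) - b) 0)"
  proof (cases "i < length fs")
    case True
    then obtain c' b' where "\<forall>j. \<bar>c' j\<bar> \<le> 1" "\<bar>b'\<bar> \<le> 1"
      "fs ! i = (\<lambda>x. max ((\<Sum>j<i. c' j * (fs ! j) x) - b') 0)"
      using assms(1) i by (auto simp: slp_def)
    with True show ?thesis
      by (intro exI[of _ c'] exI[of _ b']) (auto simp: nth_append fun_eq_iff)
  next
    case False
    with i have "i = length fs" by simp
    with assms(2,3) show ?thesis
      by (intro exI[of _ c] exI[of _ b]) (auto simp: nth_append fun_eq_iff)
  qed
qed

lemma slp_nonneg:
  assumes "slp r fs" "i < length fs" "x \<in> cube r"
  shows "(fs ! i) x \<ge> 0"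
proof (cases "i < r")
  case True
  with assms(1) have "(fs ! i) x = x i" by (auto simp: slp_def)
  with assms(3) True show ?thesis by (auto simp: cube_def PiE_iff)
next
  case False
  with assms(1,2) obtain c b where "fs ! i = (\<lambda>x. max ((\<Sum>j<i. c j * (fs ! j) x) - b) 0)"
    unfolding slp_def by (meson not_less)
  then show ?thesis by (metis max.cobounded2)
qed

text \<open>
  Layer \<open>l \<ge> 1\<close> carries the first \<open>r + (l - 1)\<close> functions of the program and computes one
  more; the identity on nonnegative numbers is a ReLU unit, so values can be passed on unchanged.
\<close>

lemma slp_network:
  assumes slp: "slp r fs" and c: "\<And>j. \<bar>c j\<bar> \<le> 1"
    and L: "L > length fs - r" and p: "p 0 = r" "p (Suc L) = 1"
    and width: "\<And>l. l \<in> {1..L} \<Longrightarrow> p l \<ge> length fs"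
    and s: "2 * real (Suc L) * real (Suc (length fs))^2 \<le> s"
    and f: "\<And>x. x \<in> cube r \<Longrightarrow> f x = (\<Sum>j<length fs. c j * (fs ! j) x)"
    and F: "\<And>x. x \<in> cube r \<Longrightarrow> \<bar>f x\<bar> \<le> F"
  shows "\<exists>h\<in>networks L p s F. \<forall>x\<in>cube r. h x 0 = f x"
proof -
  define n where "n = length fs"
  have rn: "r \<le> n" and fs_in: "\<And>i x. i < r \<Longrightarrow> (fs ! i) x = x i"
    using slp by (auto simp: slp_def n_def)
  have "\<forall>i. \<exists>c b. r \<le> i \<longrightarrow> i < n \<longrightarrow> ((\<forall>j. \<bar>c j\<bar> \<le> 1) \<and> \<bar>b\<bar> \<le> 1 \<and>
        fs ! i = (\<lambda>x. max ((\<Sum>j<i. c j * (fs ! j) x) - b) 0))"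
    using slp unfolding slp_def n_def by blast
  then have "\<exists>C B. \<forall>i. r \<le> i \<longrightarrow> i < n \<longrightarrow> ((\<forall>j. \<bar>C i j\<bar> \<le> 1) \<and> \<bar>B i\<bar> \<le> 1 \<and>
        fs ! i = (\<lambda>x. max ((\<Sum>j<i. C i j * (fs ! j) x) - B i) 0))"
    unfolding choice_iff .
  then obtain C B where CB: "\<And>i. r \<le> i \<Longrightarrow> i < n \<Longrightarrow> ((\<forall>j. \<bar>C i j\<bar> \<le> 1) \<and> \<bar>B i\<bar> \<le> 1 \<and>
        fs ! i = (\<lambda>x. max ((\<Sum>j<i. C i j * (fs ! j) x) - B i) 0))"
    by blast
  \<comment> \<open>Row \<open>r + (l - 1)\<close> of \<open>W l\<close> is the neuron created in
    layer \<open>l + 1\<close>; its threshold \<open>B\<close> sits at that layer, hence the shift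
    by 2 in \<open>v\<close>. For \<open>l = 0\<close> the truncated subtraction makes the copying
    rows exactly the \<open>r\<close> inputs.\<close>
  define W where "W l i j = (if l = L then (if i = 0 \<and> j < n then c j else 0)
      else if i \<ge> n \<or> j \<ge> n then 0
      else if i < r + (l - 1) then (if i = j then 1 else 0)
      else if l \<ge> 1 \<and> i = r + (l - 1) then (if j < i then C i j else 0) else (0::real))" for l i j
  define v where "v l i = (if i < n \<and> l \<ge> 2 \<and> i = r + (l - 2) then B i else (0::real))" for l i :: nat
  have L0: "L > 0" using L by simp
  let ?A = "{(l, i, j). l \<le> L \<and> i < p (Suc l) \<and> j < p l \<and> W l i j \<noteq> 0}" and ?V = "{(l, i). l \<in> {1..L} \<and> i < p l \<and> v l i \<noteq> 0}"
  \<comment> \<open>\<open>net_eval\<close> yields values before activation, so the invariant is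
    stated for the ReLU output that the next layer reads.\<close>
  have state: "max (net_eval p W v l x i - v (Suc l) i) 0 = (fs ! i) x"
    if "x \<in> cube r" "l < L" "i < n" "i < r + l" for x l i
    using that(2-)
  proof (induction l arbitrary: i)
    case 0
    then have "net_eval p W v 0 x i = (\<Sum>j<r. if i = j then x j else 0)"
      unfolding net_eval.simps p using rn L0 0 by (intro sum.cong) (auto simp: W_def)
    also have "\<dots> = x i" using 0 by simp
    finally show ?case using 0 fs_in slp_nonneg[OF slp, of i x] that(1)
      by (simp add: v_def n_def)
  next
    case (Suc l)
    have wid: "n \<le> p (Suc l)" using width[of "Suc l"] Suc.prems by (simp add: n_def)
    let ?a = "\<lambda>j. max (net_eval p W v l x j - v (Suc l) j) 0"
    show ?case
    proof (cases "i < r + l")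
      case True
      have "net_eval p W v (Suc l) x i = (\<Sum>j<p (Suc l). if i = j then ?a j else 0)"
        unfolding net_eval.simps using Suc.prems True by (intro sum.cong) (auto simp: W_def)
      also have "\<dots> = ?a i" using Suc.prems wid by simp
      also have "\<dots> = (fs ! i) x" using Suc True by simp
      finally have "net_eval p W v (Suc l) x i = (fs ! i) x" .
      moreover have "v (Suc (Suc l)) i = 0" using True by (simp add: v_def)
      ultimately show ?thesis using slp_nonneg[OF slp, of i x] that(1) Suc.prems
        by (simp add: n_def del: net_eval.simps)
    next
      case False
      with Suc.prems have i: "i = r + l" by simp
      have "net_eval p W v (Suc l) x i = (\<Sum>j<i. C i j * ?a j)"
        unfolding net_eval.simps using Suc.prems wid i
        by (intro sum.mono_neutral_cong_right) (auto simp: W_def)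
      also have "\<dots> = (\<Sum>j<i. C i j * (fs ! j) x)"
        using Suc i by (intro sum.cong) auto
      finally have "net_eval p W v (Suc l) x i = (\<Sum>j<i. C i j * (fs ! j) x)" .
      moreover have "v (Suc (Suc l)) i = B i" using i Suc.prems by (simp add: v_def)
      ultimately show ?thesis using CB[of i] Suc.prems i by (simp del: net_eval.simps)
    qed
  qed
  define h where "h = (\<lambda>x. \<lambda>i\<in>{..<p (Suc L)}. net_eval p W v L x i)"
  have h: "h x 0 = f x" if x: "x \<in> cube r" for x
  proof -
    obtain l where l: "L = Suc l" using L0 gr0_implies_Suc by blast
    have wid: "n \<le> p L" using width[of L] L0 by (simp add: n_def)
    have "h x 0 = net_eval p W v L x 0" by (simp add: h_def p)
    also have "\<dots> = (\<Sum>j<n. c j * max (net_eval p W v l x j - v (Suc l) j) 0)"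
      unfolding l net_eval.simps using wid l
      by (intro sum.mono_neutral_cong_right) (auto simp: W_def)
    \<comment> \<open>Here \<open>L > length fs - r\<close> gives \<open>r + l \<ge> n\<close>:
      every program entry is present in the last hidden layer.\<close>
    also have "\<dots> = (\<Sum>j<n. c j * (fs ! j) x)"
      using L l x state[of x l] by (intro sum.cong) (auto simp: n_def)
    finally show ?thesis using f x by (simp add: n_def)
  qed
  \<comment> \<open>The widths \<open>p\<close> may be far larger than \<open>n\<close>, but nonzero
    weights are confined to indices up to \<open>n\<close>, so the count is independent of
    \<open>p\<close>.\<close>
  have card1: "card ?A \<le> Suc L * (Suc n * Suc n)"
  proof -
    have "?A \<subseteq> {..L} \<times> {..n} \<times> {..n}"
    proof -
      have "W l i j = 0" if "i > n \<or> j > n" for l i j using that unfolding W_def by auto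
      then have "W l i j \<noteq> 0 \<Longrightarrow> i \<le> n \<and> j \<le> n" for l i j using not_less by blast
      then show ?thesis by auto
    qed
    then have "card ?A
        \<le> card ({..L} \<times> {..n} \<times> {..n})" by (intro card_mono) auto
    then show ?thesis by (simp add: card_cartesian_product)
  qed
  have card2: "card ?V \<le> Suc L * Suc n"
  proof -
    have "?V \<subseteq> {..L} \<times> {..n}"
      by (auto simp: v_def split: if_splits)
    then have "card ?V \<le> card ({..L} \<times> {..n})"
      by (intro card_mono) auto
    then show ?thesis by (simp add: card_cartesian_product)
  qed
  have "real (Suc L * (Suc n * Suc n)) + real (Suc L * Suc n) \<le> 2 * real (Suc L) * real (Suc n)^2"
  proof -
    have "Suc L * Suc n \<le> Suc L * (Suc n * Suc n)" by (rule mult_le_mono2) simp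
    then have "real (Suc L * Suc n) \<le> real (Suc L * (Suc n * Suc n))" by (rule of_nat_mono)
    then show ?thesis by (simp add: power2_eq_square algebra_simps)
  qed
  with card1 card2 s have sparse: "real (card ?A
           + card ?V) \<le> s"
    unfolding n_def[symmetric] of_nat_add by linarith
  have "h \<in> networks L p s F"
    unfolding networks_def
  proof (rule CollectI, intro exI conjI)
    show "h = (\<lambda>x. \<lambda>i\<in>{..<p (Suc L)}. net_eval p W v L x i)" by (rule h_def)
    show "\<forall>l\<le>L. \<forall>i<p (Suc l). \<forall>j<p l. \<bar>W l i j\<bar> \<le> 1"
      using c CB by (auto simp: W_def)
    show "\<forall>l\<in>{1..L}. \<forall>i<p l. \<bar>v l i\<bar> \<le> 1"
      using CB by (auto simp: v_def)
    show "\<forall>x\<in>cube (p 0). \<forall>i<p (Suc L). \<bar>h x i\<bar> \<le> F"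
      using h F by (auto simp: p)
  qed (rule sparse)
  with h show ?thesis by blast
qed

text \<open>The output layer of a network has no ReLU. A computed function is therefore a
  combination of entries with coefficients bounded by 1 and may be negative, unlike the entries
  themselves.\<close>

definition slp_extends :: "nat \<Rightarrow> ((nat \<Rightarrow> real) \<Rightarrow> real) \<Rightarrow> ((nat \<Rightarrow> real) \<Rightarrow> real) list \<Rightarrow> bool" where
  "slp_extends r f fs \<longleftrightarrow> (\<exists>hs c. slp r (fs @ hs) \<and> (\<forall>j. \<bar>c j\<bar> \<le> 1) \<and>
     (\<forall>x\<in>cube r. f x = (\<Sum>j<length (fs @ hs). c j * ((fs @ hs) ! j) x)))"

text \<open>Quantifying over every starting program lets the programs of several functions be
  concatenated: the second is run as a continuation of the first, without renumbering.\<close>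

definition slp_fun :: "nat \<Rightarrow> ((nat \<Rightarrow> real) \<Rightarrow> real) \<Rightarrow> bool" where
  "slp_fun r f \<longleftrightarrow> (\<forall>fs. slp r fs \<longrightarrow> slp_extends r f fs)"

text \<open>An output combination is turned into a single entry, which later entries can use with
  one coefficient of size 1.\<close>

lemma slp_fun_relu_neuron:
  assumes "slp_fun r f" "slp r fs"
  shows "\<exists>hs. hs \<noteq> [] \<and> slp r (fs @ hs) \<and> (\<forall>x\<in>cube r. last hs x = max (f x) 0)"
proof -
  obtain hs c where *: "slp r (fs @ hs)" "\<And>j. \<bar>c j\<bar> \<le> 1"
    "\<And>x. x \<in> cube r \<Longrightarrow> f x = (\<Sum>j<length (fs @ hs). c j * ((fs @ hs) ! j) x)"
    using assms unfolding slp_fun_def slp_extends_def by blast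
  from slp_snoc[OF *(1,2), of 0] *(3) show ?thesis
    by (intro exI[of _ "hs @ [\<lambda>x. max ((\<Sum>j<length (fs @ hs). c j * ((fs @ hs) ! j) x) - 0) 0]"])
       (simp del: length_append)
qed

lemma slp_fun_cong: "slp_fun r f \<Longrightarrow> (\<And>x. x \<in> cube r \<Longrightarrow> f x = g x) \<Longrightarrow> slp_fun r g"
  unfolding slp_fun_def slp_extends_def by simp

lemma slp_fun_scale:
  assumes "slp_fun r f" "\<bar>t\<bar> \<le> 1"
  shows "slp_fun r (\<lambda>x. t * f x)"
  unfolding slp_fun_def
proof (intro allI impI)
  fix fs assume "slp r fs"
  with assms(1) obtain hs c where *: "slp r (fs @ hs)" "\<And>j. \<bar>c j\<bar> \<le> 1"
    "\<And>x. x \<in> cube r \<Longrightarrow> f x = (\<Sum>j<length (fs @ hs). c j * ((fs @ hs) ! j) x)"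
    unfolding slp_fun_def slp_extends_def by blast
  have "\<bar>t * c j\<bar> \<le> 1" for j
    using *(2)[of j] assms(2) by (simp add: abs_mult mult_le_one)
  with * show "slp_extends r (\<lambda>x. t * f x) fs"
      unfolding slp_extends_def
    by (intro exI[of _ hs] exI[of _ "\<lambda>j. t * c j"]) (simp add: sum_distrib_left mult.assoc)
qed

lemma slp_fun_uminus: "slp_fun r f \<Longrightarrow> slp_fun r (\<lambda>x. - f x)"
  using slp_fun_scale[of r f "-1"] by simp

lemma slp_fun_relu:
  assumes "slp_fun r f"
  shows "slp_fun r (\<lambda>x. max (f x) 0)"
  unfolding slp_fun_def
proof (intro allI impI)
  fix fs assume "slp r fs"
  from slp_fun_relu_neuron[OF assms this] obtain hs where
    *: "hs \<noteq> []" "slp r (fs @ hs)" "\<And>x. x \<in> cube r \<Longrightarrow> last hs x = max (f x) 0" by blast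
  let ?k = "length (fs @ hs) - 1"
  have "(\<Sum>j<length (fs @ hs). (if j = ?k then 1 else 0) * ((fs @ hs) ! j) x) = last hs x" for x
  proof -
    have "(\<Sum>j<length (fs @ hs). (if j = ?k then 1 else 0) * ((fs @ hs) ! j) x)
        = (\<Sum>j<length (fs @ hs). if j = ?k then ((fs @ hs) ! j) x else 0)"
      by (intro sum.cong) auto
    also have "\<dots> = ((fs @ hs) ! ?k) x" using *(1) by simp
    also have "\<dots> = last hs x" using *(1) by (metis append_is_Nil_conv last_appendR last_conv_nth)
    finally show ?thesis .
  qed
  with * show "slp_extends r (\<lambda>x. max (f x) 0) fs"
      unfolding slp_extends_def
    by (intro exI[of _ hs] exI[of _ "\<lambda>j. if j = ?k then 1 else 0"]) auto
qed

text \<open>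
  The positive and negative parts of both summands are put into separate neurons, so that the
  coefficients of the sum are again bounded by 1.
\<close>

lemma slp_fun_add:
  assumes f: "slp_fun r f" and g: "slp_fun r g"
  shows "slp_fun r (\<lambda>x. f x + g x)"
  unfolding slp_fun_def
proof (intro allI impI)
  fix fs assume "slp r fs"
  from slp_fun_relu_neuron[OF f this] obtain h1 where h1: "h1 \<noteq> []" "slp r (fs @ h1)"
    "\<And>x. x \<in> cube r \<Longrightarrow> last h1 x = max (f x) 0" by blast
  from slp_fun_relu_neuron[OF slp_fun_uminus[OF f] h1(2)] obtain h2 where h2: "h2 \<noteq> []"
    "slp r ((fs @ h1) @ h2)" "\<And>x. x \<in> cube r \<Longrightarrow> last h2 x = max (- f x) 0" by blast
  from slp_fun_relu_neuron[OF g h2(2)] obtain h3 where h3: "h3 \<noteq> []"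
    "slp r (((fs @ h1) @ h2) @ h3)" "\<And>x. x \<in> cube r \<Longrightarrow> last h3 x = max (g x) 0" by blast
  from slp_fun_relu_neuron[OF slp_fun_uminus[OF g] h3(2)] obtain h4 where h4: "h4 \<noteq> []"
    "slp r ((((fs @ h1) @ h2) @ h3) @ h4)" "\<And>x. x \<in> cube r \<Longrightarrow> last h4 x = max (- g x) 0" by blast
  define hs where "hs = h1 @ h2 @ h3 @ h4"
  define k1 where "k1 = length fs + length h1 - 1"
  define k2 where "k2 = length fs + length h1 + length h2 - 1"
  define k3 where "k3 = length fs + length h1 + length h2 + length h3 - 1"
  define k4 where "k4 = length fs + length h1 + length h2 + length h3 + length h4 - 1"
  have pos: "length h1 > 0" "length h2 > 0" "length h3 > 0" "length h4 > 0"
    using h1(1) h2(1) h3(1) h4(1) by auto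
  have ord: "k1 < k2" "k2 < k3" "k3 < k4" "k4 < length (fs @ hs)"
    unfolding k1_def k2_def k3_def k4_def hs_def length_append using pos by linarith+
  have last_nth: "(xs @ ys @ zs) ! (length xs + length ys - 1) = last ys" if "ys \<noteq> []"
    for xs ys zs :: "((nat \<Rightarrow> real) \<Rightarrow> real) list"
  proof -
    have "length ys > 0" using that by simp
    then have "length xs + length ys - 1 = length xs + (length ys - 1)" by linarith
    with that show ?thesis by (simp add: nth_append last_conv_nth)
  qed
  have nth: "(fs @ hs) ! k1 = last h1" "(fs @ hs) ! k2 = last h2" "(fs @ hs) ! k3 = last h3"
      "(fs @ hs) ! k4 = last h4"
    using last_nth[of h1 fs "h2 @ h3 @ h4"] last_nth[of h2 "fs @ h1" "h3 @ h4"]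
      last_nth[of h3 "fs @ h1 @ h2" h4] last_nth[of h4 "fs @ h1 @ h2 @ h3" "[]"]
      h1(1) h2(1) h3(1) h4(1)
    by (simp_all add: k1_def k2_def k3_def k4_def hs_def add.assoc)
  define c where "c j = (if j = k1 then 1 else if j = k2 then -1 else if j = k3 then 1
      else if j = k4 then -1 else (0::real))" for j
  have "f x + g x = (\<Sum>j<length (fs @ hs). c j * ((fs @ hs) ! j) x)" if x: "x \<in> cube r" for x
  proof -
    have "(\<Sum>j<length (fs @ hs). c j * ((fs @ hs) ! j) x) = (\<Sum>j\<in>{k1,k2,k3,k4}. c j * ((fs @ hs) ! j) x)"
      using ord by (intro sum.mono_neutral_right) (auto simp: c_def)
    also have "\<dots> = last h1 x - last h2 x + last h3 x - last h4 x"
      using ord by (simp add: c_def nth)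
    also have "\<dots> = f x + g x" using h1(3)[OF x] h2(3)[OF x] h3(3)[OF x] h4(3)[OF x] by auto
    finally show ?thesis by simp
  qed
  then show "slp_extends r (\<lambda>x. f x + g x) fs"
      unfolding slp_extends_def using h4(2) by (intro exI[of _ hs] exI[of _ c]) (auto simp: hs_def c_def)
qed

lemma slp_fun_diff: "slp_fun r f \<Longrightarrow> slp_fun r g \<Longrightarrow> slp_fun r (\<lambda>x. f x - g x)"
  using slp_fun_add[OF _ slp_fun_uminus, of r f g] by simp

lemma slp_fun_zero: "slp_fun r (\<lambda>x. 0)"
  unfolding slp_fun_def slp_extends_def by (intro allI impI exI[of _ "[]"] exI[of _ "\<lambda>_. 0"]) simp

lemma slp_fun_sum: "finite A \<Longrightarrow> (\<And>a. a \<in> A \<Longrightarrow> slp_fun r (f a)) \<Longrightarrow> slp_fun r (\<lambda>x. \<Sum>a\<in>A. f a x)"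
  by (induction A rule: finite_induct) (auto intro: slp_fun_zero slp_fun_add)

text \<open>A coefficient above 1 is not an admissible weight; it is split into \<open>m\<close>
  equal admissible parts, which are added.\<close>

lemma slp_fun_cmult:
  assumes "slp_fun r f"
  shows "slp_fun r (\<lambda>x. t * f x)"
proof -
  obtain n :: nat where n: "\<bar>t\<bar> \<le> n" using real_arch_simple by blast
  define m where "m = Suc n"
  have m: "\<bar>t / m\<bar> \<le> 1" "m > 0" using n by (auto simp: m_def field_simps abs_divide)
  have "slp_fun r (\<lambda>x. \<Sum>a<m. (t / m) * f x)"
    by (intro slp_fun_sum slp_fun_scale assms m) simp
  moreover have "(\<lambda>x. \<Sum>a<m. (t / m) * f x) = (\<lambda>x. t * f x)"
    using m(2) by (simp add: fun_eq_iff)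
  ultimately show ?thesis by simp
qed

text \<open>A neuron with zero weights and threshold -1 outputs 1; the rest is scaling.\<close>

lemma slp_fun_const: "slp_fun r (\<lambda>x. t)"
proof -
  have "slp_fun r (\<lambda>x. 1)"
    unfolding slp_fun_def
  proof (intro allI impI)
    fix fs assume "slp r fs"
    from slp_snoc[OF this, of "\<lambda>_. 0" "-1"]
    have "slp r (fs @ [\<lambda>x. 1])" by simp
    moreover have "(\<Sum>j<length (fs @ [\<lambda>x. 1]). (if j = length fs then 1 else 0) * ((fs @ [\<lambda>x. 1]) ! j) x) = 1"
      for x :: "nat \<Rightarrow> real" by (simp add: nth_append)
    ultimately show "slp_extends r (\<lambda>x. 1) fs"
      unfolding slp_extends_def
      by (intro exI[of _ "[\<lambda>x. 1]"] exI[of _ "\<lambda>j. if j = length fs then 1 else 0"]) auto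
  qed
  from slp_fun_cmult[OF this, of t] show ?thesis by simp
qed

lemma slp_fun_coord:
  assumes "i < r"
  shows "slp_fun r (\<lambda>x. x i)"
  unfolding slp_fun_def
proof (intro allI impI)
  fix fs assume *: "slp r fs"
  have "(\<Sum>j<length fs. (if j = i then 1 else 0) * (fs ! j) x) = x i" for x
  proof -
    have "(\<Sum>j<length fs. (if j = i then 1 else 0) * (fs ! j) x)
        = (\<Sum>j<length fs. if j = i then (fs ! j) x else 0)"
      by (intro sum.cong) auto
    then show ?thesis using * assms by (auto simp: slp_def)
  qed
  with * show "slp_extends r (\<lambda>x. x i) fs"
      unfolding slp_extends_def
    by (intro exI[of _ "[]"] exI[of _ "\<lambda>j. if j = i then 1 else 0"]) auto
qed

lemma slp_fun_abs: "slp_fun r f \<Longrightarrow> slp_fun r (\<lambda>x. \<bar>f x\<bar>)"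
  by (rule slp_fun_cong[where f = "\<lambda>x. max (f x) 0 + max (- f x) 0"])
    (auto intro!: slp_fun_add slp_fun_relu slp_fun_uminus)

lemma slp_fun_min: "slp_fun r f \<Longrightarrow> slp_fun r g \<Longrightarrow> slp_fun r (\<lambda>x. min (f x) (g x))"
  by (rule slp_fun_cong[where f = "\<lambda>x. f x - max (f x - g x) 0"])
    (auto intro!: slp_fun_diff slp_fun_relu)

lemma slp_fun_Min:
  "finite A \<Longrightarrow> A \<noteq> {} \<Longrightarrow> (\<And>a. a \<in> A \<Longrightarrow> slp_fun r (f a)) \<Longrightarrow> slp_fun r (\<lambda>x. MIN a\<in>A. f a x)"
  by (induction A rule: finite_ne_induct) (auto intro: slp_fun_min)

lemma cube_grid:
  assumes "m > 0" "x \<in> cube r"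
  shows "\<exists>a\<in>PiE {..<r} (\<lambda>_. (\<lambda>k. real k / real m) ` {..m}). \<forall>i<r. \<bar>x i - a i\<bar> \<le> 1 / m"
proof
  define k where "k i = nat \<lfloor>x i * m\<rfloor>" for i
  have *: "real (k i) \<le> x i * m \<and> x i * m < real (k i) + 1 \<and> k i \<le> m" if "i < r" for i
  proof -
    have x: "0 \<le> x i" "x i \<le> 1" using assms(2) that by (auto simp: cube_def PiE_iff)
    then have "0 \<le> x i * m" "x i * m \<le> m" by (auto simp: mult_le_cancel_right1 mult_left_le_one_le)
    then show ?thesis unfolding k_def by linarith
  qed
  show "(\<lambda>i\<in>{..<r}. real (k i) / m) \<in> PiE {..<r} (\<lambda>_. (\<lambda>k. real k / real m) ` {..m})"
    using * by auto
  show "\<forall>i<r. \<bar>x i - (\<lambda>i\<in>{..<r}. real (k i) / m) i\<bar> \<le> 1 / m"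
  proof (intro allI impI)
    fix i assume "i < r"
    with *[of i] assms(1) have "real (k i) / m \<le> x i" "x i \<le> (real (k i) + 1) / m"
      by (simp_all add: field_simps)
    with \<open>i < r\<close> show "\<bar>x i - (\<lambda>i\<in>{..<r}. real (k i) / m) i\<bar> \<le> 1 / m"
      by (simp add: add_divide_distrib)
  qed
qed

text \<open>
  The McShane extension \<open>MIN a\<in>A. g a + K * \<bar>x - a\<bar>\<^sub>1\<close> of the restriction of \<open>g\<close> to a finite grid
  \<open>A\<close> is a ReLU program.
\<close>

lemma slp_fun_approx:
  assumes lip: "\<And>x y. x \<in> cube r \<Longrightarrow> y \<in> cube r \<Longrightarrow> \<bar>g x - g y\<bar> \<le> K * (\<Sum>i<r. \<bar>x i - y i\<bar>)"
    and K: "K \<ge> 0" and e: "e > 0"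
  shows "\<exists>f. slp_fun r f \<and> (\<forall>x\<in>cube r. 0 \<le> f x \<and> f x \<le> 1 \<and> \<bar>f x - min 1 (max (g x) 0)\<bar> \<le> e)"
proof -
  \<comment> \<open>Some grid point lies within \<open>r / m\<close> of \<open>x\<close> in the l1
    distance. The factor 2 counts the variation of \<open>g\<close> and the penalty term once
    each.\<close>
  obtain m :: nat where m: "m > 0" "2 * K * r / m \<le> e"
  proof -
    obtain m :: nat where m: "2 * K * r / e < m" using reals_Archimedean2 by blast
    have "0 \<le> 2 * K * r / e" using K e by simp
    with m have "m > 0" by linarith
    with m e have "2 * K * r / m \<le> e" by (simp add: field_simps)
    with \<open>m > 0\<close> show ?thesis by (rule that)
  qed
  define A where "A = PiE {..<r} (\<lambda>_. (\<lambda>k. real k / real m) ` {..m})"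
  have fin: "finite A" unfolding A_def by (intro finite_PiE) auto
  have ne: "A \<noteq> {}" unfolding A_def by (auto simp: PiE_eq_empty_iff)
  have sub: "A \<subseteq> cube r" unfolding A_def cube_def using m(1) by (intro PiE_mono) (auto simp: field_simps)
  define h where "h x = (MIN a\<in>A. g a + K * (\<Sum>i<r. \<bar>x i - a i\<bar>))" for x
  \<comment> \<open>Clamping keeps the values in the unit interval, below any output bound
    \<open>F \<ge> 1\<close>. It is 1-Lipschitz, so the error estimate for \<open>h\<close> carries
    over.\<close>
  define f where "f x = min 1 (max (h x) 0)" for x
  have "slp_fun r h" unfolding h_def
    by (intro slp_fun_Min fin ne slp_fun_add slp_fun_const slp_fun_cmult slp_fun_sum slp_fun_abs
        slp_fun_diff slp_fun_coord) auto
  then have "slp_fun r f" unfolding f_def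
    by (intro slp_fun_min slp_fun_const slp_fun_relu)
  moreover have "\<bar>f x - min 1 (max (g x) 0)\<bar> \<le> e" if x: "x \<in> cube r" for x
  proof -
    have lo: "g x \<le> h x" unfolding h_def
    proof (rule Min.boundedI)
      fix b assume "b \<in> (\<lambda>a. g a + K * (\<Sum>i<r. \<bar>x i - a i\<bar>)) ` A"
      then obtain a where "a \<in> A" "b = g a + K * (\<Sum>i<r. \<bar>x i - a i\<bar>)" by blast
      with lip[of x a] x sub show "g x \<le> b" by auto
    qed (use fin ne in auto)
    obtain a where a: "a \<in> A" "\<And>i. i < r \<Longrightarrow> \<bar>x i - a i\<bar> \<le> 1 / m"
      using cube_grid[OF m(1) x] unfolding A_def by blast
    have S: "(\<Sum>i<r. \<bar>x i - a i\<bar>) \<le> r / m"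
      using sum_bounded_above[of "{..<r}" "\<lambda>i. \<bar>x i - a i\<bar>" "1/m"] a(2) by simp
    have "h x \<le> g a + K * (\<Sum>i<r. \<bar>x i - a i\<bar>)"
      unfolding h_def using fin a(1) by (intro Min_le) auto
    also have "\<dots> \<le> g x + 2 * (K * (\<Sum>i<r. \<bar>x i - a i\<bar>))"
      using lip[of x a] x sub a(1) by auto
    also have "\<dots> \<le> g x + 2 * (K * (r / m))"
      using mult_left_mono[OF S K] by simp
    also have "\<dots> \<le> g x + e" using m(2) by simp
    finally show ?thesis using lo unfolding f_def by linarith
  qed
  ultimately show ?thesis by (intro exI[of _ f]) (auto simp: f_def)
qed

section \<open>Covering sparse networks\<close>

text \<open>A sparse parameter vector as a list of positions with values, absent positions meaning
  0. Counting sparse vectors becomes counting lists of a fixed length.\<close>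

definition table_fun :: "('k \<times> real) list \<Rightarrow> 'k \<Rightarrow> real" where
  "table_fun xs k = (case map_of xs k of None \<Rightarrow> 0 | Some t \<Rightarrow> t)"

lemma table_fun_surj:
  assumes fin: "finite {k. \<theta> k \<noteq> 0}" and card: "card {k. \<theta> k \<noteq> 0} \<le> m"
    and sub: "{k. \<theta> k \<noteq> 0} \<subseteq> P" and ne: "k0 \<in> P" and G: "\<And>k. \<theta> k \<in> G"
  shows "\<exists>xs. set xs \<subseteq> P \<times> G \<and> length xs = m \<and> table_fun xs = \<theta>"
proof -
  obtain ks where ks: "set ks = {k. \<theta> k \<noteq> 0}" "distinct ks"
    using finite_distinct_list[OF fin] by blast
  \<comment> \<open>The list must have length exactly \<open>m\<close>. The padding repeats
    \<open>k0\<close> with its true value, so lookups are unaffected.\<close>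
  define ks' where "ks' = ks @ replicate (m - length ks) k0"
  have len: "length ks' = m"
    using ks card distinct_card[OF ks(2)] by (simp add: ks'_def)
  have map_of: "map_of (map (\<lambda>k. (k, \<theta> k)) zs) k = (if k \<in> set zs then Some (\<theta> k) else None)" for k zs
    by (induction zs) auto
  have "table_fun (map (\<lambda>k. (k, \<theta> k)) ks') k = \<theta> k" for k
  proof (cases "k \<in> set ks'")
    case True
    then show ?thesis by (simp add: table_fun_def map_of)
  next
    case False
    then have "k \<notin> set ks" by (simp add: ks'_def)
    with False ks(1) show ?thesis by (simp add: table_fun_def map_of)
  qed
  moreover have "set (map (\<lambda>k. (k, \<theta> k)) ks') \<subseteq> P \<times> G"
    using sub ks(1) ne G by (auto simp: ks'_def)
  ultimately show ?thesis using len by (intro exI[of _ "map (\<lambda>k. (k, \<theta> k)) ks'"]) auto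
qed

text \<open>A layer sums at most \<open>q\<close> terms, each at most the previous bound plus 1 for
  the threshold. Since that bound is at least 1, doubling absorbs the 1.\<close>

lemma net_eval_bound:
  assumes W: "\<And>l i j. \<bar>W l i j\<bar> \<le> 1" and v: "\<And>l i. \<bar>v l i\<bar> \<le> 1"
    and p: "\<And>l. l \<le> L \<Longrightarrow> p l \<le> q" and q: "q \<ge> 1" and x: "\<And>j. j < p 0 \<Longrightarrow> \<bar>x j\<bar> \<le> 1"
    and "l \<le> L"
  shows "\<bar>net_eval p W v l x i\<bar> \<le> (2 * real q) ^ Suc l"
  using \<open>l \<le> L\<close>
proof (induction l arbitrary: i)
  case 0
  have "\<bar>net_eval p W v 0 x i\<bar> \<le> (\<Sum>j<p 0. \<bar>W 0 i j * x j\<bar>)" by (simp add: sum_abs)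
  also have "\<dots> \<le> (\<Sum>j<p 0. 1)"
    using W x by (intro sum_mono) (auto simp: abs_mult intro!: mult_le_one)
  also have "\<dots> \<le> real q" using p[of 0] by simp
  finally show ?case by simp
next
  case (Suc l)
  have "\<bar>net_eval p W v (Suc l) x i\<bar>
      \<le> (\<Sum>j<p (Suc l). \<bar>W (Suc l) i j * max (net_eval p W v l x j - v (Suc l) j) 0\<bar>)"
    by (simp add: sum_abs)
  also have "\<dots> \<le> (\<Sum>j<p (Suc l). 1 * ((2 * real q) ^ Suc l + 1))"
    unfolding abs_mult
  proof (intro sum_mono mult_mono W)
    fix j
    show "\<bar>max (net_eval p W v l x j - v (Suc l) j) 0\<bar> \<le> (2 * real q) ^ Suc l + 1"
      using Suc.IH[of j] Suc.prems v[of "Suc l" j] by linarith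
  qed auto
  also have "\<dots> \<le> real q * ((2 * real q) ^ Suc l + 1)"
    using p[OF Suc.prems] by (simp add: mult_right_mono)
  also have "\<dots> \<le> real q * (2 * (2 * real q) ^ Suc l)"
  proof (rule mult_left_mono)
    have "1 \<le> (2 * real q) ^ Suc l" using q by (intro one_le_power) simp
    then show "(2 * real q) ^ Suc l + 1 \<le> 2 * (2 * real q) ^ Suc l" by linarith
  qed simp
  finally show ?case by (simp add: mult_ac)
qed

text \<open>One summand in the perturbation induction: \<open>B\<close> bounds the previous layer,
  and the additional \<open>1\<close> and \<open>\<delta>\<close> come from the threshold and its
  perturbation.\<close>

lemma abs_mult_diff_le:
  fixes a b w w' \<delta> B :: real
  assumes "\<bar>w - w'\<bar> \<le> \<delta>" "\<bar>a\<bar> \<le> B + 1" "\<bar>w'\<bar> \<le> 1" "\<bar>a - b\<bar> \<le> B * \<delta> + \<delta>" "1 \<le> B" "0 \<le> \<delta>"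
  shows "\<bar>w * a - w' * b\<bar> \<le> 4 * B * \<delta>"
proof -
  have "w * a - w' * b = (w - w') * a + w' * (a - b)" by (simp add: algebra_simps)
  then have "\<bar>w * a - w' * b\<bar> \<le> \<bar>w - w'\<bar> * \<bar>a\<bar> + \<bar>w'\<bar> * \<bar>a - b\<bar>"
    unfolding abs_mult[symmetric] by linarith
  also have "\<dots> \<le> \<delta> * (B + 1) + 1 * (B * \<delta> + \<delta>)"
    using assms by (intro add_mono mult_mono) auto
  also have "\<dots> \<le> 4 * B * \<delta>"
    using mult_right_mono[OF \<open>1 \<le> B\<close> \<open>0 \<le> \<delta>\<close>] by (simp add: algebra_simps)
  finally show ?thesis .
qed

text \<open>The base 5 dominates the base 2 of \<open>net_eval_bound\<close>, so that one power
  controls outputs as well as differences, and it accommodates the factor 4 of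
  \<open>abs_mult_diff_le\<close> in every layer.\<close>

lemma net_eval_perturb:
  assumes W: "\<And>l i j. \<bar>W l i j\<bar> \<le> 1" "\<And>l i j. \<bar>W' l i j\<bar> \<le> 1"
    and v: "\<And>l i. \<bar>v l i\<bar> \<le> 1"
    and d: "\<And>l i j. \<bar>W l i j - W' l i j\<bar> \<le> \<delta>" "\<And>l i. \<bar>v l i - v' l i\<bar> \<le> \<delta>"
    and p: "\<And>l. l \<le> L \<Longrightarrow> p l \<le> q" and q: "q \<ge> 1" and x: "\<And>j. j < p 0 \<Longrightarrow> \<bar>x j\<bar> \<le> 1"
    and "l \<le> L"
  shows "\<bar>net_eval p W v l x i - net_eval p W' v' l x i\<bar> \<le> (5 * real q) ^ Suc l * \<delta>"
  using \<open>l \<le> L\<close>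
proof (induction l arbitrary: i)
  case 0
  have d0: "\<delta> \<ge> 0" using d(2)[of 0 0] by linarith
  have "\<bar>net_eval p W v 0 x i - net_eval p W' v' 0 x i\<bar> = \<bar>\<Sum>j<p 0. (W 0 i j - W' 0 i j) * x j\<bar>"
    by (simp add: sum_subtractf algebra_simps)
  also have "\<dots> \<le> (\<Sum>j<p 0. \<bar>(W 0 i j - W' 0 i j) * x j\<bar>)" by (rule sum_abs)
  also have "\<dots> \<le> (\<Sum>j<p 0. \<delta> * 1)"
    unfolding abs_mult using d x by (intro sum_mono mult_mono) (auto simp: d0)
  also have "\<dots> \<le> real q * \<delta>" using p[of 0] d0 by (simp add: mult_right_mono)
  also have "\<dots> \<le> 5 * real q * \<delta>" using d0 by (intro mult_right_mono) auto
  finally show ?case by simp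
next
  case (Suc l)
  have d0: "\<delta> \<ge> 0" using d(2)[of 0 0] by linarith
  let ?a = "\<lambda>j. max (net_eval p W v l x j - v (Suc l) j) 0"
  let ?b = "\<lambda>j. max (net_eval p W' v' l x j - v' (Suc l) j) 0"
  have pw: "(2 * real q) ^ Suc l \<le> (5 * real q) ^ Suc l" "1 \<le> (5 * real q) ^ Suc l"
    using q by (intro power_mono one_le_power; simp)+
  have term_le: "\<bar>W (Suc l) i j * ?a j - W' (Suc l) i j * ?b j\<bar> \<le> 4 * (5 * real q) ^ Suc l * \<delta>" for j
  proof -
    have a: "\<bar>?a j\<bar> \<le> (5 * real q) ^ Suc l + 1"
    proof -
      have "\<bar>net_eval p W v l x j\<bar> \<le> (2 * real q) ^ Suc l"
        by (rule net_eval_bound[where L = L]) (use W(1) v p q x Suc.prems in auto)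
      then show ?thesis using v[of "Suc l" j] pw(1) by linarith
    qed
    have ab: "\<bar>?a j - ?b j\<bar> \<le> (5 * real q) ^ Suc l * \<delta> + \<delta>"
      using Suc.IH[of j] Suc.prems d(2)[of "Suc l" j] by linarith
    show ?thesis
      by (rule abs_mult_diff_le[OF d(1) a W(2) ab pw(2) d0])
  qed
  have "(\<Sum>j<p (Suc l). \<bar>W (Suc l) i j * ?a j - W' (Suc l) i j * ?b j\<bar>)
      \<le> of_nat (card {..<p (Suc l)}) * (4 * (5 * real q) ^ Suc l * \<delta>)"
    by (rule sum_bounded_above) (rule term_le)
  also have "\<dots> = real (p (Suc l)) * (4 * (5 * real q) ^ Suc l * \<delta>)"
    by (simp only: card_lessThan)
  also have "\<dots> \<le> real q * (5 * (5 * real q) ^ Suc l * \<delta>)"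
    using p[OF Suc.prems] d0 by (intro mult_mono) auto
  finally have "(\<Sum>j<p (Suc l). \<bar>W (Suc l) i j * ?a j - W' (Suc l) i j * ?b j\<bar>)
      \<le> (5 * real q) ^ Suc (Suc l) * \<delta>" by (simp add: mult_ac)
  then show ?case
    using sum_abs[of "\<lambda>j. W (Suc l) i j * ?a j - W' (Suc l) i j * ?b j" "{..<p (Suc l)}"]
    by (simp add: sum_subtractf)
qed

text \<open>Widths that no longer depend on \<open>p\<close>: the cover has to be counted in terms
  of the sparsity alone.\<close>

definition pruned_width :: "nat \<Rightarrow> nat \<Rightarrow> nat \<Rightarrow> nat \<Rightarrow> nat" where
  "pruned_width r m L l = (if l = 0 then r else if l \<le> L then m else 1)"

text \<open>
  A hidden neuron without nonzero incoming weight and threshold has the value \<open>0\<close>, so that at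
  most \<open>s\<close> neurons per layer matter, however large the widths are.
\<close>

lemma network_prune:
  assumes h: "h \<in> networks L p s F" and p: "p 0 = r" "p (Suc L) = 1" and m: "nat \<lfloor>s\<rfloor> \<le> m"
  defines "q \<equiv> m + r + 1"
  shows "\<exists>W v. (\<forall>x. h x 0 = net_eval (pruned_width r m L) W v L x 0) \<and>
     (\<forall>l i j. \<bar>W l i j\<bar> \<le> 1) \<and> (\<forall>l i. \<bar>v l i\<bar> \<le> 1) \<and>
     {(l, i, j). W l i j \<noteq> 0} \<subseteq> {..L} \<times> {..<q} \<times> {..<q} \<and> card {(l, i, j). W l i j \<noteq> 0} \<le> m \<and>
     {(l, i). v l i \<noteq> 0} \<subseteq> {..L} \<times> {..<q} \<and> card {(l, i). v l i \<noteq> 0} \<le> m"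
proof -
  obtain W v where h_eq: "h = (\<lambda>x. \<lambda>i\<in>{..<p (Suc L)}. net_eval p W v L x i)"
    and W: "\<And>l i j. l \<le> L \<Longrightarrow> i < p (Suc l) \<Longrightarrow> j < p l \<Longrightarrow> \<bar>W l i j\<bar> \<le> 1"
    and v: "\<And>l i. l \<in> {1..L} \<Longrightarrow> i < p l \<Longrightarrow> \<bar>v l i\<bar> \<le> 1"
    and s: "real (card {(l, i, j). l \<le> L \<and> i < p (Suc l) \<and> j < p l \<and> W l i j \<noteq> 0}
           + card {(l, i). l \<in> {1..L} \<and> i < p l \<and> v l i \<noteq> 0}) \<le> s"
    using h unfolding networks_def by blast
  define S1 where "S1 = {(l, i, j). l \<le> L \<and> i < p (Suc l) \<and> j < p l \<and> W l i j \<noteq> 0}"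
  define S2 where "S2 = {(l, i). l \<in> {1..L} \<and> i < p l \<and> v l i \<noteq> 0}"
  have "S1 \<subseteq> (SIGMA l:{..L}. {..<p (Suc l)} \<times> {..<p l})" by (auto simp: S1_def)
  then have fin1: "finite S1" by (rule finite_subset) auto
  have "S2 \<subseteq> (SIGMA l:{..L}. {..<p l})" by (auto simp: S2_def)
  then have fin2: "finite S2" by (rule finite_subset) auto
  have card: "card S1 + card S2 \<le> m"
    using s m unfolding S1_def[symmetric] S2_def[symmetric] by linarith
  \<comment> \<open>The neurons that are kept. In a hidden layer each is charged to a nonzero
    threshold or to a nonzero incoming weight, which bounds their number by the sparsity; inputs and
    the output are kept unconditionally.\<close>
  define A where "A l = (if l = 0 then {..<r} else if l \<le> L then
      {i. i < p l \<and> (v l i \<noteq> 0 \<or> (\<exists>j<p (l - 1). W (l - 1) i j \<noteq> 0))} else {0::nat})" for l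
  have finA: "finite (A l)" for l by (auto simp: A_def)
  have cardA: "card (A l) \<le> m" if "l \<in> {1..L}" for l
  proof -
    have "A l \<subseteq> (\<lambda>(l, i, j). i) ` S1 \<union> snd ` S2"
    proof
      fix i assume i: "i \<in> A l"
      then have "i < p l" using that by (auto simp: A_def)
      show "i \<in> (\<lambda>(l, i, j). i) ` S1 \<union> snd ` S2"
      proof (cases "v l i = 0")
        case True
        with i that obtain j where "j < p (l - 1)" "W (l - 1) i j \<noteq> 0" by (auto simp: A_def)
        with that \<open>i < p l\<close> have "(l - 1, i, j) \<in> S1" by (auto simp: S1_def)
        then show ?thesis by force
      next
        case False
        with that \<open>i < p l\<close> have "(l, i) \<in> S2" by (auto simp: S2_def)
        then show ?thesis by force
      qed
    qed
    then have "card (A l) \<le> card ((\<lambda>(l, i, j). i) ` S1 \<union> snd ` S2)"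
      using fin1 fin2 by (intro card_mono) auto
    also have "\<dots> \<le> card S1 + card S2"
      using card_Un_le card_image_le[OF fin1] card_image_le[OF fin2] by (meson add_mono order_trans)
    finally show ?thesis using card by simp
  qed
  \<comment> \<open>\<open>e l\<close> numbers the kept neurons of layer \<open>l\<close>. It has to
    be the identity on the inputs, because the argument \<open>x\<close> is not renumbered.\<close>
  have "\<forall>l. \<exists>e. bij_betw e {..<card (A l)} (A l) \<and> (l = 0 \<longrightarrow> e = id)"
  proof
    fix l show "\<exists>e. bij_betw e {..<card (A l)} (A l) \<and> (l = 0 \<longrightarrow> e = id)"
    proof (cases "l = 0")
      case True
      then show ?thesis by (auto simp: A_def intro!: exI[of _ id])
    next
      case False
      with ex_bij_betw_nat_finite[OF finA[of l]] show ?thesis by (auto simp: atLeast0LessThan)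
    qed
  qed
  then obtain e where e: "\<And>l. bij_betw (e l) {..<card (A l)} (A l)" and e0: "e 0 = id"
    unfolding choice_iff by blast
  define a where "a l = card (A l)" for l
  have a0: "a 0 = r" by (simp add: a_def A_def)
  have aL: "a (Suc L) = 1" by (simp add: a_def A_def)
  have am: "a l \<le> m" if "l \<in> {1..L}" for l using cardA[OF that] by (simp add: a_def)
  have aq: "a l \<le> q" for l
  proof (cases "l = 0 \<or> l > L")
    case True
    then show ?thesis by (auto simp: a_def A_def q_def)
  next
    case False
    then show ?thesis using am[of l] by (auto simp: q_def)
  qed
  have eA: "e l i \<in> A l" if "i < a l" for l i
    using bij_betw_apply[OF e, of i l] that by (simp add: a_def)
  have A_p: "A l \<subseteq> {..<p l}" if "l \<le> Suc L" for l
  proof (cases "l = Suc L")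
    case False
    then show ?thesis using that p by (auto simp: A_def)
  qed (use p in \<open>auto simp: A_def\<close>)
  have e_p: "e l i < p l" if "l \<le> Suc L" "i < a l" for l i
    using eA[OF that(2)] A_p[OF that(1)] by blast
  have e_inj: "i = j" if "e l i = e l j" "i < a l" "j < a l" for l i j
    using e[of l] that unfolding bij_betw_def inj_on_def a_def by auto
  define W' where "W' l i j = (if l \<le> L \<and> i < a (Suc l) \<and> j < a l then W l (e (Suc l) i) (e l j) else 0)" for l i j
  define v' where "v' l i = (if l \<in> {1..L} \<and> i < a l then v l (e l i) else 0)" for l i
  let ?A = "{(l, i, j). W' l i j \<noteq> 0}" and ?V = "{(l, i). v' l i \<noteq> 0}"
  have eval: "net_eval (pruned_width r m L) W' v' l x i = net_eval p W v l x (e (Suc l) i)"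
    if "l \<le> L" "i < a (Suc l)" for l i x
    using that
  proof (induction l arbitrary: i)
    case 0
    then show ?case by (auto simp: pruned_width_def W'_def a0 p e0 intro!: sum.cong)
  next
    case (Suc l)
    let ?f = "\<lambda>k. W (Suc l) (e (Suc (Suc l)) i) k * max (net_eval p W v l x k - v (Suc l) k) 0"
    have ps: "pruned_width r m L (Suc l) = m" using Suc.prems by (simp add: pruned_width_def)
    have "net_eval (pruned_width r m L) W' v' (Suc l) x i
        = (\<Sum>j<a (Suc l). ?f (e (Suc l) j))"
      unfolding net_eval.simps ps
    proof (intro sum.mono_neutral_cong_right)
      fix j assume "j \<in> {..<a (Suc l)}"
      then have "net_eval (pruned_width r m L) W' v' l x j = net_eval p W v l x (e (Suc l) j)"
        "v' (Suc l) j = v (Suc l) (e (Suc l) j)"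
        "W' (Suc l) i j = W (Suc l) (e (Suc (Suc l)) i) (e (Suc l) j)"
        using Suc.prems by (auto intro!: Suc.IH simp: v'_def W'_def)
      then show "W' (Suc l) i j * max (net_eval (pruned_width r m L) W' v' l x j - v' (Suc l) j) 0
          = ?f (e (Suc l) j)" by (simp only:)
    qed (use Suc.prems am[of "Suc l"] in \<open>auto simp: W'_def\<close>)
    also have "\<dots> = (\<Sum>k\<in>A (Suc l). ?f k)"
      using e[of "Suc l"] unfolding a_def by (rule sum.reindex_bij_betw)
    also have "\<dots> = (\<Sum>k<p (Suc l). ?f k)"
    proof (rule sum.mono_neutral_left)
      show "\<forall>k\<in>{..<p (Suc l)} - A (Suc l). ?f k = 0"
      proof
        fix k assume k: "k \<in> {..<p (Suc l)} - A (Suc l)"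
        then have "v (Suc l) k = 0" "\<And>j. j < p l \<Longrightarrow> W l k j = 0"
          using Suc.prems by (auto simp: A_def)
        then have "net_eval p W v l x k = 0" by (cases l) auto
        then show "?f k = 0" using \<open>v (Suc l) k = 0\<close> by simp
      qed
    qed (use A_p[of "Suc l"] Suc.prems in auto)
    finally show ?case by simp
  qed
  have "e (Suc L) 0 = 0"
    using eA[of 0 "Suc L"] aL by (simp add: A_def)
  then have "h x 0 = net_eval (pruned_width r m L) W' v' L x 0" for x
    using eval[of L 0 x] aL p by (simp add: h_eq)
  moreover have "\<bar>W' l i j\<bar> \<le> 1" for l i j
    using W e_p by (auto simp: W'_def)
  moreover have "\<bar>v' l i\<bar> \<le> 1" for l i
    using v e_p by (auto simp: v'_def)
  moreover have "?A \<subseteq> {..L} \<times> {..<q} \<times> {..<q}"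
    using aq less_le_trans by (fastforce simp: W'_def split: if_splits)
  moreover have "?V \<subseteq> {..L} \<times> {..<q}"
    using aq less_le_trans by (fastforce simp: v'_def split: if_splits)
  moreover have "card ?A \<le> m"
  proof -
    \<comment> \<open>Renumbering sends the new nonzero positions injectively to old ones, so
      pruning does not increase the count.\<close>
    have "card ?A \<le> card S1"
    proof (rule card_inj_on_le[OF _ _ fin1])
      show "inj_on (\<lambda>(l, i, j). (l, e (Suc l) i, e l j)) ?A"
        using e_inj by (auto simp: inj_on_def W'_def split: if_splits)
      show "(\<lambda>(l, i, j). (l, e (Suc l) i, e l j)) ` ?A \<subseteq> S1"
        using e_p by (auto simp: S1_def W'_def split: if_splits)
    qed
    then show ?thesis using card by simp
  qed
  moreover have "card ?V \<le> m"
  proof -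
    have "card ?V \<le> card S2"
    proof (rule card_inj_on_le[OF _ _ fin2])
      show "inj_on (\<lambda>(l, i). (l, e l i)) ?V"
        using e_inj by (auto simp: inj_on_def v'_def split: if_splits)
      show "(\<lambda>(l, i). (l, e l i)) ` ?V \<subseteq> S2"
        using e_p by (auto simp: S2_def v'_def split: if_splits)
    qed
    then show ?thesis using card by simp
  qed
  ultimately show ?thesis by blast
qed

lemma net_eval_measurable:
  assumes "p 0 = r"
  shows "(\<lambda>x. net_eval p W v l x i) \<in> borel_measurable (Rvec r)"
proof (induction l arbitrary: i)
  case 0
  then show ?case using assms by simp
next
  case (Suc l)
  from this[measurable] show ?case by simp
qed

text \<open>Each of the \<open>m\<close> table entries consists of a position (layer, row, column)
  and one of the \<open>2 * Q + 1\<close> multiples of \<open>1 / Q\<close> in [-1, 1]. The exponent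
  \<open>2 * m\<close> provides one table for the weights and one for the thresholds.\<close>

definition cover_size :: "nat \<Rightarrow> nat \<Rightarrow> nat \<Rightarrow> nat \<Rightarrow> nat" where
  "cover_size r m L Q = (Suc L * (m + r + 1) * (m + r + 1) * (2 * Q + 1)) ^ (2 * m)"

text \<open>The bound of \<open>net_eval_perturb\<close> at the output layer for parameters moved by
  at most \<open>1 / Q\<close>.\<close>

definition cover_radius :: "nat \<Rightarrow> nat \<Rightarrow> nat \<Rightarrow> nat \<Rightarrow> real" where
  "cover_radius r m L Q = (5 * real (m + r + 1)) ^ Suc L / real Q"

text \<open>Rounding the weights of the pruned networks down to multiples of \<open>1 / Q\<close>.\<close>

lemma network_cover:
  fixes r m L Q :: nat
  assumes Q: "Q > 0"
  shows "\<exists>C. finite C \<and> card C \<le> cover_size r m L Q \<and>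
     C \<subseteq> borel_measurable (Rvec r) \<and>
     (\<forall>p s F. \<forall>h\<in>networks L p s F. p 0 = r \<longrightarrow> p (Suc L) = 1 \<longrightarrow> nat \<lfloor>s\<rfloor> \<le> m \<longrightarrow>
        (\<exists>c\<in>C. \<forall>x\<in>cube r. \<bar>h x 0 - c x\<bar> \<le> cover_radius r m L Q))"
proof -
  define q where "q = m + r + 1"
  define rnd where "rnd t = of_int \<lfloor>t * Q\<rfloor> / real Q" for t :: real
  define G where "G = (\<lambda>k. of_int k / real Q) ` {- int Q .. int Q}"
  have cardG: "card G \<le> 2 * Q + 1"
  proof -
    have "card G \<le> card {- int Q .. int Q}" unfolding G_def by (rule card_image_le) auto
    then show ?thesis by simp
  qed
  \<comment> \<open>Since 0 is a fixed point, rounding does not enlarge the set of nonzero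
    parameters.\<close>
  have rnd0: "rnd 0 = 0" by (simp add: rnd_def)
  have rnd: "rnd t \<in> G" "\<bar>rnd t\<bar> \<le> 1" "\<bar>t - rnd t\<bar> \<le> 1 / Q" if t: "\<bar>t\<bar> \<le> 1" for t
  proof -
    have "t * real Q \<le> 1 * real Q" "(- 1) * real Q \<le> t * real Q"
      using t by (intro mult_right_mono; linarith)+
    then have k: "\<lfloor>t * Q\<rfloor> \<in> {- int Q .. int Q}" by (simp add: le_floor_iff floor_le_iff)
    then show "rnd t \<in> G" unfolding G_def rnd_def by (rule imageI)
    have "\<bar>real_of_int \<lfloor>t * Q\<rfloor>\<bar> \<le> Q" using k by auto
    then show "\<bar>rnd t\<bar> \<le> 1" using Q by (simp add: rnd_def abs_divide)
    have "t - rnd t = (t * Q - of_int \<lfloor>t * Q\<rfloor>) / Q" using Q by (simp add: rnd_def field_simps)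
    moreover have "\<bar>t * Q - of_int \<lfloor>t * Q\<rfloor>\<bar> \<le> 1" by linarith
    ultimately show "\<bar>t - rnd t\<bar> \<le> 1 / Q" using Q by (simp add: abs_divide divide_right_mono)
  qed
  define P1 where "P1 = {..L} \<times> {..<q} \<times> {..<q}"
  define P2 where "P2 = {..L} \<times> {..<q}"
  define X1 where "X1 = {xs. set xs \<subseteq> P1 \<times> G \<and> length xs = m}"
  define X2 where "X2 = {xs. set xs \<subseteq> P2 \<times> G \<and> length xs = m}"
  define net where "net = (\<lambda>(xs, ys) x. net_eval (pruned_width r m L)
      (\<lambda>l i j. table_fun xs (l, i, j)) (\<lambda>l i. table_fun ys (l, i)) L x 0)"
  have finP: "finite (P1 \<times> G)" "finite (P2 \<times> G)" by (auto simp: P1_def P2_def G_def)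
  have finX: "finite X1" "finite X2"
    unfolding X1_def X2_def by (intro finite_lists_length_eq finP)+
  have q0: "q > 0" by (simp add: q_def)
  let ?N = "Suc L * q * q * (2 * Q + 1)"
  have "card X1 \<le> ?N ^ m"
    unfolding X1_def card_lists_length_eq[OF finP(1)]
    using mult_le_mono2[OF cardG, of "Suc L * q * q"]
    by (intro power_mono) (simp_all add: P1_def card_cartesian_product algebra_simps)
  moreover have "card X2 \<le> ?N ^ m"
  proof -
    have "card (P2 \<times> G) \<le> Suc L * q * (2 * Q + 1)"
      unfolding P2_def card_cartesian_product using mult_le_mono2[OF cardG] by simp
    also have "\<dots> \<le> ?N"
    proof (rule mult_le_mono1)
      have "Suc L * q * 1 \<le> Suc L * q * q" using q0 by (intro mult_le_mono2) simp
      then show "Suc L * q \<le> Suc L * q * q" by (simp only: mult_1_right)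
    qed
    finally show ?thesis unfolding X2_def card_lists_length_eq[OF finP(2)]
      by (intro power_mono) auto
  qed
  ultimately have "card (X1 \<times> X2) \<le> ?N ^ m * ?N ^ m"
    unfolding card_cartesian_product by (rule mult_le_mono)
  also have "\<dots> = ?N ^ (2 * m)" by (simp add: power_add[symmetric] mult_2)
  finally have "card (net ` (X1 \<times> X2)) \<le> ?N ^ (2 * m)"
    using finX by (intro order_trans[OF card_image_le]) auto
  moreover have "finite (net ` (X1 \<times> X2))" using finX by auto
  \<comment> \<open>Measurability of the members is recorded because deviation inequalities and
    integrals are later applied to each of them.\<close>
  moreover have "net ` (X1 \<times> X2) \<subseteq> borel_measurable (Rvec r)"
    using net_eval_measurable[of "pruned_width r m L" r]
    by (auto simp: net_def pruned_width_def)
  moreover have "\<exists>c\<in>net ` (X1 \<times> X2). \<forall>x\<in>cube r. \<bar>h x 0 - c x\<bar> \<le> (5 * real q) ^ Suc L / real Q"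
    if h: "h \<in> networks L p s F" "p 0 = r" "p (Suc L) = 1" "nat \<lfloor>s\<rfloor> \<le> m" for p s F h
  proof -
    obtain W v where W: "\<And>x. h x 0 = net_eval (pruned_width r m L) W v L x 0"
      "\<And>l i j. \<bar>W l i j\<bar> \<le> 1" "\<And>l i. \<bar>v l i\<bar> \<le> 1"
      and s: "{(l, i, j). W l i j \<noteq> 0} \<subseteq> P1" "card {(l, i, j). W l i j \<noteq> 0} \<le> m"
      "{(l, i). v l i \<noteq> 0} \<subseteq> P2" "card {(l, i). v l i \<noteq> 0} \<le> m"
      using network_prune[OF h] unfolding q_def P1_def P2_def by blast
    define \<theta> where "\<theta> = (\<lambda>(l, i, j). rnd (W l i j))"
    define \<eta> where "\<eta> = (\<lambda>(l, i). rnd (v l i))"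
    let ?A = "{(l, i, j). W l i j \<noteq> 0}" and ?V = "{(l, i). v l i \<noteq> 0}" and ?T = "{k. \<theta> k \<noteq> 0}" and ?H = "{k. \<eta> k \<noteq> 0}"
    have sub: "?T \<subseteq> ?A" "?H \<subseteq> ?V"
      using rnd0 by (auto simp: \<theta>_def \<eta>_def)
    have fin: "finite ?A" "finite ?V"
      using s(1,3) by (auto simp: P1_def P2_def intro: finite_subset)
    have "\<exists>xs. set xs \<subseteq> P1 \<times> G \<and> length xs = m \<and> table_fun xs = \<theta>"
    proof (rule table_fun_surj)
      show "finite ?T" using sub(1) fin(1) by (rule finite_subset)
      show "card ?T \<le> m" using card_mono[OF fin(1) sub(1)] s(2) by simp
      show "?T \<subseteq> P1" using sub(1) s(1) by blast
      show "(0, 0, 0) \<in> P1" using q0 by (simp add: P1_def)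
      show "\<theta> k \<in> G" for k using rnd(1) W(2) by (auto simp: \<theta>_def split: prod.split)
    qed
    then obtain xs where xs: "xs \<in> X1" "table_fun xs = \<theta>" by (auto simp: X1_def)
    have "\<exists>ys. set ys \<subseteq> P2 \<times> G \<and> length ys = m \<and> table_fun ys = \<eta>"
    proof (rule table_fun_surj)
      show "finite ?H" using sub(2) fin(2) by (rule finite_subset)
      show "card ?H \<le> m" using card_mono[OF fin(2) sub(2)] s(4) by simp
      show "?H \<subseteq> P2" using sub(2) s(3) by blast
      show "(0, 0) \<in> P2" using q0 by (simp add: P2_def)
      show "\<eta> k \<in> G" for k using rnd(1) W(3) by (auto simp: \<eta>_def split: prod.split)
    qed
    then obtain ys where ys: "ys \<in> X2" "table_fun ys = \<eta>" by (auto simp: X2_def)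
    show ?thesis
    proof (intro bexI ballI)
      fix x assume x: "x \<in> cube r"
      have "\<bar>net_eval (pruned_width r m L) W v L x 0
          - net_eval (pruned_width r m L) (\<lambda>l i j. rnd (W l i j)) (\<lambda>l i. rnd (v l i)) L x 0\<bar>
          \<le> (5 * real q) ^ Suc L * (1 / real Q)"
        by (rule net_eval_perturb[where L = L])
          (use W rnd x in \<open>auto simp: pruned_width_def q_def cube_def PiE_iff\<close>)
      then show "\<bar>h x 0 - net (xs, ys) x\<bar> \<le> (5 * real q) ^ Suc L / real Q"
        by (simp add: net_def xs ys \<theta>_def \<eta>_def W(1))
    next
      show "net (xs, ys) \<in> net ` (X1 \<times> X2)" using xs ys by blast
    qed
  qed
  ultimately show ?thesis
    unfolding cover_size_def cover_radius_def q_def[symmetric]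
    by (intro exI[of _ "net ` (X1 \<times> X2)"] conjI allI ballI impI)
qed

section \<open>Ramps and distribution functions\<close>

text \<open>Zero up to \<open>k / m\<close>, then of slope 1 up to \<open>(k + 1) / m\<close>, then
  constant \<open>1 / m\<close>. It is a smoothed indicator left unnormalised so as to be
  1-Lipschitz.\<close>

definition ramp :: "nat \<Rightarrow> nat \<Rightarrow> real \<Rightarrow> real" where
  "ramp m k x = max (x - real k / real m) 0 - max (x - real (Suc k) / real m) 0"

lemma ramp_bounds:
  assumes "m > 0"
  shows "0 \<le> ramp m k x" "ramp m k x \<le> 1 / m"
    "ramp m k x \<le> 1 / m * indicator {real k / m<..} x"
    "1 / m * indicator {real (Suc k) / m<..} x \<le> ramp m k x"
proof -
  define d where "d = 1 / real m"
  have d: "real (Suc k) / m = real k / m + d" "d > 0" using assms by (simp_all add: field_simps d_def)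
  show "0 \<le> ramp m k x" "ramp m k x \<le> 1 / m"
    "ramp m k x \<le> 1 / m * indicator {real k / m<..} x"
    "1 / m * indicator {real (Suc k) / m<..} x \<le> ramp m k x"
    unfolding ramp_def indicator_def d(1) d_def[symmetric] using d(2) by auto
qed

lemma ramp_lipschitz:
  assumes "m > 0"
  shows "\<bar>ramp m k x - ramp m k y\<bar> \<le> \<bar>x - y\<bar>"
proof -
  have "real (Suc k) / m = real k / m + 1 / m" using assms by (simp add: field_simps)
  moreover have "0 < 1 / real m" using assms by simp
  ultimately show ?thesis unfolding ramp_def by linarith
qed

lemma ramp_measurable [measurable]: "ramp m k \<in> borel_measurable borel"
  unfolding ramp_def by measurable

text \<open>The two ReLUs are formed in the first hidden layer, copied through the others and
  subtracted at the output: at most 4 weights per layer and 2 thresholds. The identity holds for all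
  \<open>x\<close>, not only in the cube, since critics are also evaluated at generator outputs
  outside the unit interval. \<open>k < m\<close> keeps the thresholds in [0, 1].\<close>

lemma ramp_network:
  assumes L: "L \<ge> 1" and p: "p 0 = 1" "p (Suc L) = 1"
    and width: "\<And>l. l \<in> {1..L} \<Longrightarrow> p l \<ge> 2" and s: "6 * real (Suc L) \<le> s" and F: "1 \<le> F"
    and k: "k < m" and \<sigma>: "\<bar>\<sigma>\<bar> \<le> 1"
  shows "\<exists>h\<in>networks L p s F. \<forall>x. h x 0 = \<sigma> * ramp m k (x 0)"
proof -
  define t where "t i = (if i = 0 then real k / m else real (Suc k) / m)" for i :: nat
  have m: "m > 0" using k by simp
  have t: "\<bar>t i\<bar> \<le> 1" for i using k by (auto simp: t_def abs_le_iff field_simps)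
  define W where "W l i j = (if l = L then (if i = 0 \<and> j = 0 then \<sigma> else if i = 0 \<and> j = 1 then - \<sigma> else 0)
     else if l = 0 then (if i < 2 \<and> j = 0 then 1 else 0)
     else if i = j \<and> i < 2 then 1 else (0::real))" for l i j :: nat
  define v where "v l i = (if l = 1 \<and> i < 2 then t i else 0)" for l i :: nat
  let ?A = "{(l, i, j). l \<le> L \<and> i < p (Suc l) \<and> j < p l \<and> W l i j \<noteq> 0}" and ?V = "{(l, i). l \<in> {1..L} \<and> i < p l \<and> v l i \<noteq> 0}"
  have state: "max (net_eval p W v l x i - v (Suc l) i) 0 = max (x 0 - t i) 0"
    if "l < L" "i < 2" for x l i
    using that
  proof (induction l arbitrary: i)
    case 0
    then show ?case by (simp add: p W_def v_def)
  next
    case (Suc l)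
    let ?a = "\<lambda>j. max (net_eval p W v l x j - v (Suc l) j) 0"
    have wid: "2 \<le> p (Suc l)" using width[of "Suc l"] Suc.prems by simp
    have "net_eval p W v (Suc l) x i = (\<Sum>j<p (Suc l). if i = j then ?a j else 0)"
      unfolding net_eval.simps using Suc.prems by (intro sum.cong) (auto simp: W_def)
    also have "\<dots> = ?a i" using Suc.prems wid by simp
    also have "\<dots> = max (x 0 - t i) 0" using Suc by simp
    finally have "net_eval p W v (Suc l) x i = max (x 0 - t i) 0" .
    moreover have "v (Suc (Suc l)) i = 0" by (simp add: v_def)
    ultimately show ?case by (simp del: net_eval.simps)
  qed
  define h where "h = (\<lambda>x. \<lambda>i\<in>{..<p (Suc L)}. net_eval p W v L x i)"
  have h: "h x 0 = \<sigma> * ramp m k (x 0)" for x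
  proof -
    obtain l where l: "L = Suc l" using L by (cases L) auto
    have wid: "2 \<le> p L" using width[of L] L by simp
    let ?a = "\<lambda>j. max (net_eval p W v l x j - v (Suc l) j) 0"
    have "h x 0 = net_eval p W v L x 0" by (simp add: h_def p)
    also have "\<dots> = (\<Sum>j<p L. W L 0 j * ?a j)" unfolding l net_eval.simps ..
    also have "\<dots> = (\<Sum>j\<in>{0, 1}. W L 0 j * ?a j)"
      using wid by (intro sum.mono_neutral_right) (auto simp: W_def)
    also have "\<dots> = \<sigma> * ?a 0 - \<sigma> * ?a 1" by (simp add: W_def)
    also have "\<dots> = \<sigma> * ramp m k (x 0)"
      using state[of l 0 x] state[of l 1 x] l by (simp add: ramp_def t_def algebra_simps)
    finally show ?thesis .
  qed
  have card1: "card ?A \<le> 4 * Suc L"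
  proof -
    have "W l i j = 0" if "\<not> (i < 2 \<and> j < 2)" for l i j using that unfolding W_def by auto
    then have "W l i j \<noteq> 0 \<Longrightarrow> i < 2 \<and> j < 2" for l i j by blast
    then have "?A \<subseteq> {..L} \<times> {..<2} \<times> {..<2}"
      by auto
    then have "card ?A
        \<le> card ({..L} \<times> {..<2::nat} \<times> {..<2::nat})" by (intro card_mono) auto
    then show ?thesis by (simp add: card_cartesian_product)
  qed
  have card2: "card ?V \<le> 2"
  proof -
    have "?V \<subseteq> {1} \<times> {..<2}"
      by (auto simp: v_def split: if_splits)
    then have "card ?V \<le> card ({1::nat} \<times> {..<2::nat})"
      by (intro card_mono) auto
    then show ?thesis by (simp add: card_cartesian_product)
  qed
  have sparse: "real (card ?A
           + card ?V) \<le> s"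
    using card1 card2 s by simp
  have "h \<in> networks L p s F"
    unfolding networks_def
  proof (rule CollectI, intro exI conjI)
    show "h = (\<lambda>x. \<lambda>i\<in>{..<p (Suc L)}. net_eval p W v L x i)" by (rule h_def)
    show "\<forall>l\<le>L. \<forall>i<p (Suc l). \<forall>j<p l. \<bar>W l i j\<bar> \<le> 1"
      using \<sigma> by (auto simp: W_def)
    show "\<forall>l\<in>{1..L}. \<forall>i<p l. \<bar>v l i\<bar> \<le> 1"
      using t by (auto simp: v_def)
    have "\<bar>\<sigma> * ramp m k y\<bar> \<le> F" for y
    proof -
      have "\<bar>\<sigma>\<bar> * \<bar>ramp m k y\<bar> \<le> 1 * 1"
        using ramp_bounds(1,2)[OF m, of k y] m \<sigma> order_trans[of "ramp m k y" "1 / m" 1]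
        by (intro mult_mono) auto
      with F show ?thesis by (simp add: abs_mult)
    qed
    then show "\<forall>x\<in>cube (p 0). \<forall>i<p (Suc L). \<bar>h x i\<bar> \<le> F"
      using h by (auto simp: p)
  qed (rule sparse)
  with h show ?thesis by blast
qed

text \<open>The indicators select the increments from the first grid point at or above
  \<open>x\<close> onwards; these telescope, and what remains is \<open>f\<close> at that grid
  point, which is within \<open>1 / m\<close> of \<open>x\<close>.\<close>

lemma lipschitz_step_approx:
  fixes f :: "real \<Rightarrow> real" and m :: nat
  assumes f: "1-lipschitz_on UNIV f" and m: "m > 0" and x: "x \<in> {0..1}"
  shows "\<bar>f x - (f 1 - (\<Sum>k<m. (f (real (Suc k) / m) - f (real k / m)) * indicator {..real k / m} x))\<bar> \<le> 1 / m"
proof -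
  \<comment> \<open>Rounding up, because \<open>x\<close> satisfies \<open>x \<le> k / m\<close>
    exactly when \<open>j \<le> k\<close>.\<close>
  define j where "j = nat \<lceil>x * m\<rceil>"
  have x01: "0 \<le> x * m" "x * m \<le> m" using x by (auto simp: mult_left_le_one_le)
  have j: "x * m \<le> j" "j < x * m + 1" "j \<le> m"
    using x01 unfolding j_def by linarith+
  have iff: "x \<le> real k / m \<longleftrightarrow> j \<le> k" for k
  proof -
    have "x \<le> real k / m \<longleftrightarrow> x * m \<le> real k" using m by (simp add: field_simps)
    also have "\<dots> \<longleftrightarrow> j \<le> k" unfolding j_def using x01 by linarith
    finally show ?thesis .
  qed
  have "(\<Sum>k<m. (f (real (Suc k) / m) - f (real k / m)) * indicator {..real k / m} x)
      = (\<Sum>k\<in>{j..<m}. f (real (Suc k) / m) - f (real k / m))"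
    using iff by (intro sum.mono_neutral_cong_right) (auto simp: indicator_def)
  also have "\<dots> = f (real m / m) - f (real j / m)"
    using sum_Suc_diff'[OF j(3), of "\<lambda>k. f (real k / m)"] by simp
  finally have "f x - (f 1 - (\<Sum>k<m. (f (real (Suc k) / m) - f (real k / m)) * indicator {..real k / m} x))
      = f x - f (real j / m)" using m by simp
  moreover have "\<bar>f x - f (real j / m)\<bar> \<le> \<bar>x - real j / m\<bar>"
    using lipschitz_onD[OF f, of x "real j / m"] by (simp add: dist_real_def)
  moreover have "\<bar>x - real j / m\<bar> \<le> 1 / m"
  proof -
    have "x - real j / m = (x * m - j) / m" using m by (simp add: field_simps)
    moreover have "\<bar>x * m - j\<bar> \<le> 1" using j by linarith
    ultimately show ?thesis using m by (simp add: abs_divide divide_right_mono)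
  qed
  ultimately show ?thesis by linarith
qed

text \<open>
  Summation by parts: \<open>f\<close> is approximated by a combination of indicators \<open>{..k / m}\<close> whose coefficients
  have absolute sum at most 1, so closeness of the distribution functions on the grid suffices.
\<close>

lemma lipschitz_mean_approx:
  fixes f :: "real \<Rightarrow> real" and x :: "'i \<Rightarrow> real" and m :: nat
  assumes f: "1-lipschitz_on UNIV f" and m: "m > 0"
    and \<nu>: "prob_space \<nu>" "sets \<nu> = sets borel" "AE t in \<nu>. t \<in> {0..1}"
    and I: "finite I" "I \<noteq> {}" and x: "\<And>i. i \<in> I \<Longrightarrow> x i \<in> {0..1}"
    and close: "\<And>k. k < m \<Longrightarrow> \<bar>(\<Sum>i\<in>I. indicator {..real k / m} (x i)) / card I - cdf \<nu> (real k / m)\<bar> \<le> \<eta>"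
  shows "\<bar>(\<Sum>i\<in>I. f (x i)) / card I - (\<integral>t. f t \<partial>\<nu>)\<bar> \<le> 2 / m + \<eta>"
proof -
  interpret \<nu>: prob_space \<nu> by fact
  note [measurable_cong] = \<nu>(2)
  define c where "c k = f (real (Suc k) / m) - f (real k / m)" for k
  \<comment> \<open>\<open>S\<close> replaces \<open>f\<close> in the empirical and in the true
    mean, each time at a cost of \<open>1 / m\<close>; hence the \<open>2 / m\<close> of the
    conclusion.\<close>
  define S where "S t = f 1 - (\<Sum>k<m. c k * indicator {..real k / m} t)" for t
  have n: "real (card I) > 0" using I by (simp add: card_gt_0_iff)
  have Sf: "\<bar>f t - S t\<bar> \<le> 1 / m" if "t \<in> {0..1}" for t
    using lipschitz_step_approx[OF f m that] by (simp add: S_def c_def)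
  have c: "\<bar>c k\<bar> \<le> 1 / m" for k
  proof -
    have "\<bar>c k\<bar> \<le> \<bar>real (Suc k) / m - real k / m\<bar>"
      using lipschitz_onD[OF f, of "real (Suc k) / m" "real k / m"] by (simp add: dist_real_def c_def)
    also have "\<dots> = 1 / m" by (simp add: diff_divide_distrib[symmetric])
    finally show ?thesis .
  qed
  have fm [measurable]: "f \<in> borel_measurable borel"
    using lipschitz_on_continuous_on[OF f] by (intro borel_measurable_continuous_onI)
  have Sm [measurable]: "S \<in> borel_measurable borel" unfolding S_def by measurable
  have ind_int: "integrable \<nu> (indicator {..a} :: real \<Rightarrow> real)" for a
    by (rule \<nu>.integrable_const_bound[where B = 1]) (auto simp: indicator_def)
  have S_int: "integrable \<nu> S"
    unfolding S_def by (intro Bochner_Integration.integrable_diff Bochner_Integration.integrable_sum integrable_mult_right ind_int) auto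
  have f_int: "integrable \<nu> f"
  proof (rule \<nu>.integrable_const_bound[where B = "\<bar>f 0\<bar> + 1"])
    show "AE t in \<nu>. norm (f t) \<le> \<bar>f 0\<bar> + 1"
      using \<nu>(3)
    proof eventually_elim
      case (elim t)
      then have "\<bar>f t - f 0\<bar> \<le> 1"
        using lipschitz_onD[OF f, of t 0] by (simp add: dist_real_def)
      then show ?case unfolding real_norm_def by linarith
    qed
  qed measurable
  have S_exp: "(\<integral>t. S t \<partial>\<nu>) = f 1 - (\<Sum>k<m. c k * cdf \<nu> (real k / m))"
  proof -
    have "(\<integral>t. S t \<partial>\<nu>) = (\<integral>t. f 1 \<partial>\<nu>) - (\<integral>t. (\<Sum>k<m. c k * indicator {..real k / m} t) \<partial>\<nu>)"
      unfolding S_def by (intro Bochner_Integration.integral_diff Bochner_Integration.integrable_sum integrable_mult_right ind_int) auto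
    also have "(\<integral>t. (\<Sum>k<m. c k * indicator {..real k / m} t) \<partial>\<nu>)
        = (\<Sum>k<m. \<integral>t. c k * indicator {..real k / m} t \<partial>\<nu>)"
      by (intro Bochner_Integration.integral_sum integrable_mult_right ind_int)
    also have "\<dots> = (\<Sum>k<m. c k * cdf \<nu> (real k / m))"
      using sets_eq_imp_space_eq[OF \<nu>(2)] by (simp add: cdf_def)
    finally show ?thesis by (simp add: \<nu>.prob_space)
  qed
  have 1: "\<bar>(\<integral>t. f t \<partial>\<nu>) - (\<integral>t. S t \<partial>\<nu>)\<bar> \<le> 1 / m"
  proof -
    have "(\<integral>t. f t \<partial>\<nu>) - (\<integral>t. S t \<partial>\<nu>) = (\<integral>t. f t - S t \<partial>\<nu>)"
      using f_int S_int by simp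
    also have "\<bar>\<dots>\<bar> \<le> (\<integral>t. \<bar>f t - S t\<bar> \<partial>\<nu>)" by (rule integral_abs_bound)
    also have "\<dots> \<le> (\<integral>t. 1 / m \<partial>\<nu>)"
      using \<nu>(3) Sf f_int S_int by (intro integral_mono_AE) auto
    finally show ?thesis by (simp add: \<nu>.prob_space)
  qed
  have 2: "\<bar>(\<Sum>i\<in>I. f (x i)) / card I - (\<Sum>i\<in>I. S (x i)) / card I\<bar> \<le> 1 / m"
  proof -
    have "\<bar>\<Sum>i\<in>I. f (x i) - S (x i)\<bar> \<le> (\<Sum>i\<in>I. \<bar>f (x i) - S (x i)\<bar>)" by (rule sum_abs)
    also have "\<dots> \<le> of_nat (card I) * (1 / m)" by (rule sum_bounded_above) (use Sf x in auto)
    finally have "\<bar>\<Sum>i\<in>I. f (x i) - S (x i)\<bar> / card I \<le> 1 / m"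
      using n by (simp add: field_simps)
    then show ?thesis using n by (simp add: sum_subtractf abs_divide diff_divide_distrib[symmetric])
  qed
  define e where "e k = (\<Sum>i\<in>I. indicator {..real k / m} (x i) :: real)" for k :: nat
  have 3: "\<bar>(\<Sum>i\<in>I. S (x i)) / card I - (\<integral>t. S t \<partial>\<nu>)\<bar> \<le> \<eta>"
  proof -
    have "(\<Sum>i\<in>I. S (x i)) = card I * f 1 - (\<Sum>i\<in>I. \<Sum>k<m. c k * indicator {..real k / m} (x i))"
      by (simp add: S_def sum_subtractf)
    also have "(\<Sum>i\<in>I. \<Sum>k<m. c k * indicator {..real k / m} (x i))
        = (\<Sum>k<m. c k * (\<Sum>i\<in>I. indicator {..real k / m} (x i)))"
      by (subst sum.swap) (simp add: sum_distrib_left)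
    finally have "(\<Sum>i\<in>I. S (x i)) / card I - (\<integral>t. S t \<partial>\<nu>)
        = - (\<Sum>k<m. c k * ((\<Sum>i\<in>I. indicator {..real k / m} (x i)) / card I - cdf \<nu> (real k / m)))"
      using n unfolding S_exp e_def[symmetric]
      by (simp add: diff_divide_distrib sum_subtractf right_diff_distrib sum_divide_distrib)
    also have "\<bar>\<dots>\<bar> \<le> (\<Sum>k<m. \<bar>c k * ((\<Sum>i\<in>I. indicator {..real k / m} (x i)) / card I - cdf \<nu> (real k / m))\<bar>)"
      by (simp only: abs_minus_cancel sum_abs)
    also have "\<dots> \<le> (\<Sum>k<m. 1 / m * \<eta>)"
      unfolding abs_mult using c close by (intro sum_mono mult_mono) auto
    also have "\<dots> = \<eta>" using m by simp
    finally show ?thesis .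
  qed
  from 1 2 3 show ?thesis by linarith
qed

text \<open>Times \<open>m\<close>, a ramp lies between the indicators of exceeding its right and
  its left end. Comparing ramp means thus compares distribution functions at neighbouring grid
  points.\<close>

lemma ramp_mean_bounds:
  assumes P: "prob_space P" and U [measurable]: "U \<in> borel_measurable P" and m: "m > 0"
  shows "(\<integral>z. ramp m k (U z) \<partial>P) \<le> 1 / m * (1 - measure P {z \<in> space P. U z \<le> real k / m})"
    and "1 / m * (1 - measure P {z \<in> space P. U z \<le> real (Suc k) / m}) \<le> (\<integral>z. ramp m k (U z) \<partial>P)"
proof -
  interpret prob_space P by fact
  have int: "integrable P (\<lambda>z. ramp m k (U z))"
    by (rule integrable_const_bound[where B = "1 / m"])
      (use ramp_bounds(1,2)[OF m] in auto)
  have ind_int: "integrable P (\<lambda>z. 1 / m * indicator {t<..} (U z))" for t :: real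
    by (rule integrable_const_bound[where B = "1 / m"]) (auto simp: indicator_def)
  have eq: "(\<integral>z. 1 / m * indicator {t<..} (U z) \<partial>P) = 1 / m * (1 - measure P {z \<in> space P. U z \<le> t})" for t
  proof -
    have "(\<integral>z. indicator {t<..} (U z) \<partial>P) = (\<integral>z. indicator {z \<in> space P. t < U z} z \<partial>P)"
      by (intro Bochner_Integration.integral_cong) (auto simp: indicator_def)
    also have "\<dots> = measure P {z \<in> space P. t < U z}" by simp
    also have "{z \<in> space P. t < U z} = space P - {z \<in> space P. U z \<le> t}" by auto
    also have "measure P \<dots> = 1 - measure P {z \<in> space P. U z \<le> t}"
      by (intro prob_compl) measurable
    finally show ?thesis by simp
  qed
  show "(\<integral>z. ramp m k (U z) \<partial>P) \<le> 1 / m * (1 - measure P {z \<in> space P. U z \<le> real k / m})"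
    unfolding eq[symmetric] using ramp_bounds(3)[OF m] by (intro integral_mono int ind_int)
  show "1 / m * (1 - measure P {z \<in> space P. U z \<le> real (Suc k) / m}) \<le> (\<integral>z. ramp m k (U z) \<partial>P)"
    unfolding eq[symmetric] using ramp_bounds(4)[OF m] by (intro integral_mono int ind_int)
qed

text \<open>Polya's argument: monotonicity of \<open>H\<close> fills the gaps between the grid points.\<close>

lemma cdf_uniformly_close:
  fixes G H \<Phi> :: "real \<Rightarrow> real" and m :: nat
  assumes m: "m > 0" and H: "mono H" "\<And>t. 0 \<le> H t" "\<And>t. H t \<le> 1"
    and \<Phi>: "\<And>t. t < 0 \<Longrightarrow> \<Phi> t = 0" "\<And>t. t \<ge> 1 \<Longrightarrow> \<Phi> t = 1"
    and mod: "\<And>s t. \<bar>s - t\<bar> \<le> 2 / m \<Longrightarrow> \<bar>\<Phi> s - \<Phi> t\<bar> \<le> \<omega>"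
    and up: "\<And>k. k < m \<Longrightarrow> G (real k / m) \<le> \<Phi> (real (Suc k) / m) + e"
    and low: "\<And>k. k < m \<Longrightarrow> G (real (Suc k) / m) \<ge> \<Phi> (real k / m) - e"
    and HG: "\<And>k. k \<le> m \<Longrightarrow> \<bar>H (real k / m) - G (real k / m)\<bar> \<le> d"
    and e: "e \<ge> 0" and d: "d \<ge> 0" and x: "x \<in> {0..1}"
  shows "\<bar>H x - \<Phi> x\<bar> \<le> \<omega> + e + d"
proof -
  define j where "j = nat \<lfloor>x * m\<rfloor>"
  have x01: "0 \<le> x * m" "x * m \<le> m" using x by (auto simp: mult_left_le_one_le)
  have j: "j \<le> x * m" "x * m < j + 1" "j \<le> m" using x01 unfolding j_def by linarith+
  have jx: "real j / m \<le> x" "x \<le> real (Suc j) / m" using j m by (auto simp: field_simps)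
  have step: "real (Suc i) / m = real i / m + 1 / m" for i by (simp add: add_divide_distrib)
  have dm: "1 / real m > 0" using m by simp
  have \<omega>: "\<omega> \<ge> 0" using mod[of 0 0] dm by simp
  \<comment> \<open>\<open>H\<close> is increased to grid point \<open>j + 1\<close>, where
    \<open>up\<close> costs one further step. Grid point \<open>j + 2\<close> is within
    \<open>2 / m\<close> of \<open>x\<close>, which is the origin of the \<open>2 / m\<close> in
    \<open>mod\<close>. If \<open>j + 1 \<ge> m\<close>, then \<open>\<Phi>\<close> has already
    reached 1 there.\<close>
  have "H x \<le> \<Phi> x + (\<omega> + e + d)"
  proof (cases "Suc j < m")
    case True
    have "H x \<le> H (real (Suc j) / m)" using H(1) jx(2) by (rule monoD)
    also have "\<dots> \<le> G (real (Suc j) / m) + d" using HG[of "Suc j"] True by linarith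
    also have "\<dots> \<le> \<Phi> (real (Suc (Suc j)) / m) + e + d" using up[OF True] by linarith
    also have "\<dots> \<le> \<Phi> x + (\<omega> + e + d)"
      using mod[of "real (Suc (Suc j)) / m" x] jx step[of "Suc j"] step[of j] dm by linarith
    finally show ?thesis .
  next
    case False
    then have "1 \<le> real (Suc j) / m" using m by (simp add: field_simps)
    then have "\<Phi> (real (Suc j) / m) = 1" by (rule \<Phi>(2))
    then show ?thesis
      using mod[of "real (Suc j) / m" x] jx step[of j] dm H(3)[of x] e d by linarith
  qed
  moreover have "H x \<ge> \<Phi> x - (\<omega> + e + d)"
  proof (cases j)
    case 0
    \<comment> \<open>There is no grid point below to step to; a negative point, where
      \<open>\<Phi>\<close> vanishes, takes its place.\<close>
    have "\<bar>x - (- (1 / real m))\<bar> \<le> 2 / m" using x jx step[of 0] dm by (simp add: 0)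
    then have "\<bar>\<Phi> x - \<Phi> (- (1 / real m))\<bar> \<le> \<omega>" by (rule mod)
    then show ?thesis using \<Phi>(1)[of "- (1 / real m)"] dm H(2)[of x] e d by simp
  next
    case (Suc i)
    have "\<Phi> x \<le> \<Phi> (real i / m) + \<omega>"
      using mod[of x "real i / m"] jx step[of i] step[of j] dm by (simp add: Suc)
    also have "\<Phi> (real i / m) \<le> G (real j / m) + e" using low[of i] j(3) Suc by simp
    also have "G (real j / m) \<le> H (real j / m) + d" using HG[of j] j(3) by linarith
    also have "H (real j / m) \<le> H x" using H(1) jx(1) by (rule monoD)
    finally show ?thesis by simp
  qed
  ultimately show ?thesis by linarith
qed

section \<open>Laws of large numbers\<close>

context prob_space
begin

text \<open>Chebyshev's inequality, with the second moment of the sum bounded row by row: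
  \<open>card I\<close> rows, each contributing at most \<open>B\<close>.\<close>

lemma mean_deviation:
  fixes V :: "'i \<Rightarrow> 'a \<Rightarrow> real" and \<eta> :: real
  assumes I: "finite I" "I \<noteq> {}" and V [measurable]: "\<And>i. i \<in> I \<Longrightarrow> V i \<in> borel_measurable M"
    and bound: "\<And>i x. i \<in> I \<Longrightarrow> x \<in> space M \<Longrightarrow> \<bar>V i x\<bar> \<le> 1"
    and cov: "\<And>i. i \<in> I \<Longrightarrow> (\<Sum>j\<in>I. expectation (\<lambda>x. V i x * V j x)) \<le> B"
    and \<eta>: "\<eta> > 0"
  shows "prob {x \<in> space M. \<bar>(\<Sum>i\<in>I. V i x) / card I\<bar> \<ge> \<eta>} \<le> B / (card I * \<eta>\<^sup>2)"
proof -
  define n where "n = real (card I)"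
  have n: "n > 0" using I by (simp add: n_def card_gt_0_iff)
  have VV: "integrable M (\<lambda>x. V i x * V j x)" if "i \<in> I" "j \<in> I" for i j
    using that
    by (intro integrable_const_bound[where B = 1])
      (auto simp: abs_mult intro!: mult_le_one bound AE_I2)
  have sq: "(\<Sum>i\<in>I. V i x)\<^sup>2 = (\<Sum>i\<in>I. \<Sum>j\<in>I. V i x * V j x)" for x
    by (simp add: power2_eq_square sum_product)
  have int: "integrable M (\<lambda>x. (\<Sum>i\<in>I. V i x)\<^sup>2)"
    unfolding sq by (intro Bochner_Integration.integrable_sum VV)
  have "expectation (\<lambda>x. (\<Sum>i\<in>I. V i x)\<^sup>2) = (\<Sum>i\<in>I. \<Sum>j\<in>I. expectation (\<lambda>x. V i x * V j x))"
    unfolding sq by (simp add: VV Bochner_Integration.integral_sum Bochner_Integration.integrable_sum)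
  also have "\<dots> \<le> (\<Sum>i\<in>I. B)" by (intro sum_mono cov)
  finally have E: "expectation (\<lambda>x. (\<Sum>i\<in>I. V i x)\<^sup>2) \<le> n * B" by (simp add: n_def)
  have "{x \<in> space M. \<bar>(\<Sum>i\<in>I. V i x) / card I\<bar> \<ge> \<eta>} = {x \<in> space M. (\<Sum>i\<in>I. V i x)\<^sup>2 \<ge> (n * \<eta>)\<^sup>2}"
  proof (intro Collect_cong conj_cong refl)
    fix x
    have "\<bar>(\<Sum>i\<in>I. V i x) / card I\<bar> \<ge> \<eta> \<longleftrightarrow> n * \<eta> \<le> \<bar>\<Sum>i\<in>I. V i x\<bar>"
      using n by (simp add: abs_divide n_def field_simps)
    also have "\<dots> \<longleftrightarrow> (n * \<eta>)\<^sup>2 \<le> (\<Sum>i\<in>I. V i x)\<^sup>2"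
      using n \<eta> by (simp flip: abs_le_square_iff)
    finally show "\<bar>(\<Sum>i\<in>I. V i x) / card I\<bar> \<ge> \<eta> \<longleftrightarrow> (\<Sum>i\<in>I. V i x)\<^sup>2 \<ge> (n * \<eta>)\<^sup>2" .
  qed
  also have "prob \<dots> \<le> expectation (\<lambda>x. (\<Sum>i\<in>I. V i x)\<^sup>2) / (n * \<eta>)\<^sup>2"
    using n \<eta> by (intro integral_Markov_inequality_measure[OF int sets.top]) auto
  also have "\<dots> \<le> (n * B) / (n * \<eta>)\<^sup>2" using E by (intro divide_right_mono) auto
  also have "\<dots> = B / (card I * \<eta>\<^sup>2)"
    using n by (simp add: n_def power2_eq_square)
  finally show ?thesis .
qed

text \<open>For centred indicators the covariance is
  \<open>prob (A i \<inter> A j) - p\<^sup>2\<close>, the kind of quantity that a mixing coefficient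
  bounds.\<close>

lemma event_frequency_deviation:
  fixes p B \<eta> :: real
  assumes I: "finite I" "I \<noteq> {}" and A: "\<And>i. i \<in> I \<Longrightarrow> A i \<in> events" "\<And>i. i \<in> I \<Longrightarrow> prob (A i) = p"
    and cov: "\<And>i. i \<in> I \<Longrightarrow> (\<Sum>j\<in>I. \<bar>prob (A i \<inter> A j) - p\<^sup>2\<bar>) \<le> B" and \<eta>: "\<eta> > 0"
  shows "prob {x \<in> space M. \<bar>(\<Sum>i\<in>I. indicator (A i) x) / card I - p\<bar> \<ge> \<eta>} \<le> B / (card I * \<eta>\<^sup>2)"
proof -
  have n: "real (card I) > 0" using I by (simp add: card_gt_0_iff)
  obtain i0 where "i0 \<in> I" using I by blast
  then have p: "0 \<le> p" "p \<le> 1" using A(2)[of i0] measure_nonneg[of M "A i0"] prob_le_1[of "A i0"] by auto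
  define V where "V i x = indicator (A i) x - p" for i x
  have cov_eq: "expectation (\<lambda>x. V i x * V j x) = prob (A i \<inter> A j) - p\<^sup>2" if "i \<in> I" "j \<in> I" for i j
  proof -
    have [measurable]: "A i \<in> events" "A j \<in> events" using A that by auto
    have ind: "integrable M (indicator (S :: 'a set) :: 'a \<Rightarrow> real)" if "S \<in> events" for S
      by (rule integrable_const_bound[where B = 1]) (use that in \<open>auto simp: indicator_def\<close>)
    have "(\<lambda>x. V i x * V j x) = (\<lambda>x. indicator (A i \<inter> A j) x - p * indicator (A i) x - p * indicator (A j) x + p\<^sup>2)"
      by (auto simp: V_def indicator_def fun_eq_iff power2_eq_square algebra_simps)
    then have "expectation (\<lambda>x. V i x * V j x)
        = expectation (\<lambda>x. indicator (A i \<inter> A j) x - p * indicator (A i) x - p * indicator (A j) x + p\<^sup>2)"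
      by simp
    also have "\<dots> = prob (A i \<inter> A j) - p * prob (A i) - p * prob (A j) + p\<^sup>2"
      by (simp add: ind prob_space)
    finally show ?thesis using A that by (simp add: power2_eq_square)
  qed
  have "(\<Sum>i\<in>I. V i x) / card I = (\<Sum>i\<in>I. indicator (A i) x) / card I - p" for x
    using n by (simp add: V_def sum_subtractf field_simps)
  moreover have "prob {x \<in> space M. \<bar>(\<Sum>i\<in>I. V i x) / card I\<bar> \<ge> \<eta>} \<le> B / (card I * \<eta>\<^sup>2)"
  proof (rule mean_deviation[OF I])
    show "V i \<in> borel_measurable M" if "i \<in> I" for i
      unfolding V_def using A(1)[OF that] by measurable
    show "\<bar>V i x\<bar> \<le> 1" for i x using p by (auto simp: V_def indicator_def)
    fix i assume i: "i \<in> I"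
    have "(\<Sum>j\<in>I. expectation (\<lambda>x. V i x * V j x)) \<le> (\<Sum>j\<in>I. \<bar>prob (A i \<inter> A j) - p\<^sup>2\<bar>)"
      using i by (intro sum_mono) (simp add: cov_eq)
    with cov[OF i] show "(\<Sum>j\<in>I. expectation (\<lambda>x. V i x * V j x)) \<le> B" by linarith
  qed fact
  ultimately show ?thesis by simp
qed

lemma sum_prob_partition:
  assumes "finite P" "P \<subseteq> events" "partition_on (space M) P" "V \<in> events"
  shows "(\<Sum>U\<in>P. prob (U \<inter> V)) = prob V"
proof -
  have "disjoint_family_on (\<lambda>U. U \<inter> V) P"
    using disjointD[OF partition_onD2[OF assms(3)]] by (fastforce simp: disjoint_family_on_def)
  then have "(\<Sum>U\<in>P. prob (U \<inter> V)) = prob (\<Union>U\<in>P. U \<inter> V)"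
    using assms by (intro finite_measure_finite_Union[symmetric]) auto
  also have "(\<Union>U\<in>P. U \<inter> V) = V"
    using assms sets.sets_into_space[OF assms(4)] by (auto simp: partition_on_def)
  finally show ?thesis .
qed

text \<open>The partitions into a set and its complement are admissible in the supremum, and the
  left-hand side is one summand of their sum. The factor 2 undoes the \<open>1/2\<close> in
  \<open>beta_coeff\<close>.\<close>

lemma abs_cov_le_beta_coeff:
  assumes sub: "\<U> \<subseteq> events" "\<V> \<subseteq> events" and UV: "U \<in> \<U>" "V \<in> \<V>"
    and compl: "space M - U \<in> \<U>" "space M - V \<in> \<V>"
  shows "\<bar>prob (U \<inter> V) - prob U * prob V\<bar> \<le> 2 * beta_coeff M \<U> \<V>"
proof -
  let ?c = "\<lambda>U V. \<bar>prob (U \<inter> V) - prob U * prob V\<bar>"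
  define S where "S = (\<lambda>(P, Q). \<Sum>U\<in>P. \<Sum>V\<in>Q. ?c U V)"
  define \<P> where "\<P> = {(P, Q). finite P \<and> P \<subseteq> \<U> \<and> partition_on (space M) P \<and>
     finite Q \<and> Q \<subseteq> \<V> \<and> partition_on (space M) Q}"
  have beta: "2 * beta_coeff M \<U> \<V> = Sup (S ` \<P>)"
  proof -
    have "{(\<Sum>U\<in>P. \<Sum>V\<in>Q. ?c U V) | P Q.
       finite P \<and> P \<subseteq> \<U> \<and> partition_on (space M) P \<and>
       finite Q \<and> Q \<subseteq> \<V> \<and> partition_on (space M) Q} = S ` \<P>"
      unfolding S_def \<P>_def by (auto simp: image_def)
    then show ?thesis unfolding beta_coeff_def by simp
  qed
  \<comment> \<open>A real \<open>Sup\<close> dominates the members only of a set that is bounded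
    above. By the triangle inequality each sum is at most 2, as both partitions have total mass
    1.\<close>
  have bdd: "bdd_above (S ` \<P>)"
  proof (rule bdd_aboveI2)
    fix PQ assume "PQ \<in> \<P>"
    then obtain P Q where PQ: "PQ = (P, Q)" "finite P" "P \<subseteq> \<U>" "partition_on (space M) P"
      "finite Q" "Q \<subseteq> \<V>" "partition_on (space M) Q" by (auto simp: \<P>_def)
    have ev: "P \<subseteq> events" "Q \<subseteq> events" using PQ sub by auto
    have P1: "(\<Sum>U\<in>P. prob U) = 1"
      using sum_prob_partition[OF PQ(2) ev(1) PQ(4) sets.top] ev(1) sets.sets_into_space
      by (simp add: prob_space Int_absorb2 subset_iff)
    have Q1: "(\<Sum>V\<in>Q. prob V) = 1"
      using sum_prob_partition[OF PQ(5) ev(2) PQ(7) sets.top] ev(2) sets.sets_into_space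
      by (simp add: prob_space Int_absorb2 subset_iff)
    have "S PQ \<le> (\<Sum>U\<in>P. \<Sum>V\<in>Q. prob (U \<inter> V) + prob U * prob V)"
      unfolding S_def PQ(1) prod.case
    proof (intro sum_mono)
      fix U V
      have "0 \<le> prob (U \<inter> V)" "0 \<le> prob U * prob V" by simp_all
      then show "?c U V \<le> prob (U \<inter> V) + prob U * prob V" by linarith
    qed
    also have "\<dots> = (\<Sum>U\<in>P. (\<Sum>V\<in>Q. prob (V \<inter> U)) + prob U * (\<Sum>V\<in>Q. prob V))"
      by (simp add: sum.distrib sum_distrib_left Int_commute)
    also have "\<dots> = (\<Sum>U\<in>P. 2 * prob U)"
      using sum_prob_partition[OF PQ(5) ev(2) PQ(7)] ev(1) by (intro sum.cong) (auto simp: Q1)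
    also have "\<dots> = 2" by (simp add: sum_distrib_left[symmetric] P1)
    finally show "S PQ \<le> 2" .
  qed
  \<comment> \<open>A partition must not contain the empty set, which arises here when
    \<open>U\<close> is empty or the whole space.\<close>
  define P where "P = {U, space M - U} - {{}}"
  define Q where "Q = {V, space M - V} - {{}}"
  have spc: "U \<subseteq> space M" "V \<subseteq> space M" using sub UV sets.sets_into_space by blast+
  have PQ: "(P, Q) \<in> \<P>"
  proof -
    have part: "partition_on (space M) ({S, space M - S} - {{}})" if "S \<subseteq> space M" for S
    proof (rule partition_onI)
      show "\<Union> ({S, space M - S} - {{}}) = space M" using that by blast
      show "disjnt p p'" if "p \<in> {S, space M - S} - {{}}" "p' \<in> {S, space M - S} - {{}}" "p \<noteq> p'" for p p'
        using that by (auto simp: disjnt_def)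
    qed auto
    then show ?thesis
      unfolding \<P>_def P_def Q_def using UV compl part[OF spc(1)] part[OF spc(2)] by auto
  qed
  have "?c U V \<le> S (P, Q)"
  proof (cases "U = {} \<or> V = {}")
    case True
    then have "?c U V = 0" by auto
    also have "\<dots> \<le> S (P, Q)" unfolding S_def by (auto intro!: sum_nonneg)
    finally show ?thesis .
  next
    case False
    have "?c U V \<le> (\<Sum>V\<in>Q. ?c U V)"
      using False by (intro member_le_sum) (auto simp: Q_def)
    also have "\<dots> \<le> (\<Sum>U\<in>P. \<Sum>V\<in>Q. ?c U V)"
      using False
      by (intro member_le_sum[where f = "\<lambda>U. \<Sum>V\<in>Q. ?c U V"])
        (auto simp: P_def intro!: sum_nonneg)
    finally show ?thesis by (simp add: S_def)
  qed
  also have "\<dots> \<le> 2 * beta_coeff M \<U> \<V>"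
    unfolding beta by (rule cSUP_upper[OF PQ bdd])
  finally show ?thesis .
qed

lemma stationary_measurable:
  "strictly_stationary M X \<Longrightarrow> X i \<in> borel_measurable M"
  by (simp add: strictly_stationary_def)

lemma stationary_shift:
  assumes X: "strictly_stationary M X" and J: "finite J" and A: "\<And>i. i \<in> J \<Longrightarrow> A i \<in> sets borel"
  shows "prob {x \<in> space M. \<forall>i\<in>J. X (i + h) x \<in> A i} = prob {x \<in> space M. \<forall>i\<in>J. X i x \<in> A i}"
proof -
  note [measurable] = stationary_measurable[OF X]
  have *: "prob {x \<in> space M. \<forall>i\<in>J. X (i + s) x \<in> A i}
      = measure (distr M (PiM J (\<lambda>_. borel)) (\<lambda>\<omega>. \<lambda>i\<in>J. X (i + s) \<omega>)) (PiE J A)" for s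
  proof (subst measure_distr)
    show "PiE J A \<in> sets (PiM J (\<lambda>_. borel))" using J A by (intro sets_PiM_I_finite) auto
    show "(\<lambda>\<omega>. \<lambda>i\<in>J. X (i + s) \<omega>) \<in> M \<rightarrow>\<^sub>M (PiM J (\<lambda>_. borel))" by measurable
    show "prob {x \<in> space M. \<forall>i\<in>J. X (i + s) x \<in> A i} =
      prob ((\<lambda>\<omega>. \<lambda>i\<in>J. X (i + s) \<omega>) -` PiE J A \<inter> space M)"
      by (intro arg_cong[where f = prob]) (auto simp: PiE_iff)
  qed
  have "distr M (PiM J (\<lambda>_. borel)) (\<lambda>\<omega>. \<lambda>i\<in>J. X (i + h) \<omega>) =
        distr M (PiM J (\<lambda>_. borel)) (\<lambda>\<omega>. \<lambda>i\<in>J. X (i + 0) \<omega>)"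
    using X J by (simp add: strictly_stationary_def)
  with *[of h] *[of 0] show ?thesis by simp
qed

text \<open>A shift moves the pair \<open>i\<close>, \<open>j\<close> to \<open>0\<close>,
  \<open>j - i\<close>, which places the events in the past and the future algebra of the mixing
  coefficient.\<close>

lemma stationary_cov_le_beta_mixing:
  assumes X: "strictly_stationary M X" and A: "A \<in> sets borel" and ij: "i < j"
  defines "E \<equiv> \<lambda>i. {x \<in> space M. X i x \<in> A}"
  shows "\<bar>prob (E i \<inter> E j) - prob (E i) * prob (E j)\<bar> \<le> 2 * beta_mixing M X (nat (j - i))"
proof -
  define k where "k = nat (j - i)"
  have k: "k \<noteq> 0" "int k = j - i" using ij by (auto simp: k_def)
  note [measurable] = stationary_measurable[OF X] A
  have shift2: "prob (E i \<inter> E j) = prob (E 0 \<inter> E (int k))"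
  proof -
    have "prob {x \<in> space M. \<forall>l\<in>{0, int k}. X (l + i) x \<in> A} = prob {x \<in> space M. \<forall>l\<in>{0, int k}. X l x \<in> A}"
      by (rule stationary_shift[OF X]) (use A in auto)
    moreover have "{x \<in> space M. \<forall>l\<in>{0, int k}. X (l + i) x \<in> A} = E i \<inter> E j"
      using k by (auto simp: E_def)
    moreover have "{x \<in> space M. \<forall>l\<in>{0, int k}. X l x \<in> A} = E 0 \<inter> E (int k)"
      by (auto simp: E_def)
    ultimately show ?thesis by simp
  qed
  have shift1: "prob (E l) = prob (E 0)" for l
    using stationary_shift[OF X, of "{0}" "\<lambda>_. A" l] A by (simp add: E_def)
  let ?U = "sigma_sets (space M) (generators M borel X {..0})"
  let ?V = "sigma_sets (space M) (generators M borel X {int k..})"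
  have gen: "generators M borel X J \<subseteq> events" for J by (auto simp: generators_def)
  have E_gen: "E l \<in> sigma_sets (space M) (generators M borel X J)" if "l \<in> J" for l J
  proof (rule sigma_sets.Basic)
    have "E l = X l -` A \<inter> space M" by (auto simp: E_def)
    with that A show "E l \<in> generators M borel X J" unfolding generators_def by blast
  qed
  have "\<bar>prob (E 0 \<inter> E (int k)) - prob (E 0) * prob (E (int k))\<bar> \<le> 2 * beta_coeff M ?U ?V"
    by (rule abs_cov_le_beta_coeff)
      (use sets.sigma_sets_subset[OF gen] E_gen in \<open>auto simp: subset_iff intro!: sigma_sets.Compl\<close>)
  also have "beta_coeff M ?U ?V = beta_mixing M X k" using k by (simp add: beta_mixing_def)
  finally show ?thesis using shift2 shift1[of i] shift1[of j] shift1[of "int k"] by (simp add: k_def)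
qed

text \<open>Each distance from \<open>i\<close> occurs at most once on either side of
  \<open>i\<close>.\<close>

lemma sum_dist_le_suminf:
  fixes g :: "nat \<Rightarrow> real"
  assumes g: "summable g" "\<And>k. g k \<ge> 0"
  shows "(\<Sum>j\<in>{1..n}. g (if j \<le> i then i - j else j - i)) \<le> 2 * suminf g"
proof -
  have "(\<Sum>j\<in>{1..n}. g (if j \<le> i then i - j else j - i))
      = (\<Sum>j\<in>{1..n} \<inter> {..i}. g (i - j)) + (\<Sum>j\<in>{1..n} \<inter> {i<..}. g (j - i))"
  proof -
    have *: "{1..n} = ({1..n} \<inter> {..i}) \<union> ({1..n} \<inter> {i<..})" by auto
    show ?thesis by (subst *, subst sum.union_disjoint) (auto intro!: sum.cong)
  qed
  moreover have "(\<Sum>j\<in>{1..n} \<inter> {..i}. g (i - j)) \<le> suminf g"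
  proof -
    have "(\<Sum>j\<in>{1..n} \<inter> {..i}. g (i - j)) = sum g ((\<lambda>j. i - j) ` ({1..n} \<inter> {..i}))"
      by (subst sum.reindex) (auto simp: inj_on_def)
    also have "\<dots> \<le> suminf g" using g by (intro sum_le_suminf) auto
    finally show ?thesis .
  qed
  moreover have "(\<Sum>j\<in>{1..n} \<inter> {i<..}. g (j - i)) \<le> suminf g"
  proof -
    have "(\<Sum>j\<in>{1..n} \<inter> {i<..}. g (j - i)) = sum g ((\<lambda>j. j - i) ` ({1..n} \<inter> {i<..}))"
      by (subst sum.reindex) (auto simp: inj_on_def)
    also have "\<dots> \<le> suminf g" using g by (intro sum_le_suminf) auto
    finally show ?thesis .
  qed
  ultimately show ?thesis by linarith
qed

text \<open>\<open>\<alpha> > 1\<close> makes the covariances summable in the time lag, so the row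
  sums of the covariance matrix are bounded uniformly in \<open>n\<close>, in \<open>A\<close> and
  in the position of the row.\<close>

lemma mixing_frequency_deviation:
  assumes X: "strictly_stationary M X" and mix: "\<alpha> > 1" "\<kappa> \<ge> 0"
    "\<And>k. k \<ge> 1 \<Longrightarrow> beta_mixing M X k \<le> \<kappa> * real k powr (- \<alpha>)"
  shows "\<exists>B. \<forall>n\<ge>1. \<forall>A\<in>sets borel. \<forall>\<eta>>0::real.
    prob {x \<in> space M. \<bar>(\<Sum>i=1..n. indicator A (X (int i) x)) / n - measure (distr M borel (X 1)) A\<bar> \<ge> \<eta>}
      \<le> B / (n * \<eta>\<^sup>2)"
proof -
  \<comment> \<open>The value 1 at lag 0 covers the diagonal term \<open>p * (1 - p)\<close>; the
    factor 2 elsewhere is that of the covariance bound.\<close>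
  define g where "g k = (if k = 0 then 1 else 2 * (\<kappa> * real k powr (- \<alpha>)))" for k :: nat
  have "summable (\<lambda>k. real k powr (- \<alpha>))" using mix(1) by (simp add: summable_real_powr_iff)
  then have "summable (\<lambda>k. 2 * (\<kappa> * real k powr (- \<alpha>)))" by (intro summable_mult)
  then have g: "summable g"
    by (rule summable_cong[THEN iffD1, rotated]) (auto simp: g_def eventually_sequentially intro!: exI[of _ 1])
  have g0: "g k \<ge> 0" for k using mix(2) by (simp add: g_def)
  show ?thesis
  proof (intro exI[of _ "2 * suminf g"] allI impI ballI)
    fix n :: nat and A :: "real set" and \<eta> :: real
    assume n: "n \<ge> 1" and A: "A \<in> sets borel" and \<eta>: "\<eta> > 0"
    note [measurable] = stationary_measurable[OF X] A
    define E where "E i = {x \<in> space M. X (int i) x \<in> A}" for i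
    define p where "p = measure (distr M borel (X 1)) A"
    have pE: "prob (E i) = p" for i
    proof -
      have "prob (E i) = prob {x \<in> space M. X 1 x \<in> A}"
        using stationary_shift[OF X, of "{1}" "\<lambda>_. A" "int i - 1"] A by (simp add: E_def)
      also have "\<dots> = p" unfolding p_def
        by (subst measure_distr) (auto intro!: arg_cong[where f = prob])
      finally show ?thesis .
    qed
    have cov: "\<bar>prob (E i \<inter> E j) - p\<^sup>2\<bar> \<le> g (if j \<le> i then i - j else j - i)" for i j
    proof -
      have main: "\<bar>prob (E i \<inter> E j) - p\<^sup>2\<bar> \<le> g (j - i)" if "i < j" for i j
      proof -
        have "\<bar>prob (E i \<inter> E j) - prob (E i) * prob (E j)\<bar> \<le> 2 * beta_mixing M X (nat (int j - int i))"
          unfolding E_def by (rule stationary_cov_le_beta_mixing[OF X A]) (use that in simp)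
        also have "nat (int j - int i) = j - i" by simp
        also have "2 * beta_mixing M X (j - i) \<le> g (j - i)"
          using mix(3)[of "j - i"] that by (simp add: g_def)
        finally show ?thesis by (simp add: pE power2_eq_square)
      qed
      consider "i < j" | "j < i" | "i = j" by linarith
      then show ?thesis
      proof cases
        case 1
        with main show ?thesis by simp
      next
        case 2
        with main[of j i] show ?thesis by (simp add: Int_commute)
      next
        case 3
        have "0 \<le> p" "p \<le> 1" using pE[of 0] by (auto simp flip: pE[of 0])
        then have "0 \<le> p * (1 - p)" "p * (1 - p) \<le> 1 * 1" by (simp, intro mult_mono) auto
        with 3 show ?thesis by (simp add: pE g_def power2_eq_square algebra_simps abs_le_iff)
      qed
    qed
    have "prob {x \<in> space M. \<bar>(\<Sum>i\<in>{1..n}. indicator (E i) x) / card {1..n} - p\<bar> \<ge> \<eta>}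
        \<le> 2 * suminf g / (card {1..n} * \<eta>\<^sup>2)"
    proof (rule event_frequency_deviation)
      fix i
      have "(\<Sum>j\<in>{1..n}. \<bar>prob (E i \<inter> E j) - p\<^sup>2\<bar>)
          \<le> (\<Sum>j\<in>{1..n}. g (if j \<le> i then i - j else j - i))"
        by (intro sum_mono cov)
      also have "\<dots> \<le> 2 * suminf g" by (rule sum_dist_le_suminf[OF g g0])
      finally show "(\<Sum>j\<in>{1..n}. \<bar>prob (E i \<inter> E j) - p\<^sup>2\<bar>) \<le> 2 * suminf g" .
    qed (use n \<eta> pE in \<open>auto simp: E_def\<close>)
    also have "{x \<in> space M. \<bar>(\<Sum>i\<in>{1..n}. indicator (E i) x) / card {1..n} - p\<bar> \<ge> \<eta>}
        = {x \<in> space M. \<bar>(\<Sum>i=1..n. indicator A (X (int i) x)) / n - p\<bar> \<ge> \<eta>}"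
      by (intro Collect_cong conj_cong refl) (simp add: E_def indicator_def)
    finally show "prob {x \<in> space M. \<bar>(\<Sum>i=1..n. indicator A (X (int i) x)) / n
        - measure (distr M borel (X 1)) A\<bar> \<ge> \<eta>} \<le> 2 * suminf g / (n * \<eta>\<^sup>2)"
      by (simp add: p_def)
  qed
qed

text \<open>Hoeffding's inequality. The exponential decay, in contrast to the Chebyshev bounds for
  the other averages, is what survives multiplication by the cardinality of a cover.\<close>

lemma iid_mean_deviation:
  fixes \<phi> :: "'c \<Rightarrow> real" and \<epsilon> :: real
  assumes I: "finite I" "I \<noteq> {}" and indep: "indep_vars (\<lambda>_. N) Z I"
    and distr: "\<And>i. i \<in> I \<Longrightarrow> distr M N (Z i) = PZ"
    and \<phi>: "\<phi> \<in> borel_measurable N" "\<And>z. 0 \<le> \<phi> z" "\<And>z. \<phi> z \<le> 1" and \<epsilon>: "\<epsilon> \<ge> 0"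
  shows "prob {x \<in> space M. \<bar>(\<Sum>i\<in>I. \<phi> (Z i x)) / card I - (\<integral>z. \<phi> z \<partial>PZ)\<bar> \<ge> \<epsilon>}
    \<le> 2 * exp (- 2 * card I * \<epsilon>\<^sup>2)"
proof -
  obtain i0 where i0: "i0 \<in> I" using I by blast
  have rv: "random_variable N (Z i)" if "i \<in> I" for i
    using indep that by (simp add: indep_vars_def)
  have dY: "distr M borel (\<lambda>x. \<phi> (Z i x)) = distr PZ borel \<phi>" if "i \<in> I" for i
    using distr_distr[OF \<phi>(1) rv[OF that]] distr[OF that] by (simp add: o_def)
  interpret Hoeffding_ineq_iid M I "\<lambda>i x. \<phi> (Z i x)" "\<lambda>x. \<phi> (Z i0 x)" 0 1 "expectation (\<lambda>x. \<phi> (Z i0 x))"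
  proof unfold_locales
    show "indep_vars (\<lambda>_. borel) (\<lambda>i x. \<phi> (Z i x)) I"
      by (rule indep_vars_compose2[OF indep]) (use \<phi> in auto)
    show "distr M borel (\<lambda>x. \<phi> (Z i x)) = distr M borel (\<lambda>x. \<phi> (Z i0 x))" if "i \<in> I" for i
      using dY that i0 by simp
    show "random_variable borel (\<lambda>x. \<phi> (Z i0 x))"
      using \<phi>(1) rv[OF i0] by (rule measurable_compose_rev)
    show "AE x in M. \<phi> (Z i0 x) \<in> {0..1}" using \<phi> by simp
    show "expectation (\<lambda>x. \<phi> (Z i0 x)) \<equiv> expectation (\<lambda>x. \<phi> (Z i0 x))" by simp
  qed (fact I)
  have "expectation (\<lambda>x. \<phi> (Z i0 x)) = (\<integral>z. \<phi> z \<partial>distr M N (Z i0))"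
    using \<phi>(1) rv[OF i0] by (simp add: integral_distr)
  then have "expectation (\<lambda>x. \<phi> (Z i0 x)) = (\<integral>z. \<phi> z \<partial>PZ)" using distr[OF i0] by simp
  with Hoeffding_ineq_abs_ge'[OF \<epsilon>] I(2) show ?thesis by simp
qed

lemma indep_vars_pair:
  assumes "indep_vars N Z I" "i \<in> I" "j \<in> I" "i \<noteq> j"
  shows "indep_var (N i) (Z i) (N j) (Z j)"
proof -
  let ?S = "\<lambda>i. sigma_sets (space M) {Z i -` A \<inter> space M | A. A \<in> sets (N i)}"
  have rv: "random_variable (N i) (Z i)" "random_variable (N j) (Z j)"
    and ind: "indep_sets ?S I" using assms by (auto simp: indep_vars_def)
  have "indep_set (?S i) (?S j)"
    unfolding indep_sets2_eq
  proof (intro conjI ballI)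
    show "?S i \<subseteq> events" "?S j \<subseteq> events" using ind assms by (auto simp: indep_sets_def)
    fix a b assume "a \<in> ?S i" "b \<in> ?S j"
    then have "prob (\<Inter>k\<in>{i, j}. (if k = i then a else b)) = (\<Prod>k\<in>{i, j}. prob (if k = i then a else b))"
      using assms by (intro indep_setsD[OF ind]) auto
    then show "prob (a \<inter> b) = prob a * prob b" using assms(4) by (simp add: Int_commute)
  qed
  with rv show ?thesis by (simp add: indep_var_eq)
qed

text \<open>
  Given \<open>D\<close>, the summands are centred and independent, hence uncorrelated.
\<close>

lemma conditional_mean_deviation:
  fixes h :: "'a \<Rightarrow> 'c \<Rightarrow> real" and \<eta> :: real
  assumes D: "space D = space M" "sets D \<subseteq> events"
    and indep: "indep_vars (\<lambda>_. N) \<zeta> {1..}" and distr: "\<And>j. j \<ge> 1 \<Longrightarrow> distr M N (\<zeta> j) = PZ"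
    and indD: "indep_set (sets D) (sigma_sets (space M) (generators M N \<zeta> {1..}))"
    and h: "(\<lambda>(x, z). h x z) \<in> borel_measurable (D \<Otimes>\<^sub>M N)" "\<And>x z. 0 \<le> h x z" "\<And>x z. h x z \<le> 1"
    and n: "(n::nat) \<ge> 1" and \<eta>: "\<eta> > 0"
  shows "{x \<in> space M. \<bar>(\<Sum>j=1..n. h x (\<zeta> j x)) / n - (\<integral>z. h x z \<partial>PZ)\<bar> \<ge> \<eta>} \<in> events" (is ?meas)
    and "prob {x \<in> space M. \<bar>(\<Sum>j=1..n. h x (\<zeta> j x)) / n - (\<integral>z. h x z \<partial>PZ)\<bar> \<ge> \<eta>} \<le> 1 / (n * \<eta>\<^sup>2)" (is ?dev)
proof -
  have rv [measurable]: "random_variable N (\<zeta> j)" if "j \<ge> 1" for j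
    using indep that by (simp add: indep_vars_def)
  have PZ: "prob_space PZ" using prob_space_distr[OF rv[of 1]] distr[of 1] by simp
  have sPZ [measurable_cong]: "sets PZ = sets N" using distr[of 1] by auto
  interpret PZ: prob_space PZ by fact
  interpret PP: pair_prob_space PZ PZ ..
  have idD [measurable]: "(\<lambda>x. x) \<in> M \<rightarrow>\<^sub>M D"
    using D by (intro measurableI) (auto simp: sets.Int_space_eq2 dest: sets.sets_into_space)
  \<comment> \<open>\<open>M\<close> restricted to the algebra \<open>D\<close>, written as an image
    measure. The sample point itself plays the role of a \<open>D\<close>-valued variable, so that
    \<open>h x\<close> with random \<open>x\<close> becomes a function on a product space.\<close>
  define DM where "DM = distr M D (\<lambda>x. x)"
  have sDM [measurable_cong]: "sets DM = sets D" by (simp add: DM_def)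
  interpret DM: prob_space DM unfolding DM_def by (rule prob_space_distr) measurable
  interpret DPP: pair_prob_space DM "PZ \<Otimes>\<^sub>M PZ" ..
  note [measurable] = h(1)
  define G where "G x = (\<integral>z. h x z \<partial>PZ)" for x
  have G [measurable]: "G \<in> borel_measurable D"
  proof -
    have "(\<lambda>(x, z). h x z) \<in> borel_measurable (D \<Otimes>\<^sub>M PZ)" by measurable
    then show ?thesis unfolding G_def by (rule PZ.borel_measurable_lebesgue_integral)
  qed
  have h_int: "integrable PZ (h x)" if "x \<in> space M" for x
  proof (rule PZ.integrable_const_bound[where B = 1])
    have "h x \<in> borel_measurable N"
      using measurable_compose[OF measurable_Pair1' h(1), of x] that D by (simp add: comp_def)
    then show "h x \<in> borel_measurable PZ" by measurable
  qed (use h in auto)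
  have G01: "0 \<le> G x" "G x \<le> 1" if "x \<in> space M" for x
  proof -
    show "0 \<le> G x" unfolding G_def using h(2) by simp
    have "G x \<le> (\<integral>z. 1 \<partial>PZ)" unfolding G_def using h(3) h_int[OF that] by (intro integral_mono) auto
    then show "G x \<le> 1" by (simp add: PZ.prob_space)
  qed
  define V where "V j x = h x (\<zeta> j x) - G x" for j x
  have hD: "(\<lambda>x. h x (\<zeta> j x)) \<in> borel_measurable M" if "j \<ge> 1" for j
  proof -
    note rv[OF that, measurable]
    have "(\<lambda>x. (x, \<zeta> j x)) \<in> M \<rightarrow>\<^sub>M D \<Otimes>\<^sub>M N" by measurable
    from measurable_compose[OF this h(1)] show ?thesis by simp
  qed
  have GM: "G \<in> borel_measurable M" using measurable_compose[OF idD G] by simp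
  have Vm: "V j \<in> borel_measurable M" if "j \<ge> 1" for j
    unfolding V_def using hD[OF that] GM by measurable
  have Vb: "\<bar>V j x\<bar> \<le> 1" if "x \<in> space M" for j x
    using G01[OF that] h(2,3)[of x "\<zeta> j x"] unfolding V_def by linarith
  have cov0: "expectation (\<lambda>x. V i x * V j x) = 0" if ij: "i \<ge> 1" "j \<ge> 1" "i \<noteq> j" for i j
  proof -
    note rv[OF ij(1), measurable] rv[OF ij(2), measurable]
    let ?P = "DM \<Otimes>\<^sub>M (PZ \<Otimes>\<^sub>M PZ)" and ?R = "D \<Otimes>\<^sub>M (N \<Otimes>\<^sub>M N)" and ?w = "\<lambda>x. (x, \<zeta> i x, \<zeta> j x)"
    let ?J = "distr M ?R ?w"
    define \<phi> where "\<phi> = (\<lambda>(x, z, z'). (h x z - G x) * (h x z' - G x))"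
    have h1: "(\<lambda>(x, z, z'). h x z) \<in> borel_measurable ?P"
      using measurable_compose[of "\<lambda>(x, z, z'). (x, z)" "?P" "D \<Otimes>\<^sub>M N", OF _ h(1)]
      by (simp add: case_prod_beta')
    have h2: "(\<lambda>(x, z, z'). h x z') \<in> borel_measurable ?P"
      using measurable_compose[of "\<lambda>(x, z, z'). (x, z')" "?P" "D \<Otimes>\<^sub>M N", OF _ h(1)]
      by (simp add: case_prod_beta')
    have \<phi> [measurable]: "\<phi> \<in> borel_measurable ?P"
      using h1 h2 unfolding \<phi>_def case_prod_beta' by measurable
    have ZZ: "distr M (N \<Otimes>\<^sub>M N) (\<lambda>x. (\<zeta> i x, \<zeta> j x)) = PZ \<Otimes>\<^sub>M PZ"
      using indep_vars_pair[OF indep, of i j] ij distr[of i] distr[of j]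
      by (simp add: indep_var_distribution_eq)
    \<comment> \<open>Independence of \<open>D\<close> from the \<open>\<zeta>\<close> yields the
      outer product, independence of \<open>\<zeta> i\<close> and \<open>\<zeta> j\<close> the inner
      one. It suffices to compare both measures on rectangles \<open>A \<times> B\<close>.\<close>
    have joint: "?J = ?P"
    proof (rule pair_measure_eqI[symmetric])
      show "sigma_finite_measure DM" "sigma_finite_measure (PZ \<Otimes>\<^sub>M PZ)" by unfold_locales
      show "sets ?P
          = sets ?J"
        by (simp, intro sets_pair_measure_cong) (simp_all add: sDM sPZ)
      define S where "S = sigma (space M) (generators M N \<zeta> {1..})"
      have genP: "generators M N \<zeta> {1..} \<subseteq> Pow (space M)" by (auto simp: generators_def)
      have sS: "sets S = sigma_sets (space M) (generators M N \<zeta> {1..})" "space S = space M"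
        using genP by (simp_all add: S_def)
      have \<zeta>S: "\<zeta> k \<in> S \<rightarrow>\<^sub>M N" if "k \<ge> 1" for k
      proof (rule measurableI)
        show "\<zeta> k x \<in> space N" if "x \<in> space S" for x
          using that measurable_space[OF rv[OF \<open>k \<ge> 1\<close>]] sS by auto
        show "\<zeta> k -` A \<inter> space S \<in> sets S" if "A \<in> sets N" for A
          unfolding sS by (rule sigma_sets.Basic) (use that \<open>k \<ge> 1\<close> in \<open>auto simp: generators_def\<close>)
      qed
      note \<zeta>S[OF ij(1), measurable] \<zeta>S[OF ij(2), measurable]
      have pairS: "(\<lambda>x. (\<zeta> i x, \<zeta> j x)) \<in> S \<rightarrow>\<^sub>M N \<Otimes>\<^sub>M N" by measurable
      have "{(\<lambda>x. (\<zeta> i x, \<zeta> j x)) -` A \<inter> space M | A. A \<in> sets (N \<Otimes>\<^sub>M N)} \<subseteq> sets S"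
        using measurable_sets[OF pairS] sS(2) by auto
      note pairS_sub = this
      fix A B assume A: "A \<in> sets DM" and B: "B \<in> sets (PZ \<Otimes>\<^sub>M PZ)"
      have B' [measurable]: "B \<in> sets (N \<Otimes>\<^sub>M N)"
        using B sets_pair_measure_cong[OF sPZ sPZ] by simp
      have A' [measurable]: "A \<in> sets D" using A by (simp add: sDM)
      let ?T = "(\<lambda>x. (\<zeta> i x, \<zeta> j x)) -` B \<inter> space M"
      have "emeasure ?J (A \<times> B)
          = emeasure M (?w -` (A \<times> B) \<inter> space M)"
        by (rule emeasure_distr) measurable
      also have "?w -` (A \<times> B) \<inter> space M = A \<inter> ?T" by auto
      also have "emeasure M (A \<inter> ?T) = emeasure M A * emeasure M ?T"
      proof -
        have "?T \<in> sigma_sets (space M) (generators M N \<zeta> {1..})"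
          using pairS_sub B' sS by blast
        then have "prob (A \<inter> ?T) = prob A * prob ?T"
          using indD A' unfolding indep_sets2_eq by blast
        then show ?thesis by (simp add: emeasure_eq_measure ennreal_mult)
      qed
      also have "emeasure M ?T = emeasure (PZ \<Otimes>\<^sub>M PZ) B"
        unfolding ZZ[symmetric] by (rule emeasure_distr[symmetric]) measurable
      also have "emeasure M A = emeasure DM A"
      proof -
        have "A \<subseteq> space M" using A' D(1) sets.sets_into_space by blast
        then show ?thesis unfolding DM_def by (subst emeasure_distr) (auto simp: Int_absorb2)
      qed
      finally show "emeasure DM A * emeasure (PZ \<Otimes>\<^sub>M PZ) B
        = emeasure ?J (A \<times> B)" by simp
    qed
    have "expectation (\<lambda>x. V i x * V j x) = expectation (\<lambda>x. \<phi> (x, \<zeta> i x, \<zeta> j x))"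
      by (simp add: \<phi>_def V_def)
    also have "\<dots> = (\<integral>y. \<phi> y \<partial>?J)"
    proof (rule integral_distr[symmetric])
      have "sets ?R = sets ?P"
        by (intro sets_pair_measure_cong) (simp_all add: sDM sPZ)
      then show "\<phi> \<in> borel_measurable ?R" using \<phi> measurable_cong_sets by blast
    qed measurable
    also have "\<dots> = (\<integral>y. \<phi> y \<partial>?P)" by (simp only: joint)
    also have "\<dots> = (\<integral>x. (\<integral>y. \<phi> (x, y) \<partial>(PZ \<Otimes>\<^sub>M PZ)) \<partial>DM)"
    proof (rule DPP.integral_fst'[symmetric])
      show "integrable ?P \<phi>"
      proof (rule DPP.integrable_const_bound[where B = 1])
        show "AE y in ?P. norm (\<phi> y) \<le> 1"
        proof (rule AE_I2)
          fix y assume "y \<in> space ?P"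
          then obtain x z z' where y: "y = (x, z, z')" "x \<in> space M"
            using D by (auto simp: space_pair_measure DM_def)
          have "\<bar>h x z - G x\<bar> \<le> 1" "\<bar>h x z' - G x\<bar> \<le> 1"
            using G01[OF y(2)] h(2,3)[of x z] h(2,3)[of x z'] by linarith+
          then show "norm (\<phi> y) \<le> 1" by (simp add: \<phi>_def y abs_mult mult_le_one)
        qed
      qed measurable
    qed
    \<comment> \<open>For fixed \<open>x\<close> the integral over the last variable is already
      zero, because \<open>G x\<close> is the mean of \<open>h x\<close>.\<close>
    also have "\<dots> = (\<integral>x. 0 \<partial>DM)"
    proof (rule Bochner_Integration.integral_cong[OF refl])
      fix x assume "x \<in> space DM"
      then have x: "x \<in> space M" using D by (simp add: DM_def)
      have f: "integrable PZ (\<lambda>z. h x z - G x)" using h_int[OF x] by simp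
      have f0: "(\<integral>z. h x z - G x \<partial>PZ) = 0" using h_int[OF x] by (simp add: G_def PZ.prob_space)
      have "(\<integral>y. \<phi> (x, y) \<partial>(PZ \<Otimes>\<^sub>M PZ)) = (\<integral>z. (\<integral>z'. \<phi> (x, z, z') \<partial>PZ) \<partial>PZ)"
      proof (rule PP.integral_fst'[symmetric])
        show "integrable (PZ \<Otimes>\<^sub>M PZ) (\<lambda>y. \<phi> (x, y))"
        proof (rule PP.integrable_const_bound[where B = 1])
          show "AE y in PZ \<Otimes>\<^sub>M PZ. norm (\<phi> (x, y)) \<le> 1"
          proof (rule AE_I2)
            fix y :: "'c \<times> 'c"
            obtain z z' where y: "y = (z, z')" by fastforce
            have "\<bar>h x z - G x\<bar> \<le> 1" "\<bar>h x z' - G x\<bar> \<le> 1"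
              using G01[OF x] h(2,3)[of x z] h(2,3)[of x z'] by linarith+
            then show "norm (\<phi> (x, y)) \<le> 1" by (simp add: \<phi>_def y abs_mult mult_le_one)
          qed
          show "(\<lambda>y. \<phi> (x, y)) \<in> borel_measurable (PZ \<Otimes>\<^sub>M PZ)"
            using \<phi> \<open>x \<in> space DM\<close> by measurable
        qed
      qed
      also have "\<dots> = 0" by (simp add: \<phi>_def f0)
      finally show "(\<integral>y. \<phi> (x, y) \<partial>(PZ \<Otimes>\<^sub>M PZ)) = 0" .
    qed
    finally show ?thesis by simp
  qed
  have "prob {x \<in> space M. \<bar>(\<Sum>j\<in>{1..n}. V j x) / card {1..n}\<bar> \<ge> \<eta>} \<le> 1 / (card {1..n} * \<eta>\<^sup>2)"
  proof (rule mean_deviation)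
    fix i assume i: "i \<in> {1..n}"
    have "(\<Sum>j\<in>{1..n}. expectation (\<lambda>x. V i x * V j x)) = (\<Sum>j\<in>{1..n}. if i = j then expectation (\<lambda>x. V i x * V i x) else 0)"
      using i by (intro sum.cong) (auto intro: cov0)
    also have "\<dots> = expectation (\<lambda>x. V i x * V i x)" using i by simp
    also have "\<dots> \<le> expectation (\<lambda>x. 1)"
    proof (rule integral_mono)
      show le: "V i x * V i x \<le> 1" if "x \<in> space M" for x
        using mult_le_one[OF Vb[OF that, of i] _ Vb[OF that, of i]] by simp
      show "integrable M (\<lambda>x. V i x * V i x)"
        using i Vm le by (intro integrable_const_bound[where B = 1]) auto
    qed simp
    finally show "(\<Sum>j\<in>{1..n}. expectation (\<lambda>x. V i x * V j x)) \<le> 1" by (simp add: prob_space)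
  qed (use n \<eta> Vm Vb in auto)
  moreover have "(\<Sum>j\<in>{1..n}. V j x) / card {1..n} = (\<Sum>j=1..n. h x (\<zeta> j x)) / n - G x" for x
    using n by (simp add: V_def sum_subtractf diff_divide_distrib)
  ultimately show ?dev by (simp only: G_def card_atLeastAtMost diff_Suc_1)
  have [measurable]: "(\<lambda>x. \<Sum>j=1..n. h x (\<zeta> j x)) \<in> borel_measurable M"
    by (intro borel_measurable_sum hD) simp
  show ?meas unfolding G_def[symmetric] using GM by measurable
qed

end

section \<open>Hoelder functions and growth rates\<close>

text \<open>The sum in the Hoelder norm bounds its terms only because its index set is finite; over
  an infinite set it would be 0 by convention.\<close>

lemma finite_multi_indices_degree: "finite {\<alpha> \<in> multi_indices r. real (degree_of r \<alpha>) < \<beta>}"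
proof -
  define b where "b = nat \<lceil>\<beta>\<rceil>"
  have "{\<alpha> \<in> multi_indices r. real (degree_of r \<alpha>) < \<beta>}
      \<subseteq> {f. \<forall>i. (i \<in> {..<r} \<longrightarrow> f i \<in> {..b}) \<and> (i \<notin> {..<r} \<longrightarrow> f i = 0)}"
  proof (intro subsetI CollectI allI conjI impI)
    fix \<alpha> i assume \<alpha>: "\<alpha> \<in> {\<alpha> \<in> multi_indices r. real (degree_of r \<alpha>) < \<beta>}"
    show "\<alpha> i \<in> {..b}" if "i \<in> {..<r}"
    proof -
      have "\<alpha> i \<le> degree_of r \<alpha>"
        unfolding degree_of_def using that by (intro member_le_sum) auto
      moreover have "real (degree_of r \<alpha>) < \<beta>" using \<alpha> by simp
      ultimately show ?thesis by (auto simp: b_def; linarith)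
    qed
    show "\<alpha> i = 0" if "i \<notin> {..<r}" using \<alpha> that by (auto simp: multi_indices_def)
  qed
  moreover have "finite {f. \<forall>i. (i \<in> {..<r} \<longrightarrow> f i \<in> {..b}) \<and> (i \<notin> {..<r} \<longrightarrow> f i = (0::nat))}"
    by (rule finite_set_of_finite_funs) auto
  ultimately show ?thesis by (rule finite_subset)
qed

text \<open>One coordinate is changed at a time. The intermediate points stay in the cube because it
  is a product.\<close>

lemma cube_lipschitz_coordinatewise:
  assumes step: "\<And>x i t. x \<in> cube r \<Longrightarrow> i < r \<Longrightarrow> t \<in> {0..1} \<Longrightarrow> \<bar>g (x(i := t)) - g x\<bar> \<le> K * \<bar>t - x i\<bar>"
    and x: "x \<in> cube r" and y: "y \<in> cube r"
  shows "\<bar>g x - g y\<bar> \<le> K * (\<Sum>i<r. \<bar>x i - y i\<bar>)"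
proof -
  define z where "z k = (\<lambda>i. if i < k then y i else x i)" for k :: nat
  have z0: "z 0 = x" by (simp add: z_def)
  have zr: "z r = y"
  proof
    fix i
    have "x i = y i" if "i \<ge> r" using x y that by (auto simp: cube_def PiE_iff extensional_def)
    then show "z r i = y i" by (simp add: z_def)
  qed
  have zc: "z k \<in> cube r" for k
    using x y by (auto simp: z_def cube_def PiE_iff extensional_def)
  have "\<bar>g x - g (z k)\<bar> \<le> K * (\<Sum>i<k. \<bar>x i - y i\<bar>)" if "k \<le> r" for k
    using that
  proof (induction k)
    case 0
    then show ?case by (simp add: z0)
  next
    case (Suc k)
    have zs: "z (Suc k) = (z k)(k := y k)" by (auto simp: z_def)
    have "y k \<in> {0..1}" using y Suc.prems by (auto simp: cube_def PiE_iff)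
    then have "\<bar>g (z (Suc k)) - g (z k)\<bar> \<le> K * \<bar>y k - z k k\<bar>"
      unfolding zs using Suc.prems by (intro step zc) auto
    then have "\<bar>g (z (Suc k)) - g (z k)\<bar> \<le> K * \<bar>x k - y k\<bar>" by (simp add: z_def abs_minus_commute)
    with Suc show ?case by (simp add: distrib_left)
  qed
  from this[of r] show ?thesis by (simp add: zr)
qed

text \<open>For \<open>\<beta> = 1\<close> the Hoelder quotient of the function itself is part of
  the norm, and the maximum distance is at most the l1 distance. For \<open>\<beta> > 1\<close>,
  integer or not, the first partial derivatives have order below \<open>\<beta>\<close>, hence are
  bounded by \<open>K\<close>, and the mean value inequality applies along coordinate lines.\<close>

lemma holder_class_lipschitz:
  assumes g: "g \<in> holder_class r (cube r) \<beta> K" and \<beta>: "\<beta> \<ge> 1" and K: "K > 0"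
    and x: "x \<in> cube r" and y: "y \<in> cube r"
  shows "\<bar>g x - g y\<bar> \<le> K * (\<Sum>i<r. \<bar>x i - y i\<bar>)"
proof -
  obtain D where D0: "\<And>x. x \<in> cube r \<Longrightarrow> D (\<lambda>_. 0) x = g x"
    and part: "\<And>\<alpha> i. \<alpha> \<in> multi_indices r \<Longrightarrow> i < r \<Longrightarrow> real (degree_of r \<alpha>) + 1 < \<beta> \<Longrightarrow>
        has_partial_on (cube r) i (D \<alpha>) (D (\<alpha>(i := Suc (\<alpha> i))))"
    and norm: "(\<Sum>\<alpha>\<in>{\<alpha>\<in>multi_indices r. real (degree_of r \<alpha>) < \<beta>}. SUP x\<in>cube r. ennreal \<bar>D \<alpha> x\<bar>)
     + (\<Sum>\<alpha>\<in>{\<alpha>\<in>multi_indices r. real (degree_of r \<alpha>) = \<beta> - 1}.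
          SUP (x, y)\<in>{(x, y). x \<in> cube r \<and> y \<in> cube r \<and> x \<noteq> y}.
            ennreal (\<bar>D \<alpha> x - D \<alpha> y\<bar> / linf_dist r x y)) \<le> ennreal K"
    using g unfolding holder_class_def by blast
  have fin: "finite {\<alpha> \<in> multi_indices r. real (degree_of r \<alpha>) < \<beta>}"
    by (rule finite_multi_indices_degree)
  have zero: "(\<lambda>_. 0) \<in> multi_indices r" "degree_of r (\<lambda>_. 0) = 0"
    by (auto simp: multi_indices_def degree_of_def)
  show ?thesis
  proof (cases "\<beta> = 1")
    case True
    have fin': "finite {\<alpha> \<in> multi_indices r. real (degree_of r \<alpha>) = \<beta> - 1}"
      by (rule finite_subset[OF _ fin]) auto
    show ?thesis
    proof (cases "x = y")
      case False
      define T where "T = (\<lambda>\<alpha>. SUP (x, y)\<in>{(x, y). x \<in> cube r \<and> y \<in> cube r \<and> x \<noteq> y}.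
            ennreal (\<bar>D \<alpha> x - D \<alpha> y\<bar> / linf_dist r x y))"
      have "ennreal (\<bar>D (\<lambda>_. 0) x - D (\<lambda>_. 0) y\<bar> / linf_dist r x y) \<le> T (\<lambda>_. 0)"
        unfolding T_def using x y False by (intro SUP_upper2[of "(x, y)"]) auto
      also have "\<dots> \<le> (\<Sum>\<alpha>\<in>{\<alpha>\<in>multi_indices r. real (degree_of r \<alpha>) = \<beta> - 1}. T \<alpha>)"
        using fin' zero True by (intro member_le_sum) auto
      also have "\<dots> \<le> ennreal K"
        unfolding T_def by (rule order_trans[OF add_increasing norm]) simp_all
      finally have le: "\<bar>g x - g y\<bar> / linf_dist r x y \<le> K"
        using K by (simp add: D0 x y)
      obtain k where k: "x k \<noteq> y k" using False by blast
      then have kr: "k < r" using x y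
        by (metis cube_def PiE_arb lessThan_iff)
      have fr: "finite ((\<lambda>i. \<bar>x i - y i\<bar>) ` {..<r})" by simp
      have pos: "0 < linf_dist r x y"
        unfolding linf_dist_def using k kr fr by (subst Max_gr_iff) auto
      have "linf_dist r x y \<le> (\<Sum>i<r. \<bar>x i - y i\<bar>)"
        unfolding linf_dist_def using kr fr
        by (subst Max_le_iff) (auto intro!: member_le_sum[of _ "{..<r}" "\<lambda>i. \<bar>x i - y i\<bar>"])
      then have "K * linf_dist r x y \<le> K * (\<Sum>i<r. \<bar>x i - y i\<bar>)" using K by (intro mult_left_mono) auto
      with le pos show ?thesis by (simp add: pos_divide_le_eq)
    qed simp
  next
    case False
    with \<beta> have \<beta>1: "\<beta> > 1" by simp
    show ?thesis
    proof (rule cube_lipschitz_coordinatewise[OF _ x y])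
      fix x i t assume x: "x \<in> cube r" and i: "i < r" and t: "t \<in> {0..1::real}"
      define e where "e = (\<lambda>_. 0 :: nat)(i := Suc 0)"
      have e: "e \<in> multi_indices r" "degree_of r e = 1"
        using i by (auto simp: e_def multi_indices_def degree_of_def)
      have upd: "x(i := s) \<in> cube r \<longleftrightarrow> s \<in> {0..1}" for s
        using x i by (auto simp: cube_def PiE_iff extensional_def)
      have P: "has_partial_on (cube r) i (D (\<lambda>_. 0)) (D e)"
        using part[OF zero(1) i] zero(2) \<beta>1 unfolding e_def by simp
      have bound: "\<bar>D e w\<bar> \<le> K" if "w \<in> cube r" for w
      proof -
        define T where "T = (\<lambda>\<alpha>. SUP x\<in>cube r. ennreal \<bar>D \<alpha> x\<bar>)"
        have "ennreal \<bar>D e w\<bar> \<le> T e" unfolding T_def by (rule SUP_upper[OF that])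
        also have "\<dots> \<le> (\<Sum>\<alpha>\<in>{\<alpha>\<in>multi_indices r. real (degree_of r \<alpha>) < \<beta>}. T \<alpha>)"
          using fin e \<beta>1 by (intro member_le_sum) auto
        also have "\<dots> \<le> ennreal K"
          unfolding T_def by (rule order_trans[OF add_increasing2 norm]) simp_all
        finally show ?thesis using K by simp
      qed
      have "norm (D (\<lambda>_. 0) (x(i := t)) - D (\<lambda>_. 0) (x(i := x i))) \<le> K * norm (t - x i)"
      proof (rule field_differentiable_bound[where S = "{0..1}" and f = "\<lambda>s. D (\<lambda>_. 0) (x(i := s))"
            and f' = "\<lambda>s. D e (x(i := s))"])
        show "((\<lambda>s. D (\<lambda>_. 0) (x(i := s))) has_field_derivative D e (x(i := s))) (at s within {0..1})"
          if "s \<in> {0..1}" for s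
        proof -
          have "((\<lambda>t. D (\<lambda>_. 0) ((x(i := s))(i := t))) has_real_derivative D e (x(i := s)))
              (at ((x(i := s)) i) within {t. (x(i := s))(i := t) \<in> cube r})"
            using P that upd unfolding has_partial_on_def by blast
          moreover have "{t. (x(i := s))(i := t) \<in> cube r} = {0..1}"
            unfolding fun_upd_upd upd by (rule Collect_mem_eq)
          ultimately show ?thesis by (simp only: fun_upd_upd fun_upd_same)
        qed
        show "norm (D e (x(i := s))) \<le> K" if "s \<in> {0..1}" for s
          using bound upd that by simp
        show "x i \<in> {0..1}" using x i by (auto simp: cube_def PiE_iff)
      qed (use t in auto)
      then show "\<bar>g (x(i := t)) - g x\<bar> \<le> K * \<bar>t - x i\<bar>"
        using D0 x upd t by simp
    qed
  qed
qed

lemma eventually_widths_ge: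
  fixes L :: "nat \<Rightarrow> nat" and p :: "nat \<Rightarrow> nat \<Rightarrow> nat"
  assumes "(\<lambda>n. real (Min (p n ` {1..L n}))) \<in> \<Omega>(w)" "filterlim w at_top at_top"
  shows "eventually (\<lambda>n. \<forall>l\<in>{1..L n}. S \<le> p n l) at_top"
proof -
  obtain c where c: "c > 0" "eventually (\<lambda>n. norm (real (Min (p n ` {1..L n}))) \<ge> c * norm (w n)) at_top"
    using assms(1) by (auto elim: landau_omega.bigE)
  have "eventually (\<lambda>n. w n \<ge> max 0 (real S / c)) at_top"
    using assms(2) unfolding filterlim_at_top by blast
  with c(2) show ?thesis
  proof eventually_elim
    case (elim n)
    have "c * (real S / c) \<le> c * w n"
      using elim(2) c(1) by (intro mult_left_mono) auto
    moreover have "norm (w n) = w n" using elim(2) by simp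
    ultimately have "real S \<le> real (Min (p n ` {1..L n}))" using elim(1) c(1) by simp
    then have "S \<le> Min (p n ` {1..L n})" by simp
    then show ?case by (meson Min_le finite_atLeastAtMost finite_imageI imageI order_trans)
  qed
qed

text \<open>With \<open>\<E>\<close> fixed the depth is of order \<open>ln n\<close>, while
  \<open>s\<close> is at least of order \<open>ln n\<close> times a factor \<open>w\<close> tending
  to infinity; so \<open>s\<close> eventually exceeds any constant multiple of the depth.\<close>

lemma eventually_sparsity_ge:
  fixes L :: "nat \<Rightarrow> nat" and s w :: "nat \<Rightarrow> real"
  assumes L: "(\<lambda>n. real (L n)) \<in> O(\<lambda>n. ln (real (n * \<E>)))" and \<E>: "\<E> \<ge> 1"
    and s: "s \<in> \<Omega>(\<lambda>n. ln (real n) * w n)" "\<And>n. n \<ge> 1 \<Longrightarrow> s n > 0" and w: "filterlim w at_top at_top"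
  shows "eventually (\<lambda>n. A * real (Suc (L n)) \<le> s n) at_top"
proof -
  obtain c where c: "c > 0" "eventually (\<lambda>n. norm (s n) \<ge> c * norm (ln (real n) * w n)) at_top"
    using s(1) by (auto elim: landau_omega.bigE)
  obtain C where C: "C > 0" "eventually (\<lambda>n. norm (real (L n)) \<le> C * norm (ln (real (n * \<E>)))) at_top"
    using L by (auto elim: landau_o.bigE)
  \<comment> \<open>\<open>2 * C + 1\<close> bounds \<open>Suc (L n)\<close> in units of
    \<open>ln n\<close>; its summand 1 pays for the \<open>Suc\<close>.\<close>
  have "eventually (\<lambda>n. w n \<ge> max 0 (\<bar>A\<bar> * (2 * C + 1) / c)) at_top"
    using w unfolding filterlim_at_top by blast
  \<comment> \<open>\<open>n \<ge> 3\<close> ensures \<open>ln n \<ge> 1\<close>, and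
    \<open>n \<ge> \<E>\<close> ensures \<open>ln (n * \<E>) \<le> 2 * ln n\<close>.\<close>
  moreover have "eventually (\<lambda>n::nat. n \<ge> max 3 \<E>) at_top" by (rule eventually_ge_at_top)
  ultimately show ?thesis using c(2) C(2)
  proof eventually_elim
    case (elim n)
    have "exp 1 \<le> real n" using elim(2) exp_le by (simp add: order_trans[OF exp_le])
    then have ln1: "1 \<le> ln (real n)" using elim(2) by (simp add: ln_ge_iff)
    have "ln (real (n * \<E>)) = ln (real n) + ln (real \<E>)"
      using elim(2) \<E> by (simp add: ln_mult)
    moreover have "ln (real \<E>) \<le> ln (real n)" using elim(2) \<E> by (subst ln_le_cancel_iff) auto
    moreover have "0 \<le> ln (real \<E>)" using \<E> by simp
    ultimately have lnE: "\<bar>ln (real (n * \<E>))\<bar> \<le> 2 * ln (real n)" using ln1 by linarith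
    have "real (L n) \<le> C * (2 * ln (real n))"
      using elim(4) mult_left_mono[OF lnE, of C] C(1) unfolding real_norm_def abs_of_nat by linarith
    then have L': "real (Suc (L n)) \<le> (2 * C + 1) * ln (real n)" using ln1 by (simp add: algebra_simps)
    have "A * real (Suc (L n)) \<le> \<bar>A\<bar> * ((2 * C + 1) * ln (real n))"
      using L' by (intro mult_mono) auto
    also have "\<dots> = c * (ln (real n) * (\<bar>A\<bar> * (2 * C + 1) / c))" using c(1) by simp
    also have "\<dots> \<le> c * (ln (real n) * w n)"
      using elim(1) ln1 c(1) by (intro mult_left_mono) auto
    also have "\<dots> \<le> s n"
      using elim(3) elim(1) ln1 s(2)[of n] elim(2) by (simp add: abs_mult)
    finally show ?case .
  qed
qed

lemma rate_mult: "n \<ge> 1 \<Longrightarrow> \<beta> > 0 \<Longrightarrow> k \<ge> 0 \<Longrightarrow> real n * rate \<beta> k n = real n powr (k / (2 * \<beta> + k))"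
proof -
  assume n: "n \<ge> 1" and b: "\<beta> > 0" "k \<ge> 0"
  have "real n * rate \<beta> k n = real n powr 1 * real n powr (- (2 * \<beta> / (2 * \<beta> + k)))"
    using n by (simp add: rate_def)
  also have "\<dots> = real n powr (1 - 2 * \<beta> / (2 * \<beta> + k))"
    unfolding powr_add[symmetric] by simp
  also have "1 - 2 * \<beta> / (2 * \<beta> + k) = k / (2 * \<beta> + k)" using b by (simp add: field_simps)
  finally show ?thesis .
qed

lemma filterlim_rate_mult:
  assumes "\<beta> > 0" "k > 0" "\<E> \<ge> 1"
  shows "filterlim (\<lambda>n. real (n * \<E>) * rate \<beta> k (n * \<E>)) at_top at_top"
proof -
  define a where "a = k / (2 * \<beta> + k)"
  have a: "a > 0" using assms by (simp add: a_def)
  have "filterlim (\<lambda>n. real n powr a) at_top at_top" using a by real_asymp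
  moreover have "eventually (\<lambda>n. real n powr a \<le> real (n * \<E>) * rate \<beta> k (n * \<E>)) at_top"
    using eventually_ge_at_top[of 1]
  proof eventually_elim
    case (elim n)
    have "real n \<le> real (n * \<E>)" using assms(3) by (intro of_nat_mono) simp
    then have "real n powr a \<le> real (n * \<E>) powr a"
      using a by (intro powr_mono2) auto
    also have "\<dots> = real (n * \<E>) * rate \<beta> k (n * \<E>)"
      unfolding a_def using assms elim by (subst rate_mult) auto
    finally show ?case .
  qed
  ultimately show ?thesis by (rule filterlim_at_top_mono)
qed

lemma filterlim_log_depth:
  fixes L :: "nat \<Rightarrow> nat"
  assumes "\<And>n. n \<ge> 1 \<Longrightarrow> real (L n) \<ge> log 2 (real n)"
  shows "filterlim L at_top at_top"
proof -
  have "filterlim (\<lambda>n. log 2 (real n)) at_top at_top" by real_asymp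
  then have "filterlim (\<lambda>n. real (L n)) at_top at_top"
    by (rule filterlim_at_top_mono) (use assms in \<open>auto simp: eventually_sequentially intro!: exI[of _ 1]\<close>)
  then show ?thesis
    unfolding filterlim_at_top
  proof (intro allI)
    fix Z assume "\<forall>Z. eventually (\<lambda>n. Z \<le> real (L n)) at_top"
    from this[rule_format, of "real Z"] show "eventually (\<lambda>n. Z \<le> L n) at_top" by simp
  qed
qed

text \<open>The logarithm of the covering number is \<open>O(u\<^sup>a (ln u)\<^sup>3)\<close> with \<open>a < 1\<close> and \<open>u = n \<E>\<close>.\<close>

lemma eventually_entropy_le:
  fixes L :: "nat \<Rightarrow> nat" and s :: "nat \<Rightarrow> real"
  assumes L: "(\<lambda>n. real (L n)) \<in> O(\<lambda>n. ln (real (n * \<E>)))" and \<E>: "\<E> \<ge> 1"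
    and s: "s \<in> O(\<lambda>n. real (n * \<E>) powr a * ln (real (n * \<E>)))"
    and a: "0 < a" "a < 1" and \<epsilon>: "\<epsilon> > 0" and c: "c > 0"
  shows "eventually (\<lambda>n. \<exists>Q>0. cover_radius r (nat \<lfloor>s n\<rfloor>) (L n) Q \<le> \<epsilon> \<and>
     real (cover_size r (nat \<lfloor>s n\<rfloor>) (L n) Q) \<le> exp (c * real (n * \<E>))) at_top"
proof -
  obtain C1 where C1: "C1 > 0" "eventually (\<lambda>n. norm (s n) \<le> C1 * norm (real (n * \<E>) powr a * ln (real (n * \<E>)))) at_top"
    using s by (auto elim: landau_o.bigE)
  obtain C2 where C2: "C2 > 0" "eventually (\<lambda>n. norm (real (L n)) \<le> C2 * norm (ln (real (n * \<E>)))) at_top"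
    using L by (auto elim: landau_o.bigE)
  have lim: "filterlim (\<lambda>n. real (n * \<E>)) at_top at_top"
  proof (rule filterlim_at_top_mono[OF filterlim_real_sequentially])
    show "eventually (\<lambda>n. real n \<le> real (n * \<E>)) at_top" using \<E> by (intro always_eventually allI of_nat_mono) simp
  qed
  have ev1: "eventually (\<lambda>u. C1 * (u powr a * ln u) + real r + 1 \<le> u / 5) at_top"
    using a C1(1) by real_asymp
  have ev2: "eventually (\<lambda>u. C2 * ln u + 1 \<le> u) at_top" using C2(1) by real_asymp
  have ev3: "eventually (\<lambda>u. 2 / \<epsilon> + 5 \<le> u) at_top" by real_asymp
  have ev4: "eventually (\<lambda>u. 2 * (C1 * (u powr a * ln u)) * ((C2 * ln u + 5) * ln u) \<le> c * u) at_top"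
    using a C1(1) C2(1) c by real_asymp
  have ev5: "eventually (\<lambda>u::real. u \<ge> 3) at_top" by (rule eventually_ge_at_top)
  note evs = this[THEN eventually_compose_filterlim, OF lim]
    ev1[THEN eventually_compose_filterlim, OF lim] ev2[THEN eventually_compose_filterlim, OF lim]
    ev3[THEN eventually_compose_filterlim, OF lim] ev4[THEN eventually_compose_filterlim, OF lim]
  from evs C1(2) C2(2) show ?thesis
  proof eventually_elim
    case (elim n)
    define u where "u = real (n * \<E>)"
    define m where "m = nat \<lfloor>s n\<rfloor>"
    define q where "q = m + r + 1"
    \<comment> \<open>Large enough for radius \<open>\<epsilon>\<close>, yet at most
      \<open>u ^ Suc (L n) / \<epsilon> + 2\<close>, so that its logarithm is only of the order of
      depth times \<open>ln u\<close>.\<close>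
    define Q where "Q = nat \<lceil>(5 * real q) ^ Suc (L n) / \<epsilon>\<rceil> + 1"
    note E = elim[folded u_def]
    have ln0: "ln u \<ge> 0" using E(1) by simp
    have m: "real m \<le> C1 * (u powr a * ln u)"
    proof -
      have "0 \<le> C1 * (u powr a * ln u)" using ln0 C1(1) by simp
      moreover have "s n \<le> C1 * (u powr a * ln u)" using E(6) ln0 by (simp add: abs_mult)
      ultimately show ?thesis unfolding m_def by linarith
    qed
    have Ln: "real (L n) \<le> C2 * ln u" using E(7) ln0 by simp
    have q: "5 * real q \<le> u" using m E(2) by (simp add: q_def)
    have q1: "real q \<ge> 1" by (simp add: q_def)
    have "(5 * real q) ^ Suc (L n) / \<epsilon> \<le> real Q" unfolding Q_def by linarith
    moreover have Q0: "Q > 0" by (simp add: Q_def)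
    ultimately have first: "(5 * real q) ^ Suc (L n) / real Q \<le> \<epsilon>"
      using \<epsilon> by (simp add: field_simps)
    have "(5 * real q) ^ Suc (L n) \<le> u ^ Suc (L n)" using q by (intro power_mono) auto
    then have "(5 * real q) ^ Suc (L n) / \<epsilon> \<le> u ^ Suc (L n) / \<epsilon>" using \<epsilon> by (intro divide_right_mono) auto
    moreover have "0 \<le> (5 * real q) ^ Suc (L n) / \<epsilon>" using \<epsilon> by simp
    ultimately have "real Q \<le> u ^ Suc (L n) / \<epsilon> + 2" unfolding Q_def by linarith
    then have "real (2 * Q + 1) \<le> 2 * (u ^ Suc (L n) / \<epsilon>) + 5" by simp
    also have "\<dots> \<le> (2 / \<epsilon>) * u ^ Suc (L n) + 5 * u ^ Suc (L n)"
      using one_le_power[of u "Suc (L n)"] E(1) by simp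
    also have "\<dots> = (2 / \<epsilon> + 5) * u ^ Suc (L n)" by (simp only: distrib_right)
    also have "\<dots> \<le> u * u ^ Suc (L n)" using E(1,4) by (intro mult_right_mono) auto
    finally have Q: "real (2 * Q + 1) \<le> u ^ (L n + 2)" by simp
    have "real (Suc (L n) * q * q * (2 * Q + 1)) = real (Suc (L n)) * real q * real q * real (2 * Q + 1)"
      by (simp only: of_nat_mult)
    \<comment> \<open>One factor \<open>u\<close> for the layer, two for row and column, and
      \<open>u ^ (L n + 2)\<close> for the grid value.\<close>
    also have "\<dots> \<le> u * u * u * u ^ (L n + 2)"
    proof (intro mult_mono Q)
      show "real (Suc (L n)) \<le> u" using Ln E(3) by simp
      show "real q \<le> u" "real q \<le> u" using q q1 by auto
    qed (use E(1) in auto)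
    also have "\<dots> = u ^ (L n + 5)" by (simp add: power_add eval_nat_numeral)
    finally have base: "real (Suc (L n) * q * q * (2 * Q + 1)) \<le> u ^ (L n + 5)" .
    have "real ((Suc (L n) * q * q * (2 * Q + 1)) ^ (2 * m)) \<le> (u ^ (L n + 5)) ^ (2 * m)"
      unfolding of_nat_power by (intro power_mono base) simp
    also have "\<dots> = exp (2 * real m * (real (L n + 5) * ln u))"
    proof -
      have "u = exp (ln u)" using E(1) by simp
      then have "(u ^ (L n + 5)) ^ (2 * m) = (exp (ln u)) ^ ((L n + 5) * (2 * m))" by (simp add: power_mult)
      also have "\<dots> = exp (real ((L n + 5) * (2 * m)) * ln u)" by (rule exp_of_nat_mult[symmetric])
      also have "real ((L n + 5) * (2 * m)) * ln u = 2 * real m * (real (L n + 5) * ln u)"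
        by (simp only: of_nat_mult of_nat_numeral mult_ac)
      finally show ?thesis .
    qed
    also have "\<dots> \<le> exp (2 * (C1 * (u powr a * ln u)) * ((C2 * ln u + 5) * ln u))"
    proof -
      have "2 * real m * (real (L n + 5) * ln u) \<le> 2 * (C1 * (u powr a * ln u)) * ((C2 * ln u + 5) * ln u)"
        using m Ln ln0 C1(1) by (intro mult_mono) auto
      then show ?thesis by simp
    qed
    also have "\<dots> \<le> exp (c * u)" using E(5) by simp
    finally show ?case
      using first Q0 unfolding cover_radius_def cover_size_def u_def[symmetric] m_def[symmetric] q_def[symmetric] by blast
  qed
qed

text \<open>\<open>A\<close> does not depend on \<open>n\<close>: the inner limit removes
  \<open>A / N\<close> for each large \<open>n\<close> separately, and only \<open>b n\<close>
  reaches the outer one.\<close>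

lemma limsup_limsup_eq_0:
  fixes p :: "nat \<Rightarrow> nat \<Rightarrow> real"
  assumes p: "\<And>n N. p n N \<ge> 0" and b: "b \<longlonglongrightarrow> 0"
    and le: "eventually (\<lambda>n. \<forall>N\<ge>1. p n N \<le> b n + A / real N) at_top"
  shows "limsup (\<lambda>n. limsup (\<lambda>N. ereal (p n N))) = 0"
proof (rule antisym)
  have lim: "limsup (\<lambda>N. ereal (p n N)) \<le> ereal (b n)" if "\<forall>N\<ge>1. p n N \<le> b n + A / real N" for n
  proof -
    have "(\<lambda>N. b n + A / real N) \<longlonglongrightarrow> b n + 0"
      by (intro tendsto_intros lim_const_over_n)
    then have "(\<lambda>N. ereal (b n + A / real N)) \<longlonglongrightarrow> ereal (b n)" by simp
    then have "limsup (\<lambda>N. ereal (b n + A / real N)) = ereal (b n)"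
      by (intro lim_imp_Limsup) auto
    moreover have "limsup (\<lambda>N. ereal (p n N)) \<le> limsup (\<lambda>N. ereal (b n + A / real N))"
      using that by (intro Limsup_mono) (auto simp: eventually_sequentially intro!: exI[of _ 1])
    ultimately show ?thesis by simp
  qed
  have "limsup (\<lambda>n. limsup (\<lambda>N. ereal (p n N))) \<le> limsup (\<lambda>n. ereal (b n))"
    using le by (intro Limsup_mono) (auto elim!: eventually_mono intro: lim)
  also have "\<dots> = 0" using b by (intro lim_imp_Limsup) (auto simp: zero_ereal_def)
  finally show "limsup (\<lambda>n. limsup (\<lambda>N. ereal (p n N))) \<le> 0" .
  have "0 \<le> limsup (\<lambda>N. ereal (p n N))" for n
    using p by (intro le_Limsup) auto
  then show "0 \<le> limsup (\<lambda>n. limsup (\<lambda>N. ereal (p n N)))"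
    by (intro le_Limsup) auto
qed

section \<open>Consistency of the minimiser\<close>

text \<open>The objective applies critics to the vector \<open>g z\<close>, while their Lipschitz
  condition concerns arguments \<open>vec1 y\<close>. Outputs of networks are extensional, so the
  two forms agree.\<close>

lemma network_output_vec1:
  assumes "h \<in> networks L p s F" "p (Suc L) = 1"
  shows "h x = vec1 (h x 0)"
  using assms unfolding networks_def vec1_def by (auto simp: fun_eq_iff)

lemma network_measurable:
  assumes "h \<in> networks L p s F" "p 0 = r" "p (Suc L) = 1"
  shows "(\<lambda>x. h x 0) \<in> borel_measurable (Rvec r)"
proof -
  obtain W v where "h = (\<lambda>x. \<lambda>i\<in>{..<p (Suc L)}. net_eval p W v L x i)"
    using assms(1) by (auto simp: networks_def)
  then show ?thesis using net_eval_measurable[where p = p and r = r and W = W and v = v and l = L and i = 0, OF assms(2)] assms(3) by simp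
qed

lemma ramp_critic:
  assumes h: "h \<in> C" "\<And>x. h x 0 = \<sigma> * ramp m k (x 0)" and \<sigma>: "\<bar>\<sigma>\<bar> \<le> 1" and m: "m > 0"
  shows "h \<in> lip1_critics C"
proof -
  have "dist (h (vec1 x) 0) (h (vec1 y) 0) \<le> 1 * dist x y" for x y
  proof -
    have "\<bar>\<sigma> * ramp m k x - \<sigma> * ramp m k y\<bar> = \<bar>\<sigma>\<bar> * \<bar>ramp m k x - ramp m k y\<bar>"
      by (simp flip: abs_mult right_diff_distrib)
    also have "\<dots> \<le> 1 * \<bar>x - y\<bar>" using \<sigma> ramp_lipschitz[OF m] by (intro mult_mono) auto
    finally show ?thesis by (simp add: h(2) vec1_def dist_real_def)
  qed
  with h(1) show ?thesis by (auto simp: lip1_critics_def intro!: lipschitz_onI)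
qed

lemma empirical_objective_eq:
  fixes f :: "real \<Rightarrow> real" and x :: "nat \<Rightarrow> real" and w :: "nat \<Rightarrow> nat \<Rightarrow> real"
  assumes "n \<ge> 1" "\<E> \<ge> 1"
  shows "(1 / real n) * (\<Sum>i=1..n. f (x i) - (1 / real \<E>) * (\<Sum>j=1..\<E>. f (w i j)))
    = (\<Sum>i\<in>{1..n}. f (x i)) / card {1..n}
      - (\<Sum>(i, j)\<in>{1..n} \<times> {1..\<E>}. f (w i j)) / card ({1..n} \<times> {1..\<E>})"
proof -
  have "(\<Sum>(i, j)\<in>{1..n} \<times> {1..\<E>}. f (w i j)) = (\<Sum>i=1..n. \<Sum>j=1..\<E>. f (w i j))"
    by (simp add: sum.cartesian_product)
  then show ?thesis using assms
    by (simp add: sum_subtractf sum_distrib_left[symmetric] card_cartesian_product right_diff_distrib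
        sum_divide_distrib[symmetric] field_simps)
qed

text \<open>
  Comparing the minimiser with a network close to the true generator bounds every critic at the
  minimiser; since the ramps and their negatives are critics, this is two-sided for ramps.
\<close>

lemma minimiser_ramp_deviation:
  fixes x :: "nat \<Rightarrow> real" and z :: "nat \<Rightarrow> nat \<Rightarrow> nat \<Rightarrow> real"
  assumes n: "n \<ge> 1" and \<E>: "\<E> \<ge> 1"
    and out: "\<And>h y. h \<in> G \<Longrightarrow> h y = vec1 (h y 0)"
    and min: "is_arg_min (empirical_W1 C \<E> n x z) (\<lambda>g. g \<in> G) gh"
    and g0: "g0 \<in> G" and z: "\<And>i j. i \<in> {1..n} \<Longrightarrow> j \<in> {1..\<E>} \<Longrightarrow> z i j \<in> T"
    and approx: "\<And>y. y \<in> T \<Longrightarrow> \<bar>g0 y 0 - gs y\<bar> \<le> \<epsilon>"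
    and critic: "\<And>\<sigma>. \<sigma> \<in> {1, -1} \<Longrightarrow> \<exists>h\<in>lip1_critics C. \<forall>y. h (vec1 y) 0 = \<sigma> * ramp m k y"
    and mean: "\<And>f. 1-lipschitz_on UNIV f \<Longrightarrow> \<bar>(\<Sum>i\<in>{1..n}. f (x i)) / card {1..n} - \<mu> f\<bar> \<le> \<delta>"
      "\<And>f. 1-lipschitz_on UNIV f \<Longrightarrow>
        \<bar>(\<Sum>(i, j)\<in>{1..n} \<times> {1..\<E>}. f (gs (z i j))) / card ({1..n} \<times> {1..\<E>}) - \<mu> f\<bar> \<le> \<delta>"
  shows "\<bar>(\<Sum>i\<in>{1..n}. ramp m k (x i)) / card {1..n}
     - (\<Sum>(i, j)\<in>{1..n} \<times> {1..\<E>}. ramp m k (gh (z i j) 0)) / card ({1..n} \<times> {1..\<E>})\<bar> \<le> 2 * \<delta> + \<epsilon>"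
proof -
  define I where "I = {1..n} \<times> {1..\<E>}"
  define J where "J g f = (\<Sum>i\<in>{1..n}. f (vec1 (x i)) 0) / card {1..n}
      - (\<Sum>(i, j)\<in>I. f (vec1 (g (z i j) 0)) 0) / card I"
    for g :: "(nat \<Rightarrow> real) \<Rightarrow> nat \<Rightarrow> real" and f :: "(nat \<Rightarrow> real) \<Rightarrow> nat \<Rightarrow> real"
  have cI: "real (card I) > 0" using n \<E> by (simp add: I_def card_cartesian_product)
  have W: "empirical_W1 C \<E> n x z g = (SUP f\<in>lip1_critics C. J g f)" if "g \<in> G" for g
  proof -
    have "(1 / real n) * (\<Sum>i=1..n. f (vec1 (x i)) 0 - (1 / real \<E>) * (\<Sum>j=1..\<E>. f (g (z i j)) 0)) = J g f" for f
    proof -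
      have "f (g (z i j)) 0 = f (vec1 (g (z i j) 0)) 0" for i j using out[OF that] by metis
      then show ?thesis
        using empirical_objective_eq[OF n \<E>, of "\<lambda>y. f (vec1 y) 0" x "\<lambda>i j. g (z i j) 0"]
        unfolding J_def I_def by simp
    qed
    then show ?thesis unfolding empirical_W1_def by simp
  qed
  have lip: "1-lipschitz_on UNIV (\<lambda>y. f (vec1 y) 0)" if "f \<in> lip1_critics C" for f
    using that by (simp add: lip1_critics_def)
  have lipD: "f (vec1 a) 0 - f (vec1 b) 0 \<le> \<bar>a - b\<bar>" if "f \<in> lip1_critics C" for f a b
    using lipschitz_onD[OF lip[OF that], of a b] by (simp add: dist_real_def)
  have ne: "lip1_critics C \<noteq> {}" using critic[of 1] by auto
  have gh: "gh \<in> G" using min by (simp add: is_arg_min_def)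
  \<comment> \<open>Critics have no common bound at generator outputs outside the unit interval.
    Subtracting the value at 0 from both averages leaves their difference unchanged, after which the
    Lipschitz condition gives a bound independent of \<open>f\<close>.\<close>
  have bdd: "bdd_above (J g ` lip1_critics C)" for g
  proof (rule bdd_aboveI2)
    fix f assume f: "f \<in> lip1_critics C"
    have "J g f = (\<Sum>i\<in>{1..n}. f (vec1 (x i)) 0 - f (vec1 0) 0) / card {1..n}
        - (\<Sum>(i, j)\<in>I. f (vec1 (g (z i j) 0)) 0 - f (vec1 0) 0) / card I"
      using n cI unfolding J_def by (simp add: sum_subtractf case_prod_beta' diff_divide_distrib)
    also have "\<dots> = (\<Sum>i\<in>{1..n}. f (vec1 (x i)) 0 - f (vec1 0) 0) / card {1..n}
        + (\<Sum>(i, j)\<in>I. f (vec1 0) 0 - f (vec1 (g (z i j) 0)) 0) / card I"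
      by (simp add: sum_subtractf case_prod_beta' diff_divide_distrib)
    also have "\<dots> \<le> (\<Sum>i\<in>{1..n}. \<bar>x i\<bar>) / card {1..n} + (\<Sum>(i, j)\<in>I. \<bar>g (z i j) 0\<bar>) / card I"
      using lipD[OF f, of _ 0] lipD[OF f, of 0]
      by (intro add_mono divide_right_mono sum_mono) (auto split: prod.split)
    finally show "J g f \<le> (\<Sum>i\<in>{1..n}. \<bar>x i\<bar>) / card {1..n} + (\<Sum>(i, j)\<in>I. \<bar>g (z i j) 0\<bar>) / card I" .
  qed
  \<comment> \<open>One \<open>\<delta>\<close> for each of the two averages and
    \<open>\<epsilon>\<close> for replacing \<open>gs\<close> by the network
    \<open>g0\<close>.\<close>
  have "empirical_W1 C \<E> n x z g0 \<le> 2 * \<delta> + \<epsilon>"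
    unfolding W[OF g0]
  proof (rule cSUP_least[OF ne])
    fix f assume f: "f \<in> lip1_critics C"
    let ?u = "\<lambda>i j. f (vec1 (gs (z i j))) 0" and ?v = "\<lambda>i j. f (vec1 (g0 (z i j) 0)) 0"
    have "\<bar>(\<Sum>(i, j)\<in>I. ?u i j) - (\<Sum>(i, j)\<in>I. ?v i j)\<bar>
        \<le> (\<Sum>(i, j)\<in>I. \<bar>?u i j - ?v i j\<bar>)"
      unfolding sum_subtractf[symmetric] case_prod_beta' by (rule sum_abs)
    also have "\<dots> \<le> (\<Sum>p\<in>I. \<epsilon>)"
    proof (intro sum_mono)
      fix p assume "p \<in> I"
      then obtain i j where p: "p = (i, j)" "i \<in> {1..n}" "j \<in> {1..\<E>}" by (auto simp: I_def)
      have "\<bar>?u i j - ?v i j\<bar> \<le> \<bar>g0 (z i j) 0 - gs (z i j)\<bar>"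
        using lipD[OF f, of "gs (z i j)" "g0 (z i j) 0"] lipD[OF f, of "g0 (z i j) 0" "gs (z i j)"] by linarith
      also have "\<dots> \<le> \<epsilon>" by (intro approx z p)
      finally show "(case p of (i, j) \<Rightarrow> \<bar>?u i j - ?v i j\<bar>) \<le> \<epsilon>"
        by (simp add: p(1))
    qed
    finally have "\<bar>(\<Sum>(i, j)\<in>I. ?u i j) - (\<Sum>(i, j)\<in>I. ?v i j)\<bar> / card I \<le> \<epsilon>"
      using cI by (simp add: field_simps)
    then have "\<bar>(\<Sum>(i, j)\<in>I. ?u i j) / card I - (\<Sum>(i, j)\<in>I. ?v i j) / card I\<bar> \<le> \<epsilon>"
      using cI by (simp add: abs_divide flip: diff_divide_distrib)
    with mean[OF lip[OF f]] show "J g0 f \<le> 2 * \<delta> + \<epsilon>"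
      unfolding J_def I_def[symmetric] by linarith
  qed
  moreover have "empirical_W1 C \<E> n x z gh \<le> empirical_W1 C \<E> n x z g0"
    using min g0 by (auto simp: is_arg_min_def not_less)
  ultimately have J: "J gh f \<le> 2 * \<delta> + \<epsilon>" if "f \<in> lip1_critics C" for f
    using cSUP_upper[OF that bdd[of gh]] W[OF gh] by linarith
  obtain h1 where h1: "h1 \<in> lip1_critics C" "\<And>y. h1 (vec1 y) 0 = 1 * ramp m k y" using critic[of 1] by auto
  obtain h2 where h2: "h2 \<in> lip1_critics C" "\<And>y. h2 (vec1 y) 0 = - 1 * ramp m k y" using critic[of "-1"] by auto
  have "J gh h1 = (\<Sum>i\<in>{1..n}. ramp m k (x i)) / card {1..n}
     - (\<Sum>(i, j)\<in>I. ramp m k (gh (z i j) 0)) / card I"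
    by (simp add: J_def h1(2))
  moreover have "J gh h2 = - ((\<Sum>i\<in>{1..n}. ramp m k (x i)) / card {1..n}
     - (\<Sum>(i, j)\<in>I. ramp m k (gh (z i j) 0)) / card I)"
    by (simp add: J_def h2(2) sum_negf case_prod_beta')
  ultimately show ?thesis using J[OF h1(1)] J[OF h2(1)] unfolding I_def[symmetric] by linarith
qed

text \<open>Uniform continuity on a compact interval extends to the line, because the distribution
  function is constant on either side of [0, 1]. The distance \<open>2 / m\<close> matches the two
  grid steps lost in \<open>cdf_uniformly_close\<close>.\<close>

lemma cdf_uniform_modulus:
  assumes \<nu>: "real_distribution \<nu>" "continuous_on UNIV (cdf \<nu>)" "AE t in \<nu>. t \<in> {0..1}" and \<omega>: "\<omega> > 0"
  shows "t < 0 \<Longrightarrow> cdf \<nu> t = 0" and "t \<ge> 1 \<Longrightarrow> cdf \<nu> t = 1"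
    and "\<exists>m>0. \<forall>s t. \<bar>s - t\<bar> \<le> 2 / real m \<longrightarrow> \<bar>cdf \<nu> s - cdf \<nu> t\<bar> \<le> \<omega>"
proof -
  interpret real_distribution \<nu> by fact
  have zero: "cdf \<nu> t = 0" if "t < 0" for t
    unfolding cdf_def using \<nu>(3) that by (intro prob_eq_0[THEN iffD2]) (auto elim: eventually_mono)
  have one: "cdf \<nu> t = 1" if "t \<ge> 1" for t
    unfolding cdf_def using \<nu>(3) that by (intro prob_eq_1[THEN iffD2]) (auto elim: eventually_mono)
  show "t < 0 \<Longrightarrow> cdf \<nu> t = 0" "t \<ge> 1 \<Longrightarrow> cdf \<nu> t = 1" by (rule zero one; assumption)+
  have "uniformly_continuous_on {-1..2} (cdf \<nu>)"
    by (intro compact_uniformly_continuous continuous_on_subset[OF \<nu>(2)]) auto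
  then obtain d where d: "d > 0" "\<And>s t. s \<in> {-1..2} \<Longrightarrow> t \<in> {-1..2} \<Longrightarrow> \<bar>s - t\<bar> < d \<Longrightarrow> \<bar>cdf \<nu> s - cdf \<nu> t\<bar> < \<omega>"
    using \<omega> unfolding uniformly_continuous_on_def dist_real_def by (metis abs_minus_commute)
  \<comment> \<open>Clipping is 1-Lipschitz and does not change the value of the distribution
    function, so any two points can be moved into the compact interval.\<close>
  define clip where "clip t = max (-1) (min 2 t)" for t :: real
  have clip: "cdf \<nu> (clip t) = cdf \<nu> t" "clip t \<in> {-1..2}" for t
    using zero[of t] zero[of "clip t"] one[of t] one[of "clip t"]
    by (cases "t < -1"; cases "t > 2"; auto simp: clip_def)+
  obtain m :: nat where m: "2 / d < m" using reals_Archimedean2 by blast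
  moreover have "2 / d > 0" using d by simp
  ultimately have m0: "m > 0" by linarith
  have "2 / m < d" using m m0 d(1) by (simp add: field_simps)
  have "\<bar>cdf \<nu> s - cdf \<nu> t\<bar> \<le> \<omega>" if "\<bar>s - t\<bar> \<le> 2 / m" for s t
  proof -
    have "\<bar>clip s - clip t\<bar> \<le> \<bar>s - t\<bar>" unfolding clip_def by (auto simp: max_def min_def)
    with that \<open>2 / m < d\<close> have "\<bar>clip s - clip t\<bar> < d" by linarith
    from d(2)[OF clip(2) clip(2) this] show ?thesis by (simp add: clip(1))
  qed
  with m0 show "\<exists>m>0. \<forall>s t. \<bar>s - t\<bar> \<le> 2 / real m \<longrightarrow> \<bar>cdf \<nu> s - cdf \<nu> t\<bar> \<le> \<omega>" by blast
qed

text \<open>The deterministic core, for one sample point outside the exceptional events. The grid of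
  size \<open>m'\<close> controls the means of all Lipschitz functions, the grid of size
  \<open>m\<close> carries the ramps; \<open>c\<close> is a cover member near the minimiser, and
  \<open>H\<close> stands for the empirical distribution function of the generated points.\<close>

lemma good_sample_cdf_close:
  fixes x :: "nat \<Rightarrow> real" and z :: "nat \<Rightarrow> nat \<Rightarrow> nat \<Rightarrow> real" and m m' :: nat
  assumes n: "n \<ge> 1" and \<E>: "\<E> \<ge> 1" and m: "m > 0" "m' > 0"
    and \<nu>: "real_distribution \<nu>" "AE t in \<nu>. t \<in> {0..1}"
      "\<And>t. t < 0 \<Longrightarrow> cdf \<nu> t = 0" "\<And>t. t \<ge> 1 \<Longrightarrow> cdf \<nu> t = 1"
      "\<And>s t. \<bar>s - t\<bar> \<le> 2 / m \<Longrightarrow> \<bar>cdf \<nu> s - cdf \<nu> t\<bar> \<le> \<omega>"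
    and PZ: "prob_space PZ" "sets PZ = sets (Rvec r)" "AE y in PZ. y \<in> cube r"
    and out: "\<And>h y. h \<in> G \<Longrightarrow> h y = vec1 (h y 0)"
    and min: "is_arg_min (empirical_W1 C \<E> n x z) (\<lambda>g. g \<in> G) gh"
    and gh: "(\<lambda>y. gh y 0) \<in> borel_measurable (Rvec r)"
    and g0: "g0 \<in> G" "\<And>y. y \<in> cube r \<Longrightarrow> \<bar>g0 y 0 - gs y\<bar> \<le> \<epsilon>" and gs: "\<And>y. gs y \<in> {0..1}"
    and critic: "\<And>k \<sigma>. k < m \<Longrightarrow> \<sigma> \<in> {1, -1} \<Longrightarrow>
      \<exists>h\<in>lip1_critics C. \<forall>y. h (vec1 y) 0 = \<sigma> * ramp m k y"
    and x: "\<And>i. x i \<in> {0..1}" and z: "\<And>i j. i \<in> {1..n} \<Longrightarrow> j \<in> {1..\<E>} \<Longrightarrow> z i j \<in> cube r"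
    and freq: "\<And>k. k < m' \<Longrightarrow>
        \<bar>(\<Sum>i\<in>{1..n}. indicator {..real k / m'} (x i)) / card {1..n} - cdf \<nu> (real k / m')\<bar> \<le> \<eta>"
      "\<And>k. k < m' \<Longrightarrow> \<bar>(\<Sum>(i, j)\<in>{1..n} \<times> {1..\<E>}. indicator {..real k / m'} (gs (z i j))) /
          card ({1..n} \<times> {1..\<E>}) - cdf \<nu> (real k / m')\<bar> \<le> \<eta>"
    and c: "c \<in> borel_measurable (Rvec r)" "\<And>y. y \<in> cube r \<Longrightarrow> \<bar>gh y 0 - c y\<bar> \<le> \<epsilon>"
      "\<And>k. k < m \<Longrightarrow> \<bar>(\<Sum>(i, j)\<in>{1..n} \<times> {1..\<E>}. ramp m k (c (z i j))) /
          card ({1..n} \<times> {1..\<E>}) - (\<integral>y. ramp m k (c y) \<partial>PZ)\<bar> \<le> \<epsilon>"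
    and H: "mono H" "\<And>t. 0 \<le> H t" "\<And>t. H t \<le> 1"
      "\<And>k. k \<le> m \<Longrightarrow> \<bar>H (real k / m) - (\<integral>y. indicator {..real k / m} (gh y 0) \<partial>PZ)\<bar> \<le> d"
    and tol: "real m * (3 * (2 / m' + \<eta>) + 4 * \<epsilon>) \<le> e" and d: "d \<ge> 0" and t: "t \<in> {0..1}"
  shows "\<bar>H t - cdf \<nu> t\<bar> \<le> \<omega> + e + d"
proof -
  interpret \<nu>: real_distribution \<nu> by fact
  interpret PZ: prob_space PZ by fact
  note [measurable_cong] = PZ(2)
  note [measurable] = gh c(1)
  define I where "I = {1..n} \<times> {1..\<E>}"
  define \<delta> where "\<delta> = 2 / real m' + \<eta>"
  have I: "finite I" "I \<noteq> {}" "real (card I) > 0" using n \<E> by (simp_all add: I_def card_cartesian_product)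
  have mean1: "\<bar>(\<Sum>i\<in>{1..n}. f (x i)) / card {1..n} - (\<integral>t. f t \<partial>\<nu>)\<bar> \<le> \<delta>"
    if "1-lipschitz_on UNIV f" for f
    unfolding \<delta>_def
    by (rule lipschitz_mean_approx[OF that m(2) \<nu>.prob_space_axioms _ \<nu>(2)]) (use n x freq(1) in auto)
  have mean2: "\<bar>(\<Sum>(i, j)\<in>{1..n} \<times> {1..\<E>}. f (gs (z i j))) / card ({1..n} \<times> {1..\<E>}) - (\<integral>t. f t \<partial>\<nu>)\<bar> \<le> \<delta>"
    if "1-lipschitz_on UNIV f" for f
    unfolding \<delta>_def I_def[symmetric] case_prod_beta'
    by (rule lipschitz_mean_approx[OF that m(2) \<nu>.prob_space_axioms _ \<nu>(2)])
      (use I gs freq(2)[folded I_def, unfolded case_prod_beta'] in auto)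
  have lip: "1-lipschitz_on UNIV (ramp m k)" for k
    using ramp_lipschitz[OF m(1)] by (intro lipschitz_onI) (auto simp: dist_real_def)
  \<comment> \<open>\<open>2 * \<delta> + \<epsilon>\<close> comes from minimality and
    \<open>\<delta>\<close> from passing to the true mean of the data; one \<open>\<epsilon>\<close>
    each is spent on exchanging the minimiser for \<open>c\<close>, on the fluctuation of
    \<open>c\<close>, and on exchanging back under \<open>PZ\<close>.\<close>
  have dev: "\<bar>(\<integral>t. ramp m k t \<partial>\<nu>) - (\<integral>y. ramp m k (gh y 0) \<partial>PZ)\<bar> \<le> 3 * \<delta> + 4 * \<epsilon>" if k: "k < m" for k
  proof -
    let ?u = "\<lambda>i j. ramp m k (gh (z i j) 0)" and ?v = "\<lambda>i j. ramp m k (c (z i j))"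
    have "\<bar>(\<Sum>i\<in>{1..n}. ramp m k (x i)) / card {1..n} - (\<Sum>(i, j)\<in>I. ?u i j) / card I\<bar>
        \<le> 2 * \<delta> + \<epsilon>"
      unfolding I_def
      by (rule minimiser_ramp_deviation[where T = "cube r" and \<mu> = "\<lambda>f. \<integral>t. f t \<partial>\<nu>"
            and G = G and C = C and ?g0.0 = g0 and gs = gs, OF n \<E>])
        (rule out min g0 z critic[OF k] mean1 mean2; assumption)+
    moreover have "\<bar>(\<Sum>i\<in>{1..n}. ramp m k (x i)) / card {1..n} - (\<integral>t. ramp m k t \<partial>\<nu>)\<bar> \<le> \<delta>"
      by (rule mean1[OF lip])
    moreover have "\<bar>(\<Sum>(i, j)\<in>I. ?u i j) / card I - (\<Sum>(i, j)\<in>I. ?v i j) / card I\<bar> \<le> \<epsilon>"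
    proof -
      have "\<bar>(\<Sum>(i, j)\<in>I. ?u i j) - (\<Sum>(i, j)\<in>I. ?v i j)\<bar>
          \<le> (\<Sum>(i, j)\<in>I. \<bar>?u i j - ?v i j\<bar>)"
        unfolding sum_subtractf[symmetric] case_prod_beta' by (rule sum_abs)
      also have "\<dots> \<le> (\<Sum>p\<in>I. \<epsilon>)"
      proof (intro sum_mono)
        fix p assume "p \<in> I"
        then obtain i j where p: "p = (i, j)" "i \<in> {1..n}" "j \<in> {1..\<E>}" by (auto simp: I_def)
        have "\<bar>?u i j - ?v i j\<bar> \<le> \<bar>gh (z i j) 0 - c (z i j)\<bar>"
          by (rule ramp_lipschitz[OF m(1)])
        also have "\<dots> \<le> \<epsilon>" by (intro c(2) z p)
        finally show "(case p of (i, j) \<Rightarrow> \<bar>?u i j - ?v i j\<bar>) \<le> \<epsilon>"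
          by (simp add: p(1))
      qed
      finally have "\<bar>(\<Sum>(i, j)\<in>I. ?u i j) - (\<Sum>(i, j)\<in>I. ?v i j)\<bar> / card I \<le> \<epsilon>"
        using I(3) by (simp add: field_simps)
      then show ?thesis using I(3) by (simp add: abs_divide flip: diff_divide_distrib)
    qed
    moreover have "\<bar>(\<Sum>(i, j)\<in>I. ?v i j) / card I - (\<integral>y. ramp m k (c y) \<partial>PZ)\<bar> \<le> \<epsilon>"
      using c(3)[OF k] by (simp add: I_def)
    moreover have "\<bar>(\<integral>y. ramp m k (c y) \<partial>PZ) - (\<integral>y. ramp m k (gh y 0) \<partial>PZ)\<bar> \<le> \<epsilon>"
    proof -
      have int: "integrable PZ (\<lambda>y. ramp m k (c y))" "integrable PZ (\<lambda>y. ramp m k (gh y 0))"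
        by (rule PZ.integrable_const_bound[where B = "1 / m"];
            use ramp_bounds(1,2)[OF m(1)] in simp)+
      have "(\<integral>y. ramp m k (c y) \<partial>PZ) - (\<integral>y. ramp m k (gh y 0) \<partial>PZ)
          = (\<integral>y. ramp m k (c y) - ramp m k (gh y 0) \<partial>PZ)" using int by simp
      also have "\<bar>\<dots>\<bar> \<le> (\<integral>y. \<bar>ramp m k (c y) - ramp m k (gh y 0)\<bar> \<partial>PZ)" by (rule integral_abs_bound)
      also have "\<dots> \<le> (\<integral>y. \<epsilon> \<partial>PZ)"
      proof (rule integral_mono_AE)
        show "AE y in PZ. \<bar>ramp m k (c y) - ramp m k (gh y 0)\<bar> \<le> \<epsilon>"
          using PZ(3)
        proof eventually_elim
          case (elim y)
          have "\<bar>ramp m k (c y) - ramp m k (gh y 0)\<bar> \<le> \<bar>c y - gh y 0\<bar>" by (rule ramp_lipschitz[OF m(1)])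
          with c(2)[OF elim] show ?case by linarith
        qed
      qed (use int in auto)
      finally show ?thesis by (simp add: PZ.prob_space)
    qed
    ultimately show ?thesis by linarith
  qed
  define G' where "G' t = measure PZ {y \<in> space PZ. gh y 0 \<le> t}" for t
  have G': "(\<integral>y. indicator {..t} (gh y 0) \<partial>PZ) = G' t" for t
  proof -
    have "(\<integral>y. indicator {..t} (gh y 0) \<partial>PZ) = (\<integral>y. ( indicator {y \<in> space PZ. gh y 0 \<le> t} :: _ \<Rightarrow> real) y \<partial>PZ)"
      by (intro Bochner_Integration.integral_cong) (auto simp: indicator_def)
    then show ?thesis by (simp add: G'_def)
  qed
  have cdf: "measure \<nu> {t \<in> space \<nu>. t \<le> s} = cdf \<nu> s" for s by (simp add: cdf_def atMost_def)
  have m0: "real m > 0" using m by simp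
  \<comment> \<open>Ramps have height \<open>1 / m\<close>; undoing this multiplies the error by
    \<open>m\<close>, which explains the factor in \<open>tol\<close>.\<close>
  have scale: "a \<le> b + e" if "1 / real m * a \<le> 1 / real m * b + e / real m" for a b
    using that m0 by (simp add: divide_le_cancel flip: add_divide_distrib)
  have tol': "3 * \<delta> + 4 * \<epsilon> \<le> e / m" using tol m0 by (simp add: \<delta>_def field_simps)
  have id: "(\<lambda>t. t) \<in> borel_measurable \<nu>" by simp
  note rb\<nu> = ramp_mean_bounds[OF \<nu>.prob_space_axioms id m(1), unfolded cdf]
  have ghPZ: "(\<lambda>y. gh y 0) \<in> borel_measurable PZ" by measurable
  note rbPZ = ramp_mean_bounds[OF PZ.prob_space_axioms ghPZ m(1), folded G'_def]
  show ?thesis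
  proof (rule cdf_uniformly_close[where G = G', OF m(1) H(1-3) \<nu>(3-5) _ _ _ _ d t])
    fix k assume k: "k < m"
    have "1 / m * (1 - cdf \<nu> (real (Suc k) / m)) \<le> 1 / m * (1 - G' (real k / m)) + e / m"
      using rb\<nu>(2)[of k] rbPZ(1)[of k] dev[OF k] tol' by linarith
    then have "1 - cdf \<nu> (real (Suc k) / m) \<le> 1 - G' (real k / m) + e" by (rule scale)
    then show "G' (real k / m) \<le> cdf \<nu> (real (Suc k) / m) + e" by linarith
    have "1 / m * (1 - G' (real (Suc k) / m)) \<le> 1 / m * (1 - cdf \<nu> (real k / m)) + e / m"
      using rb\<nu>(1)[of k] rbPZ(2)[of k] dev[OF k] tol' by linarith
    then have "1 - G' (real (Suc k) / m) \<le> 1 - cdf \<nu> (real k / m) + e" by (rule scale)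
    then show "cdf \<nu> (real k / m) - e \<le> G' (real (Suc k) / m)" by linarith
  next
    show "\<bar>H (real k / m) - G' (real k / m)\<bar> \<le> d" if "k \<le> m" for k using H(4)[OF that] by (simp add: G')
    \<comment> \<open>Nonnegativity of \<open>e\<close> is read off from \<open>dev\<close>, which
      bounds an absolute value.\<close>
    have "0 \<le> 3 * \<delta> + 4 * \<epsilon>" using dev[OF m(1)] by linarith
    with tol' m0 have "0 \<le> e / m" by linarith
    with m0 show "0 \<le> e" by (simp add: zero_le_divide_iff)
  qed
qed

lemma empirical_cdf_mono: "mono (empirical_cdf g zs N)"
  unfolding empirical_cdf_def
  by (intro monoI mult_left_mono sum_mono) (auto simp: indicator_def)

lemma empirical_cdf_bounds: "0 \<le> empirical_cdf g zs N t" "empirical_cdf g zs N t \<le> 1"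
proof -
  show "0 \<le> empirical_cdf g zs N t" unfolding empirical_cdf_def by (intro mult_nonneg_nonneg sum_nonneg) auto
  have "(\<Sum>j=1..N. indicator {..t} (g (zs j) 0)) \<le> (\<Sum>j=1..N. 1 :: real)"
    by (intro sum_mono) (auto simp: indicator_def)
  then have "(\<Sum>j=1..N. indicator {..t} (g (zs j) 0)) \<le> real N" by simp
  then show "empirical_cdf g zs N t \<le> 1"
    unfolding empirical_cdf_def by (cases "N = 0") (auto simp: field_simps)
qed

lemma (in prob_space) prob_UN_le:
  fixes b :: real
  assumes "finite K" "\<And>k. k \<in> K \<Longrightarrow> S k \<in> events" "\<And>k. k \<in> K \<Longrightarrow> prob (S k) \<le> b"
  shows "prob (\<Union>k\<in>K. S k) \<le> card K * b"
proof -
  have "prob (\<Union>k\<in>K. S k) \<le> (\<Sum>k\<in>K. prob (S k))"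
    using assms by (intro finite_measure_subadditive_finite) auto
  also have "\<dots> \<le> card K * b" using sum_bounded_above[of K "\<lambda>k. prob (S k)" b] assms(3) by simp
  finally show ?thesis .
qed

text \<open>The law is a point mass, so its distribution function jumps at \<open>a\<close>. This
  rules out a true generator depending on no coordinate at all, that is,
  \<open>dg = 0\<close>.\<close>

lemma constant_generator_not_continuous:
  assumes PZ: "prob_space PZ" "g \<in> borel_measurable PZ" and g: "\<And>y. y \<in> space PZ \<Longrightarrow> g y = a"
  shows "\<not> continuous_on UNIV (cdf (distr PZ borel g))"
proof
  interpret PZ: prob_space PZ by fact
  interpret real_distribution "distr PZ borel g" by (rule PZ.real_distribution_distr) (use PZ in auto)
  assume "continuous_on UNIV (cdf (distr PZ borel g))"
  then have "isCont (cdf (distr PZ borel g)) a" by (simp add: continuous_on_eq_continuous_at)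
  then have "measure (distr PZ borel g) {a} = 0" by (simp add: isCont_cdf)
  moreover have "measure (distr PZ borel g) {a} = measure PZ (g -` {a} \<inter> space PZ)"
    using PZ(2) by (intro measure_distr) auto
  moreover have "g -` {a} \<inter> space PZ = space PZ" using g by auto
  ultimately show False by (simp add: PZ.prob_space)
qed

theorem lemma3p6:
  fixes M :: "'w measure"
    and X :: "int \<Rightarrow> 'w \<Rightarrow> real" and Y :: "'w \<Rightarrow> real"
    and PZ :: "(nat \<Rightarrow> real) measure"
    and Z :: "nat \<Rightarrow> nat \<Rightarrow> 'w \<Rightarrow> nat \<Rightarrow> real" and Zs :: "nat \<Rightarrow> 'w \<Rightarrow> nat \<Rightarrow> real"
    and dZ dg \<E> :: nat and \<beta> K \<gamma> \<kappa> \<alpha> \<rho> :: real and F :: "nat \<Rightarrow> real"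
    and gstar :: "(nat \<Rightarrow> real) \<Rightarrow> real"
    and Lf Lg :: "nat \<Rightarrow> nat" and pf pg :: "nat \<Rightarrow> nat \<Rightarrow> nat" and sf sg :: "nat \<Rightarrow> real"
    and ghat :: "nat \<Rightarrow> 'w \<Rightarrow> (nat \<Rightarrow> real) \<Rightarrow> nat \<Rightarrow> real"
  assumes prob: "prob_space M"
    and stationary: "strictly_stationary M X"
    and X_range: "\<And>i \<omega>. \<omega> \<in> space M \<Longrightarrow> X i \<omega> \<in> {0..1}"
    and Y: "Y \<in> borel_measurable M" "distr M borel Y = distr M borel (X 1)"
    and PZ: "prob_space PZ" "sets PZ = sets (Rvec dZ)" "AE z in PZ. z \<in> cube dZ"
    and Z_indep: "prob_space.indep_vars M (\<lambda>_. Rvec dZ) (\<lambda>(i, j). Z i j) ({1..} \<times> {1..\<E>})"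
    and Z_distr: "\<And>i j. 1 \<le> i \<Longrightarrow> j \<in> {1..\<E>} \<Longrightarrow> distr M (Rvec dZ) (Z i j) = PZ"
    and Zs_indep: "prob_space.indep_vars M (\<lambda>_. Rvec dZ) Zs {1..}"
    and Zs_distr: "\<And>j. 1 \<le> j \<Longrightarrow> distr M (Rvec dZ) (Zs j) = PZ"
    and X_Z_indep: "prob_space.indep_set M
          (sigma_sets (space M) (generators M borel X UNIV))
          (sigma_sets (space M) (generators M (Rvec dZ) (\<lambda>(i, j). Z i j) ({1..} \<times> {1..\<E>})))"
    and XZ_Zs_indep: "prob_space.indep_set M
          (sigma_sets (space M) (generators M borel X UNIV \<union>
             generators M (Rvec dZ) (\<lambda>(i, j). Z i j) ({1..} \<times> {1..\<E>})))
          (sigma_sets (space M) (generators M (Rvec dZ) Zs {1..}))"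
    and beta: "\<beta> \<ge> 1" and K: "K > 0" and E: "\<E> \<ge> 1" and gamma: "\<gamma> \<ge> 1"
    and gstar: "gstar \<in> generator_class dZ dg \<beta> K"
    and model: "distr M borel Y = distr PZ borel gstar"
    and cont: "continuous_on UNIV (cdf (distr M borel Y))"
    and pf_ends: "\<And>n. n \<ge> 1 \<Longrightarrow> pf n 0 = 1 \<and> pf n (Suc (Lf n)) = 1"
    and pg_ends: "\<And>n. n \<ge> 1 \<Longrightarrow> pg n 0 = dZ \<and> pg n (Suc (Lg n)) = 1"
    and s_pos: "\<And>n. n \<ge> 1 \<Longrightarrow> sf n > 0 \<and> sg n > 0"
    and a_depth: "\<And>n. n \<ge> 1 \<Longrightarrow> real (Lf n) \<ge> log 2 (real n) * log 2 (max 4 (4 * \<gamma>))"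
    and a_width: "(\<lambda>n. real (Min (pf n ` {1..Lf n}))) \<in> \<Omega>(\<lambda>n. real n * rate \<gamma> 1 n)"
    and a_sparse: "sf \<in> \<Omega>(\<lambda>n. ln (real n) * (real n * rate \<gamma> 1 n))"
    and b_F: "\<And>n. n \<ge> 1 \<Longrightarrow> F n \<ge> max K 1"
    and b_depth: "\<And>n. n \<ge> 1 \<Longrightarrow>
          log 2 (real (n * \<E>)) * log 2 (max (4 * real dg) (4 * \<beta>)) \<le> real (Lg n)"
    and b_depth_upper: "(\<lambda>n. real (Lg n)) \<in> O(\<lambda>n. ln (real (n * \<E>)))"
    and b_width: "(\<lambda>n. real (Min (pg n ` {1..Lg n})))
          \<in> \<Omega>(\<lambda>n. real (n * \<E>) * rate \<beta> (real dg) (n * \<E>))"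
    and b_sparse: "sg \<in> \<Theta>(\<lambda>n. real (n * \<E>) * rate \<beta> (real dg) (n * \<E>) * ln (real (n * \<E>)))"
    and b_compare: "\<And>n. n \<ge> 1 \<Longrightarrow> Lf n \<le> Lg n \<and> sf n \<le> sg n"
    and c_mixing: "\<kappa> > 1" "\<alpha> > 1"
          "\<And>k. k \<ge> 1 \<Longrightarrow> beta_mixing M X k \<le> \<kappa> * real k powr (- \<alpha>)"
    and ghat_measurable: "\<And>n. n \<ge> 1 \<Longrightarrow>
          (\<lambda>(\<omega>, z). ghat n \<omega> z 0) \<in> borel_measurable (data_algebra M dZ \<E> X Z n \<Otimes>\<^sub>M Rvec dZ)"
    and ghat_min: "\<And>n \<omega>. n \<ge> 1 \<Longrightarrow> \<omega> \<in> space M \<Longrightarrow>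
          is_arg_min
            (empirical_W1 (networks (Lf n) (pf n) (sf n) (F n)) \<E> n
               (\<lambda>i. X (int i) \<omega>) (\<lambda>i j. Z i j \<omega>))
            (\<lambda>g. g \<in> networks (Lg n) (pg n) (sg n) (F n)) (ghat n \<omega>)"
    and rho: "\<rho> > 0"
  shows "limsup (\<lambda>n. limsup (\<lambda>N. ereal (measure M {\<omega> \<in> space M.
           \<bar>empirical_cdf (ghat n \<omega>) (\<lambda>j. Zs j \<omega>) N (Y \<omega>) - cdf (distr M borel Y) (Y \<omega>)\<bar> \<ge> \<rho>}))) = 0"
proof -

  \<comment> \<open>Laws of the data and of the true generator\<close>
  interpret prob_space M by (rule prob)
  interpret PZ: prob_space PZ by (rule PZ(1))
  define \<nu> where "\<nu> = distr M borel Y"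
  have Xm [measurable]: "X i \<in> borel_measurable M" for i using stationary_measurable[OF stationary] .
  note Y(1) [measurable]
  have \<nu>_rd: "real_distribution \<nu>" unfolding \<nu>_def by (rule real_distribution_distr) measurable
  interpret \<nu>: real_distribution \<nu> by (rule \<nu>_rd)
  have \<nu>X: "\<nu> = distr M borel (X 1)" using Y(2) by (simp add: \<nu>_def)
  have \<nu>01: "AE t in \<nu>. t \<in> {0..1}"
    unfolding \<nu>X by (subst AE_distr_iff) (use X_range in auto)
  have Y01: "AE \<omega> in M. Y \<omega> \<in> {0..1}"
    using \<nu>01 unfolding \<nu>_def by (subst (asm) AE_distr_iff) auto
  have cont\<nu>: "continuous_on UNIV (cdf \<nu>)" using cont by (simp add: \<nu>_def)
  have gs_meas: "gstar \<in> borel_measurable (Rvec dZ)" using gstar by (simp add: generator_class_def)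
  then have gs_measPZ: "gstar \<in> borel_measurable PZ" using PZ(2) measurable_cong_sets by blast
  have \<nu>g: "\<nu> = distr PZ borel gstar" using model by (simp add: \<nu>_def)
  have g01: "AE y in PZ. gstar y \<in> {0..1}"
    using \<nu>01 gs_measPZ unfolding \<nu>g by (subst (asm) AE_distr_iff) auto
  have spPZ: "space PZ = space (Rvec dZ)" using PZ(2) by (rule sets_eq_imp_space_eq)

  \<comment> \<open>For \<open>dg = 0\<close> the product of \<open>n * \<E>\<close> and its rate
    would be constantly 1, and the widths and sparsities could not be forced to grow.\<close>
  have dg: "dg \<ge> 1"
  proof (rule ccontr)
    assume "\<not> dg \<ge> 1"
    then have dg0: "dg = 0" by simp
    obtain I where I: "I \<subseteq> {..<dZ}" "card I = dg"
      "\<forall>x\<in>space (Rvec dZ). \<forall>y\<in>space (Rvec dZ). (\<forall>i\<in>I. x i = y i) \<longrightarrow> gstar x = gstar y"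
      using gstar unfolding generator_class_def by blast
    have "I = {}" using I(1,2) dg0 finite_subset[OF I(1)] by simp
    obtain y0 where "y0 \<in> space PZ" using PZ.not_empty by blast
    then have "gstar y = gstar y0" if "y \<in> space PZ" for y
      using I(3) that unfolding spPZ \<open>I = {}\<close> by blast
    from constant_generator_not_continuous[OF PZ(1) gs_measPZ this] cont\<nu> show False by (simp add: \<nu>g)
  qed

  \<comment> \<open>\<open>gstar\<close> takes values in the unit interval only almost surely.
    Clamping makes this hold everywhere without changing the law.\<close>
  define gs where "gs y = min 1 (max (gstar y) 0)" for y
  have gs_meas' [measurable]: "gs \<in> borel_measurable (Rvec dZ)" unfolding gs_def using gs_meas by measurable
  have gs01: "gs y \<in> {0..1}" for y by (auto simp: gs_def)
  have gs_cdf: "(\<integral>y. indicator {..t} (gs y) \<partial>PZ) = cdf \<nu> t" for t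
  proof -
    have "(\<integral>y. indicator {..t} (gs y) \<partial>PZ) = (\<integral>y. (indicator {..t} (gstar y) :: real) \<partial>PZ)"
    proof (rule integral_cong_AE)
      show "AE y in PZ. indicator {..t} (gs y) = (indicator {..t} (gstar y) :: real)"
        using g01 by eventually_elim (auto simp: gs_def)
      have "(\<lambda>y. indicator {..t} (gs y) :: real) \<in> borel_measurable (Rvec dZ)" by measurable
      then show "(\<lambda>y. indicator {..t} (gs y) :: real) \<in> borel_measurable PZ"
        using PZ(2) measurable_cong_sets by blast
      show "(\<lambda>y. indicator {..t} (gstar y) :: real) \<in> borel_measurable PZ"
        using gs_measPZ by measurable
    qed
    also have "\<dots> = (\<integral>s. indicator {..t} s \<partial>\<nu>)"
      unfolding \<nu>g using gs_measPZ by (intro integral_distr[symmetric]) auto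
    also have "\<dots> = cdf \<nu> t" by (simp add: cdf_def)
    finally show ?thesis .
  qed

  \<comment> \<open>Choice of grids and tolerances\<close>
  obtain m where m: "m > 0" "\<And>s t. \<bar>s - t\<bar> \<le> 2 / real m \<Longrightarrow> \<bar>cdf \<nu> s - cdf \<nu> t\<bar> \<le> \<rho> / 8"
    using cdf_uniform_modulus(3)[OF \<nu>_rd cont\<nu> \<nu>01, of "\<rho> / 8"] rho by auto
  \<comment> \<open>Calibrated so that
    \<open>m * (6 * \<eta> + 4 * \<epsilon>) = \<rho> / 4\<close>, each of the two terms
    contributing \<open>\<rho> / 8\<close>.\<close>
  define \<epsilon> where "\<epsilon> = \<rho> / (32 * real m)"
  define \<eta> where "\<eta> = \<rho> / (48 * real m)"
  have \<epsilon>: "\<epsilon> > 0" and \<eta>: "\<eta> > 0" using rho m(1) by (simp_all add: \<epsilon>_def \<eta>_def)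
  obtain m' :: nat where m': "m' > 0" "2 / real m' \<le> \<eta>"
  proof -
    obtain m' :: nat where m': "2 / \<eta> < m'" using reals_Archimedean2 by blast
    have "2 / \<eta> > 0" using \<eta> by simp
    with m' have "m' > 0" by linarith
    moreover from this m' \<eta> have "2 / real m' \<le> \<eta>" by (simp add: field_simps)
    ultimately show ?thesis by (rule that)
  qed
  have tol: "real m * (3 * (2 / m' + \<eta>) + 4 * \<epsilon>) \<le> \<rho> / 4"
  proof -
    have "real m * (3 * (2 / m' + \<eta>) + 4 * \<epsilon>) \<le> real m * (3 * (\<eta> + \<eta>) + 4 * \<epsilon>)"
      using m'(2) by (intro mult_left_mono) auto
    also have "\<dots> = \<rho> / 4" using m(1) by (simp add: \<epsilon>_def \<eta>_def field_simps)
    finally show ?thesis .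
  qed

  \<comment> \<open>A fixed program near the true generator\<close>
  have "gstar \<in> holder_class dZ (cube dZ) \<beta> K" using gstar by (simp add: generator_class_def)
  from holder_class_lipschitz[OF this beta K]
  obtain f0 where f0: "slp_fun dZ f0" "\<And>y. y \<in> cube dZ \<Longrightarrow> 0 \<le> f0 y \<and> f0 y \<le> 1 \<and> \<bar>f0 y - gs y\<bar> \<le> \<epsilon>"
    using slp_fun_approx[of dZ gstar K \<epsilon>] K \<epsilon> unfolding gs_def by auto
  \<comment> \<open>The program depends on \<open>\<epsilon>\<close> and \<open>gstar\<close> only,
    so its length is constant in \<open>n\<close>.\<close>
  obtain fs cs where fs: "slp dZ fs" "\<And>j. \<bar>cs j\<bar> \<le> 1"
    "\<And>y. y \<in> cube dZ \<Longrightarrow> f0 y = (\<Sum>j<length fs. cs j * (fs ! j) y)"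
    using f0(1) slp_start[of dZ] unfolding slp_fun_def slp_extends_def by blast

  \<comment> \<open>Growth of depth, width and sparsity\<close>
  have Lf_log: "log 2 (real n) \<le> real (Lf n)" if "n \<ge> 1" for n
  proof -
    have "1 \<le> log 2 (max 4 (4 * \<gamma>))" by (subst le_log_iff) auto
    then have "log 2 (real n) * 1 \<le> log 2 (real n) * log 2 (max 4 (4 * \<gamma>))"
      using that by (intro mult_left_mono) auto
    with a_depth[OF that] show ?thesis by simp
  qed
  have Lf_lim: "filterlim Lf at_top at_top" by (rule filterlim_log_depth[OF Lf_log])
  have Lg_lim: "filterlim Lg at_top at_top"
    by (rule filterlim_at_top_mono[OF Lf_lim])
      (use b_compare in \<open>auto simp: eventually_sequentially intro!: exI[of _ 1]\<close>)
  define wg where "wg n = real (n * \<E>) * rate \<beta> (real dg) (n * \<E>)" for n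
  define wf where "wf n = real n * rate \<gamma> 1 n" for n
  have wg_lim: "filterlim wg at_top at_top"
    unfolding wg_def using beta dg E by (intro filterlim_rate_mult) auto
  have wf_lim: "filterlim wf at_top at_top"
    using filterlim_rate_mult[of \<gamma> 1 1] gamma by (simp add: wf_def[abs_def])
  \<comment> \<open>The logarithmic upper bound is given for the generator depth; the critics
    inherit it through \<open>Lf n \<le> Lg n\<close>.\<close>
  have Lf_O: "(\<lambda>n. real (Lf n)) \<in> O(\<lambda>n. ln (real (n * \<E>)))"
  proof -
    have "(\<lambda>n. real (Lf n)) \<in> O(\<lambda>n. real (Lg n))"
      by (rule bigoI[of _ 1]) (use b_compare in \<open>auto simp: eventually_sequentially intro!: exI[of _ 1]\<close>)
    then show ?thesis using b_depth_upper by (rule landau_o.big.trans)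
  qed
  \<comment> \<open>\<open>ln n \<le> ln (n * \<E>)\<close> weakens the lower half of
    \<open>b_sparse\<close> to the form that \<open>eventually_sparsity_ge\<close> compares with the
    depth.\<close>
  have sg_Omega: "sg \<in> \<Omega>(\<lambda>n. ln (real n) * wg n)"
  proof -
    have "(\<lambda>n. ln (real n) * wg n) \<in> O(\<lambda>n. real (n * \<E>) * rate \<beta> (real dg) (n * \<E>) * ln (real (n * \<E>)))"
    proof (rule bigoI[of _ 1], unfold eventually_sequentially, intro exI[of _ 1] allI impI)
      fix n :: nat assume n: "1 \<le> n"
      have "ln (real n) \<le> ln (real (n * \<E>))" using n E by (subst ln_le_cancel_iff) (auto intro!: of_nat_mono)
      moreover have "0 \<le> ln (real n)" using n by simp
      ultimately have "\<bar>wg n\<bar> * \<bar>ln (real n)\<bar> \<le> \<bar>wg n\<bar> * \<bar>ln (real (n * \<E>))\<bar>"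
        by (intro mult_left_mono) auto
      then show "norm (ln (real n) * wg n)
          \<le> 1 * norm (real (n * \<E>) * rate \<beta> (real dg) (n * \<E>) * ln (real (n * \<E>)))"
        unfolding wg_def[symmetric] real_norm_def abs_mult by (simp only: mult_ac mult_1)
    qed
    moreover have "(\<lambda>n. real (n * \<E>) * rate \<beta> (real dg) (n * \<E>) * ln (real (n * \<E>))) \<in> O(sg)"
      using IntD2[OF b_sparse[unfolded bigtheta_def]] unfolding bigomega_iff_bigo .
    ultimately show ?thesis unfolding bigomega_iff_bigo by (rule landau_o.big.trans)
  qed

  \<comment> \<open>Properties of the network classes for large sample sizes\<close>
  let ?C = "\<lambda>n. networks (Lf n) (pf n) (sf n) (F n)"
  let ?PG = "\<lambda>n. \<exists>g0\<in>networks (Lg n) (pg n) (sg n) (F n). \<forall>y\<in>cube dZ. g0 y 0 = f0 y"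
  let ?PC = "\<lambda>n. \<forall>k<m. \<forall>\<sigma>\<in>{1, -1}. \<exists>h\<in>lip1_critics (?C n).
      \<forall>y. h (vec1 y) 0 = \<sigma> * ramp m k y"
  let ?PE = "\<lambda>n. \<exists>Q>0. cover_radius dZ (nat \<lfloor>sg n\<rfloor>) (Lg n) Q \<le> \<epsilon> \<and>
     real (cover_size dZ (nat \<lfloor>sg n\<rfloor>) (Lg n) Q) \<le> exp (\<epsilon>\<^sup>2 * real (n * \<E>))"
  define Sl where "Sl = length fs"
  have evG: "eventually ?PG at_top"
  proof -
    have "eventually (\<lambda>n. Suc Sl \<le> Lg n) at_top" using Lg_lim unfolding filterlim_at_top by blast
    moreover have "eventually (\<lambda>n. \<forall>l\<in>{1..Lg n}. Sl \<le> pg n l) at_top"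
      using b_width wg_lim unfolding wg_def by (rule eventually_widths_ge)
    moreover have "eventually (\<lambda>n. (2 * real (Suc Sl)^2) * real (Suc (Lg n)) \<le> sg n) at_top"
      by (rule eventually_sparsity_ge[OF b_depth_upper E sg_Omega _ wg_lim]) (use s_pos in auto)
    ultimately show ?thesis using eventually_ge_at_top[of 1]
    proof eventually_elim
      case (elim n)
      show ?case
      proof (rule slp_network[OF fs(1,2)])
        show "length fs - dZ < Lg n" using elim(1) by (simp add: Sl_def)
        show "2 * real (Suc (Lg n)) * (real (Suc (length fs)))\<^sup>2 \<le> sg n"
          using elim(3) by (simp only: Sl_def mult_ac)
        show "\<bar>f0 y\<bar> \<le> F n" if "y \<in> cube dZ" for y
          using f0(2)[OF that] b_F[OF elim(4)] by auto
      qed (use elim fs(3) pg_ends in \<open>auto simp: Sl_def\<close>)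
    qed
  qed
  have evC: "eventually ?PC at_top"
  proof -
    have "eventually (\<lambda>n. 1 \<le> Lf n) at_top" using Lf_lim unfolding filterlim_at_top by blast
    moreover have "eventually (\<lambda>n. \<forall>l\<in>{1..Lf n}. 2 \<le> pf n l) at_top"
      using a_width wf_lim unfolding wf_def by (rule eventually_widths_ge)
    moreover have "eventually (\<lambda>n. 6 * real (Suc (Lf n)) \<le> sf n) at_top"
      by (rule eventually_sparsity_ge[OF Lf_O E _ _ wf_lim]) (use s_pos a_sparse in \<open>auto simp: wf_def\<close>)
    ultimately show ?thesis using eventually_ge_at_top[of 1]
    proof eventually_elim
      case (elim n)
      show ?case
      proof (intro allI impI ballI)
        fix k and \<sigma> :: real assume k: "k < m" and \<sigma>: "\<sigma> \<in> {1, -1}"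
        have \<sigma>1: "\<bar>\<sigma>\<bar> \<le> 1" using \<sigma> by auto
        have "\<exists>h\<in>?C n. \<forall>x. h x 0 = \<sigma> * ramp m k (x 0)"
          by (rule ramp_network[OF _ _ _ _ _ _ k \<sigma>1]) (use elim pf_ends[of n] b_F[of n] in auto)
        then obtain h where h: "h \<in> ?C n" "\<And>x. h x 0 = \<sigma> * ramp m k (x 0)"
          by blast
        have "h \<in> lip1_critics (?C n)"
          by (rule ramp_critic[OF h \<sigma>1 m(1)])
        moreover have "h (vec1 y) 0 = \<sigma> * ramp m k y" for y by (simp add: h(2) vec1_def)
        ultimately show "\<exists>h\<in>lip1_critics (?C n). \<forall>y. h (vec1 y) 0 = \<sigma> * ramp m k y"
          by blast
      qed
    qed
  qed
  define a where "a = real dg / (2 * \<beta> + real dg)"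
  have a: "0 < a" "a < 1" using dg beta by (auto simp: a_def field_simps)
  have sg_O: "sg \<in> O(\<lambda>n. real (n * \<E>) powr a * ln (real (n * \<E>)))"
  proof -
    have "sg \<in> O(\<lambda>n. real (n * \<E>) * rate \<beta> (real dg) (n * \<E>) * ln (real (n * \<E>)))"
      using b_sparse by (simp add: bigtheta_def)
    also have "O(\<lambda>n. real (n * \<E>) * rate \<beta> (real dg) (n * \<E>) * ln (real (n * \<E>)))
        = O(\<lambda>n. real (n * \<E>) powr a * ln (real (n * \<E>)))"
    proof (rule landau_o.big.cong, unfold eventually_sequentially, intro exI[of _ 1] allI impI)
      fix n :: nat assume "1 \<le> n"
      then have "1 \<le> n * \<E>" using E by simp
      from rate_mult[OF this, of \<beta> "real dg"] beta
      show "real (n * \<E>) * rate \<beta> (real dg) (n * \<E>) * ln (real (n * \<E>))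
        = real (n * \<E>) powr a * ln (real (n * \<E>))" by (simp only: a_def)
    qed
    finally show ?thesis .
  qed
  \<comment> \<open>The entropy exponent \<open>\<epsilon>\<^sup>2\<close> is half of the Hoeffding
    exponent \<open>2 * \<epsilon>\<^sup>2\<close>, so a union bound over the cover still decays
    exponentially.\<close>
  have evE: "eventually ?PE at_top"
    by (rule eventually_entropy_le[OF b_depth_upper E sg_O a \<epsilon>]) (use \<epsilon> in simp)

  \<comment> \<open>The vanishing bound on the probability\<close>
  have \<kappa>0: "\<kappa> \<ge> 0" using c_mixing(1) by simp
  obtain B where B: "\<And>n A \<eta>. n \<ge> 1 \<Longrightarrow> A \<in> sets borel \<Longrightarrow> \<eta> > 0 \<Longrightarrow>
    prob {\<omega> \<in> space M. \<bar>(\<Sum>i=1..n. indicator A (X (int i) \<omega>)) / n - measure (distr M borel (X 1)) A\<bar> \<ge> \<eta>}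
      \<le> B / (n * \<eta>\<^sup>2)"
    using mixing_frequency_deviation[OF stationary c_mixing(2) \<kappa>0 c_mixing(3)] by blast

  \<comment> \<open>Union bounds over \<open>m'\<close> frequencies of the data, over
    \<open>m'\<close> frequencies of \<open>gs (Z i j)\<close>, and over the pairs of a cover member
    and a ramp.\<close>
  define b where "b n = real m' * (B / (real n * \<eta>\<^sup>2)) + real m' * (2 * exp (- 2 * real (n * \<E>) * \<eta>\<^sup>2))
      + 2 * real m * exp (- \<epsilon>\<^sup>2 * real (n * \<E>))" for n
  have b_lim: "b \<longlonglongrightarrow> 0"
  proof -
    have E0: "real \<E> > 0" using E by simp
    have "(\<lambda>n. real m' * (B / (real n * \<eta>\<^sup>2))) \<longlonglongrightarrow> 0" using \<eta> by real_asymp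
    moreover have "(\<lambda>n. real m' * (2 * exp (- 2 * (real n * real \<E>) * \<eta>\<^sup>2))) \<longlonglongrightarrow> 0"
      using \<eta> E0 by real_asymp
    moreover have "(\<lambda>n. 2 * real m * exp (- \<epsilon>\<^sup>2 * (real n * real \<E>))) \<longlonglongrightarrow> 0"
      using \<epsilon> E0 by real_asymp
    ultimately have "(\<lambda>n. real m' * (B / (real n * \<eta>\<^sup>2)) + real m' * (2 * exp (- 2 * (real n * real \<E>) * \<eta>\<^sup>2))
      + 2 * real m * exp (- \<epsilon>\<^sup>2 * (real n * real \<E>))) \<longlonglongrightarrow> 0 + 0 + 0" by (intro tendsto_add)
    then show ?thesis by (simp add: b_def[abs_def])
  qed

  have Z_rv: "random_variable (Rvec dZ) (Z i j)" if "1 \<le> i" "j \<in> {1..\<E>}" for i j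
    using Z_indep that unfolding indep_vars_def by force
  have Z_cube: "AE \<omega> in M. Z i j \<omega> \<in> cube dZ" if "1 \<le> i" "j \<in> {1..\<E>}" for i j
  proof -
    have "cube dZ \<in> sets (Rvec dZ)" unfolding cube_def by (intro sets_PiM_I_finite) auto
    moreover have "AE y in distr M (Rvec dZ) (Z i j). y \<in> cube dZ" unfolding Z_distr[OF that] by (rule PZ(3))
    ultimately show ?thesis using Z_rv[OF that] by (subst (asm) AE_distr_iff) auto
  qed
  have gen_sub: "generators M borel X J \<subseteq> events" for J by (auto simp: generators_def)
  have genZ_sub: "generators M (Rvec dZ) (\<lambda>(i, j). Z i j) ({1..n} \<times> {1..\<E>}) \<subseteq> events" for n
    using Z_rv by (auto simp: generators_def intro!: measurable_sets)

  \<comment> \<open>Probability of a large error for fixed numbers of data and generated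
    points\<close>
  let ?bad = "\<lambda>n N. {\<omega> \<in> space M. \<bar>empirical_cdf (ghat n \<omega>) (\<lambda>j. Zs j \<omega>) N (Y \<omega>) - cdf \<nu> (Y \<omega>)\<bar> \<ge> \<rho>}"
  have main: "prob (?bad n N) \<le> b n + (real (Suc m) * 16 / \<rho>\<^sup>2) / real N"
    if n: "n \<ge> 1" and N: "N \<ge> 1"
      and g0: "?PG n" and critic: "?PC n" and ent: "?PE n" for n N
  proof -
    let ?G = "networks (Lg n) (pg n) (sg n) (F n)"
    define I where "I = {1..n} \<times> {1..\<E>}"
    define Zp where "Zp = (\<lambda>(i, j). Z i j)"
    have I: "finite I" "I \<noteq> {}" "card I = n * \<E>" using n E by (simp_all add: I_def)
    have Zp_indep: "indep_vars (\<lambda>_. Rvec dZ) Zp I"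
      unfolding Zp_def by (rule indep_vars_subset[OF Z_indep]) (auto simp: I_def)
    have Zp_distr: "distr M (Rvec dZ) (Zp p) = PZ" if "p \<in> I" for p
      using that Z_distr by (auto simp: I_def Zp_def)
    have Zp_rv [measurable]: "random_variable (Rvec dZ) (Zp p)" if "p \<in> I" for p
      using that Z_rv by (auto simp: I_def Zp_def)
    obtain Q where Q: "Q > 0" "cover_radius dZ (nat \<lfloor>sg n\<rfloor>) (Lg n) Q \<le> \<epsilon>"
      "real (cover_size dZ (nat \<lfloor>sg n\<rfloor>) (Lg n) Q) \<le> exp (\<epsilon>\<^sup>2 * real (n * \<E>))" using ent by blast
    obtain CC where CC: "finite CC"
      "card CC \<le> cover_size dZ (nat \<lfloor>sg n\<rfloor>) (Lg n) Q"
      "CC \<subseteq> borel_measurable (Rvec dZ)"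
      "\<forall>p s F. \<forall>h\<in>networks (Lg n) p s F. p 0 = dZ \<longrightarrow> p (Suc (Lg n)) = 1 \<longrightarrow> nat \<lfloor>s\<rfloor> \<le> nat \<lfloor>sg n\<rfloor> \<longrightarrow>
        (\<exists>c\<in>CC. \<forall>x\<in>cube dZ. \<bar>h x 0 - c x\<bar> \<le> cover_radius dZ (nat \<lfloor>sg n\<rfloor>) (Lg n) Q)"
      using network_cover[OF Q(1), where r = dZ and m = "nat \<lfloor>sg n\<rfloor>" and L = "Lg n"]
      by - (elim exE conjE, rule that)
    have cover: "\<exists>c\<in>CC. \<forall>x\<in>cube dZ. \<bar>h x 0 - c x\<bar> \<le> \<epsilon>" if h: "h \<in> ?G" for h
    proof -
      obtain c where c: "c \<in> CC"
        "\<forall>x\<in>cube dZ. \<bar>h x 0 - c x\<bar> \<le> cover_radius dZ (nat \<lfloor>sg n\<rfloor>) (Lg n) Q"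
        using CC(4)[rule_format, OF h] pg_ends[OF n] by auto
      show ?thesis
        by (rule bexI[OF _ c(1)], rule ballI, rule order_trans[OF c(2)[rule_format] Q(2)])
    qed
    have cardCC: "real (card CC) \<le> exp (\<epsilon>\<^sup>2 * real (n * \<E>))"
      using of_nat_mono[OF CC(2), where 'a = real] Q(3) by linarith

    define S1 where "S1 k = {\<omega> \<in> space M. \<bar>(\<Sum>i=1..n. indicator {..real k / m'} (X (int i) \<omega>)) / n
        - cdf \<nu> (real k / m')\<bar> \<ge> \<eta>}" for k :: nat
    define S2 where "S2 k = {\<omega> \<in> space M. \<bar>(\<Sum>p\<in>I. indicator {..real k / m'} (gs (Zp p \<omega>))) / card I
        - cdf \<nu> (real k / m')\<bar> \<ge> \<eta>}" for k :: nat
    \<comment> \<open>Hoeffding's inequality cannot be applied to \<open>ghat n\<close> itself,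
      which is a function of the same \<open>Z i j\<close>. Cover members are deterministic
      functions, so all of them are controlled at once.\<close>
    define S3 where "S3 = (\<lambda>(c, k). {\<omega> \<in> space M. \<bar>(\<Sum>p\<in>I. ramp m k (c (Zp p \<omega>))) / card I
        - (\<integral>y. ramp m k (c y) \<partial>PZ)\<bar> \<ge> \<epsilon>})"
    define S4 where "S4 k = {\<omega> \<in> space M. \<bar>(\<Sum>j=1..N. indicator {..real k / m} (ghat n \<omega> (Zs j \<omega>) 0)) / N
        - (\<integral>y. indicator {..real k / m} (ghat n \<omega> y 0) \<partial>PZ)\<bar> \<ge> \<rho> / 4}" for k :: nat

    have S1: "S1 k \<in> events" "prob (S1 k) \<le> B / (real n * \<eta>\<^sup>2)" for k
      unfolding S1_def cdf_def using B[OF n _ \<eta>, of "{..real k / m'}"] by (simp_all add: \<nu>X)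
    have S2: "S2 k \<in> events" "prob (S2 k) \<le> 2 * exp (- 2 * real (n * \<E>) * \<eta>\<^sup>2)" for k
    proof -
      show "S2 k \<in> events" unfolding S2_def by measurable
      have "(\<lambda>y. indicator {..real k / m'} (gs y) :: real) \<in> borel_measurable (Rvec dZ)" by measurable
      from iid_mean_deviation[OF I(1,2) Zp_indep Zp_distr this _ _ less_imp_le[OF \<eta>]]
      show "prob (S2 k) \<le> 2 * exp (- 2 * real (n * \<E>) * \<eta>\<^sup>2)"
        unfolding S2_def gs_cdf by (simp add: I(3))
    qed
    have S3: "S3 ck \<in> events" "prob (S3 ck) \<le> 2 * exp (- 2 * real (n * \<E>) * \<epsilon>\<^sup>2)" if "ck \<in> CC \<times> {..<m}" for ck
    proof -
      obtain c k where ck: "ck = (c, k)" "c \<in> CC" using \<open>ck \<in> CC \<times> {..<m}\<close> by auto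
      then have [measurable]: "c \<in> borel_measurable (Rvec dZ)" using CC(3) by blast
      show "S3 ck \<in> events" unfolding S3_def ck(1) prod.case by measurable
      have "(\<lambda>y. ramp m k (c y)) \<in> borel_measurable (Rvec dZ)" by measurable
      moreover have "ramp m k y \<le> 1" for y
      proof -
        have "1 / real m \<le> 1" using m(1) by simp
        with ramp_bounds(2)[OF m(1), of k y] show ?thesis by linarith
      qed
      ultimately show "prob (S3 ck) \<le> 2 * exp (- 2 * real (n * \<E>) * \<epsilon>\<^sup>2)"
        using iid_mean_deviation[OF I(1,2) Zp_indep Zp_distr _ _ _ less_imp_le[OF \<epsilon>], of "\<lambda>y. ramp m k (c y)"]
          ramp_bounds(1)[OF m(1)]
        unfolding S3_def ck(1) by (simp add: I(3))
    qed
    \<comment> \<open>The estimator is determined by \<open>D\<close>, and the fresh sample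
      \<open>Zs\<close> is independent of it; hence the averages over \<open>Zs\<close> concentrate
      around integrals under \<open>PZ\<close> with the estimator held fixed.\<close>
    define D where "D = data_algebra M dZ \<E> X Z n"
    have D_gen: "generators M borel X {1..int n} \<union>
        generators M (Rvec dZ) (\<lambda>(i, j). Z i j) ({1..n} \<times> {1..\<E>}) \<subseteq> events"
      using gen_sub genZ_sub by blast
    have D_sets: "sets D = sigma_sets (space M) (generators M borel X {1..int n} \<union>
        generators M (Rvec dZ) (\<lambda>(i, j). Z i j) ({1..n} \<times> {1..\<E>}))" and D_space: "space D = space M"
      unfolding D_def data_algebra_def using D_gen sets.space_closed
      by (auto intro!: sets_measure_of space_measure_of)
    have D_events: "sets D \<subseteq> events" unfolding D_sets using D_gen by (rule sets.sigma_sets_subset)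
    have D_indep: "indep_set (sets D) (sigma_sets (space M) (generators M (Rvec dZ) Zs {1..}))"
    proof -
      have "sets D \<subseteq> sigma_sets (space M) (generators M borel X UNIV \<union>
             generators M (Rvec dZ) (\<lambda>(i, j). Z i j) ({1..} \<times> {1..\<E>}))"
        unfolding D_sets by (rule sigma_sets_mono') (auto simp: generators_def)
      with XZ_Zs_indep show ?thesis unfolding indep_sets2_eq by blast
    qed
    have S4: "S4 k \<in> events" "prob (S4 k) \<le> 1 / (real N * (\<rho> / 4)\<^sup>2)" for k
    proof -
      have "(\<lambda>(\<omega>, y). indicator {..real k / m} (ghat n \<omega> y 0) :: real) \<in> borel_measurable (D \<Otimes>\<^sub>M Rvec dZ)"
      proof -
        have "(\<lambda>p. (\<lambda>(\<omega>, y). ghat n \<omega> y 0) p) \<in> borel_measurable (D \<Otimes>\<^sub>M Rvec dZ)"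
          using ghat_measurable[OF n] by (simp add: D_def)
        then have "(\<lambda>p. indicator {..real k / m} ((\<lambda>(\<omega>, y). ghat n \<omega> y 0) p) :: real) \<in> borel_measurable (D \<Otimes>\<^sub>M Rvec dZ)"
          by measurable
        then show ?thesis by (simp add: case_prod_beta')
      qed
      note cmd = conditional_mean_deviation[OF D_space D_events Zs_indep Zs_distr D_indep this _ _ N]
      show "S4 k \<in> events" unfolding S4_def by (rule cmd(1)) (use rho in \<open>simp_all add: indicator_def\<close>)
      show "prob (S4 k) \<le> 1 / (real N * (\<rho> / 4)\<^sup>2)"
        unfolding S4_def by (rule cmd(2)) (use rho in \<open>simp_all add: indicator_def\<close>)
    qed

    \<comment> \<open>Union bounds for the exceptional events\<close>
    define U1 where "U1 = (\<Union>k\<in>{..<m'}. S1 k)"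
    define U2 where "U2 = (\<Union>k\<in>{..<m'}. S2 k)"
    define U3 where "U3 = (\<Union>ck\<in>CC \<times> {..<m}. S3 ck)"
    define U4 where "U4 = (\<Union>k\<in>{..m}. S4 k)"
    have U1: "U1 \<in> events" "prob U1 \<le> real m' * (B / (real n * \<eta>\<^sup>2))"
      unfolding U1_def using S1(1) prob_UN_le[of "{..<m'}" S1, OF _ S1] by simp_all
    have U2: "U2 \<in> events" "prob U2 \<le> real m' * (2 * exp (- 2 * real (n * \<E>) * \<eta>\<^sup>2))"
      unfolding U2_def using S2(1) prob_UN_le[of "{..<m'}" S2, OF _ S2] by simp_all
    have U3: "U3 \<in> events" "prob U3 \<le> 2 * real m * exp (- \<epsilon>\<^sup>2 * real (n * \<E>))"
    proof -
      have fin: "finite (CC \<times> {..<m})" using CC(1) by simp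
      show "U3 \<in> events" unfolding U3_def using S3(1) fin by (intro sets.finite_UN) auto
      have "prob U3 \<le> real (card (CC \<times> {..<m})) * (2 * exp (- 2 * real (n * \<E>) * \<epsilon>\<^sup>2))"
        unfolding U3_def by (rule prob_UN_le[OF fin S3])
      also have "\<dots> = 2 * real m * (real (card CC) * exp (- 2 * real (n * \<E>) * \<epsilon>\<^sup>2))"
        by (simp add: card_cartesian_product)
      also have "\<dots> \<le> 2 * real m * (exp (\<epsilon>\<^sup>2 * real (n * \<E>)) * exp (- 2 * real (n * \<E>) * \<epsilon>\<^sup>2))"
        using cardCC by (intro mult_left_mono mult_right_mono) auto
      also have "exp (\<epsilon>\<^sup>2 * real (n * \<E>)) * exp (- 2 * real (n * \<E>) * \<epsilon>\<^sup>2) = exp (- \<epsilon>\<^sup>2 * real (n * \<E>))"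
        unfolding exp_add[symmetric] by (simp add: algebra_simps)
      finally show "prob U3 \<le> 2 * real m * exp (- \<epsilon>\<^sup>2 * real (n * \<E>))" .
    qed
    have U4: "U4 \<in> events" "prob U4 \<le> (real (Suc m) * 16 / \<rho>\<^sup>2) / real N"
    proof -
      show "U4 \<in> events" unfolding U4_def using S4(1) by auto
      have "prob U4 \<le> real (card {..m}) * (1 / (real N * (\<rho> / 4)\<^sup>2))"
        unfolding U4_def by (rule prob_UN_le[OF _ S4]) simp
      then show "prob U4 \<le> (real (Suc m) * 16 / \<rho>\<^sup>2) / real N"
        by (simp add: power_divide field_simps)
    qed

    \<comment> \<open>\<open>Y\<close> and the \<open>Z i j\<close> lie in the unit interval and the
      cube only almost surely, so the large-error event is contained in the exceptional events only
      up to a null set.\<close>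
    have "AE \<omega> in M. \<forall>p\<in>I. Zp p \<omega> \<in> cube dZ"
      using I(1) Z_cube by (intro AE_finite_allI) (auto simp: I_def Zp_def)
    with Y01 have "AE \<omega> in M. \<omega> \<in> ?bad n N
        \<longrightarrow> \<omega> \<in> U1 \<union> U2 \<union> U3 \<union> U4"
    proof eventually_elim
      case (elim \<omega>)
      show ?case
      proof (intro impI, rule ccontr)
        assume bad: "\<omega> \<in> ?bad n N"
          and "\<omega> \<notin> U1 \<union> U2 \<union> U3 \<union> U4"
        then have \<omega>: "\<omega> \<in> space M" "\<omega> \<notin> U1" "\<omega> \<notin> U2" "\<omega> \<notin> U3" "\<omega> \<notin> U4" by auto
        have gh: "ghat n \<omega> \<in> ?G" using ghat_min[OF n \<omega>(1)] by (simp add: is_arg_min_def)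
        obtain g1 where g1: "g1 \<in> ?G" "\<And>y. y \<in> cube dZ \<Longrightarrow> g1 y 0 = f0 y" using g0 by blast
        obtain c where c: "c \<in> CC" "\<And>y. y \<in> cube dZ \<Longrightarrow> \<bar>ghat n \<omega> y 0 - c y\<bar> \<le> \<epsilon>"
          using cover[OF gh] by blast
        \<comment> \<open>\<open>\<rho> / 8\<close> is the modulus over two grid steps, the first
          \<open>\<rho> / 4\<close> the ramp error, the second the fluctuation of the fresh sample.
          Their sum stays strictly below \<open>\<rho>\<close>.\<close>
        have "\<bar>empirical_cdf (ghat n \<omega>) (\<lambda>j. Zs j \<omega>) N (Y \<omega>) - cdf \<nu> (Y \<omega>)\<bar> \<le> \<rho> / 8 + \<rho> / 4 + \<rho> / 4"
        proof (rule good_sample_cdf_close[where x = "\<lambda>i. X (int i) \<omega>" and z = "\<lambda>i j. Z i j \<omega>"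
              and ?g0.0 = g1 and gs = gs and c = c and \<epsilon> = \<epsilon> and \<eta> = \<eta> and r = dZ and PZ = PZ
              and C = "?C n" and G = ?G and gh = "ghat n \<omega>",
              OF n E m(1) m'(1) \<nu>_rd \<nu>01])
          show "cdf \<nu> t = 0" if "t < 0" for t
            using cdf_uniform_modulus(1)[OF \<nu>_rd cont\<nu> \<nu>01 zero_less_one that] .
          show "cdf \<nu> t = 1" if "1 \<le> t" for t
            using cdf_uniform_modulus(2)[OF \<nu>_rd cont\<nu> \<nu>01 zero_less_one that] .
          show "h y = vec1 (h y 0)" if "h \<in> ?G" for h y
            using network_output_vec1[OF that] pg_ends[OF n] by simp
          show "(\<lambda>y. ghat n \<omega> y 0) \<in> borel_measurable (Rvec dZ)"
            using network_measurable[OF gh] pg_ends[OF n] by simp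
          show "\<bar>g1 y 0 - gs y\<bar> \<le> \<epsilon>" if "y \<in> cube dZ" for y
            using f0(2)[OF that] g1(2)[OF that] by simp
          show "\<exists>h\<in>lip1_critics (?C n). \<forall>y. h (vec1 y) 0 = \<sigma> * ramp m k y"
            if "k < m" "\<sigma> \<in> {1, -1}" for k \<sigma> using critic that by blast
          show "X (int i) \<omega> \<in> {0..1}" for i using X_range[OF \<omega>(1)] .
          show "Z i j \<omega> \<in> cube dZ" if "i \<in> {1..n}" "j \<in> {1..\<E>}" for i j
            using elim(2) that by (auto simp: I_def Zp_def)
          show "\<bar>(\<Sum>i\<in>{1..n}. indicator {..real k / m'} (X (int i) \<omega>)) / card {1..n} - cdf \<nu> (real k / m')\<bar> \<le> \<eta>"
            if "k < m'" for k
          proof -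
            have "\<omega> \<notin> S1 k" using \<omega>(2) that by (auto simp: U1_def)
            then show ?thesis using \<omega>(1) by (simp add: S1_def)
          qed
          show "\<bar>(\<Sum>(i, j)\<in>{1..n} \<times> {1..\<E>}. indicator {..real k / m'} (gs (Z i j \<omega>))) /
              card ({1..n} \<times> {1..\<E>}) - cdf \<nu> (real k / m')\<bar> \<le> \<eta>" if "k < m'" for k
          proof -
            have "\<omega> \<notin> S2 k" using \<omega>(3) that by (auto simp: U2_def)
            then show ?thesis
              using \<omega>(1) unfolding S2_def I_def[symmetric] by (simp add: Zp_def case_prod_beta')
          qed
          show "c \<in> borel_measurable (Rvec dZ)" using c(1) CC(3) by blast
          show "\<bar>(\<Sum>(i, j)\<in>{1..n} \<times> {1..\<E>}. ramp m k (c (Z i j \<omega>))) / card ({1..n} \<times> {1..\<E>})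
              - (\<integral>y. ramp m k (c y) \<partial>PZ)\<bar> \<le> \<epsilon>" if "k < m" for k
          proof -
            have "\<omega> \<notin> S3 (c, k)" using \<omega>(4) that c(1) by (auto simp: U3_def)
            then show ?thesis
              using \<omega>(1) unfolding S3_def I_def[symmetric] by (simp add: Zp_def case_prod_beta')
          qed
          show "\<bar>empirical_cdf (ghat n \<omega>) (\<lambda>j. Zs j \<omega>) N (real k / m)
              - (\<integral>y. indicator {..real k / m} (ghat n \<omega> y 0) \<partial>PZ)\<bar> \<le> \<rho> / 4" if "k \<le> m" for k
          proof -
            have "\<omega> \<notin> S4 k" using \<omega>(5) that by (auto simp: U4_def)
            then show ?thesis using \<omega>(1) by (simp add: S4_def empirical_cdf_def)
          qed
        qed (use m(2) PZ ghat_min[OF n \<omega>(1)] g1(1) gs01 c(2) empirical_cdf_mono empirical_cdf_bounds tol rho elim(1)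
            in \<open>simp_all\<close>)
        with bad rho show False by simp
      qed
    qed
    then have "prob (?bad n N) \<le> prob (U1 \<union> U2 \<union> U3 \<union> U4)"
      using U1 U2 U3 U4 by (intro finite_measure_mono_AE) auto
    also have "\<dots> \<le> prob U1 + prob U2 + prob U3 + prob U4"
      using U1(1) U2(1) U3(1) U4(1)
      by (intro order_trans[OF measure_Un_le] add_mono) auto
    also have "\<dots> \<le> b n + (real (Suc m) * 16 / \<rho>\<^sup>2) / real N"
      unfolding b_def using U1(2) U2(2) U3(2) U4(2) by linarith
    finally show ?thesis .
  qed

  \<comment> \<open>The double limit\<close>
  show ?thesis
    unfolding \<nu>_def[symmetric]
  proof (rule limsup_limsup_eq_0[OF _ b_lim])
    show "eventually (\<lambda>n. \<forall>N\<ge>1. prob (?bad n N) \<le> b n + (real (Suc m) * 16 / \<rho>\<^sup>2) / real N) at_top"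
      using evG evC evE eventually_ge_at_top[of 1]
    proof eventually_elim
      case (elim n)
      then show ?case using main[of n] by blast
    qed
  qed simp
qed

end
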